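(* Let $c>\frac12$ be a constant. Then for any $p=p(n)$ with $\frac{c\ln n}{n}<p<\frac12$, the giant component of $G(n,p)$ is almost surely non-singular; that is, the probability that the adjacency matrix of the giant component of $G(n,p)$ is non-singular tends to $1$ as $n\to\infty$.
   Context: $G(n,p)$ is the Erdős–Rényi random graph on the vertex set $\{1,\dots,n\}$: each pair of distinct vertices is joined by an edge independently with probability $p$. It is well known that for $p\ge c\ln n/n$ with $c>1/2$ the graph $G(n,p)$ consists, with probability tending to $1$, of one large connected component (the giant component, i.e. the largest connected component) together with some isolated vertices. The adjacency matrix of a graph is the symmetric $(0,1)$ matrix, indexed by its vertices, whose $ij$ entry is $1$ if and only if $i$ and $j$ are adjacent; a graph is called non-singular if its adjacency matrix is non-singular over the real numbers. "Almost surely" means with probability tending to $1$ as $n\to\infty$. *)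

theory Defs
  imports "HOL-Probability.Probability" "Jordan_Normal_Form.Determinant"
begin

type_synonym ugraph = "nat set \<times> nat set set"

abbreviation verts :: "ugraph \<Rightarrow> nat set" where
  "verts G \<equiv> fst G"

abbreviation edges :: "ugraph \<Rightarrow> nat set set" where
  "edges G \<equiv> snd G"

definition all_pairs :: "nat set \<Rightarrow> nat set set" where
  "all_pairs V = {e. e \<subseteq> V \<and> card e = 2}"

definition adjacent :: "ugraph \<Rightarrow> nat \<Rightarrow> nat \<Rightarrow> bool" where
  "adjacent G u v \<longleftrightarrow> {u, v} \<in> edges G"

text \<open>One independent coin per unordered pair; \<open>bernoulli_pmf\<close> truncates a parameter
  outside \<open>[0, 1]\<close>.\<close>

definition random_graph :: "nat \<Rightarrow> real \<Rightarrow> ugraph pmf" where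
  "random_graph n p =
     map_pmf (\<lambda>X. ({1..n}, {e \<in> all_pairs {1..n}. X e}))
       (Pi_pmf (all_pairs {1..n}) False (\<lambda>_. bernoulli_pmf p))"

definition connectivity :: "ugraph \<Rightarrow> nat rel" where
  "connectivity G = {(u, v). u \<in> verts G \<and> v \<in> verts G \<and> (adjacent G)\<^sup>*\<^sup>* u v}"

definition induced_subgraph :: "ugraph \<Rightarrow> nat set \<Rightarrow> ugraph" where
  "induced_subgraph G C = (C, {e \<in> edges G. e \<subseteq> C})"

definition connected_components :: "ugraph \<Rightarrow> ugraph set" where
  "connected_components G = induced_subgraph G ` (verts G // connectivity G)"

text \<open>A component with the largest number of vertices; a tie is broken by an arbitrary
  choice.\<close>

definition giant_component :: "ugraph \<Rightarrow> ugraph" where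
  "giant_component G = (ARG_MAX (\<lambda>H. card (verts H)) H. H \<in> connected_components G)"

text \<open>Matrix indices start at 0 and the vertices are listed in increasing order; another
  order conjugates the matrix by a permutation matrix, so singularity does not depend on it.\<close>

definition adjacency_matrix :: "ugraph \<Rightarrow> real mat" where
  "adjacency_matrix G =
     (let vs = sorted_list_of_set (verts G)
      in Matrix.mat (length vs) (length vs)
           (\<lambda>(i, j). if adjacent G (vs ! i) (vs ! j) then 1 else 0))"

definition nonsingular :: "ugraph \<Rightarrow> bool" where
  "nonsingular G \<longleftrightarrow> invertible_mat (adjacency_matrix G)"

end

theory Submission
  imports Defs "HOL-Real_Asymp.Real_Asymp"
begin

text \<open>Call a vector indexed by the vertices small if its support has at most \<open>n / 200\<close> elements. A first moment computation over supports shows that with high probability every kernel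
  vector whose support is minimal and has at least two elements fails to be small; the case of supports of
  size two (two leaves with a common neighbour) is where \<open>c > 1 / 2\<close> is needed.

  Kernel vectors that are not small are excluded by deleting a vertex \<open>i\<close> in the support. If
  \<open>A'\<close> is the remaining matrix and \<open>x\<close> is the row of \<open>i\<close>, then \<open>A' y = - x\<close> and \<open>x \<bullet> y = 0\<close> for
  some \<open>y\<close>. If \<open>A'\<close> has a kernel vector \<open>u\<close> that is not small, then \<open>x \<bullet> u = 0\<close>, which is unlikely
  by the Littlewood--Offord inequality because \<open>x\<close> is independent of \<open>A'\<close>. Otherwise \<open>A'\<close> is
  invertible on the vertices that are not isolated, and \<open>x\<close> is a zero of the quadratic form of this
  inverse. Most rows of the inverse are not small (first moment again), so this is unlikely by a
  quadratic Littlewood--Offord inequality. Since every vertex is in the support of a kernel vector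
  with small probability, by Markov's inequality there is no kernel vector with large support.

  Hence the kernel lives on the isolated vertices. This is a statement about all components with at
  least two vertices, so the uniqueness of the giant component plays no role.\<close>

subsection \<open>Independent coins\<close>

text \<open>The first moment over supports \<open>S\<close> needs two mechanisms. While
  \<open>card S * p\<close> is at most 1 / 10, a row rarely meets \<open>S\<close> twice, and the
  combinatorial pattern suffices: no row has exactly one neighbour in \<open>S\<close>, yet
  minimality of the support forces at least \<open>card S - 1\<close> nonzero rows. Beyond that,
  rows meeting \<open>S\<close> often are no longer rare, and independence can be used only once the
  kernel vector is known. At most \<open>card S\<close> rows determine it and the others are fresh,
  at the price of a second binomial coefficient. The threshold n / 200 is small enough for both
  coefficients to lose against the factor \<open>exp (- 2 / 25)\<close> gained from each fresh row.
  A row of the inverse solves a kernel equation with one row exempted, so the same first moment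
  covers it; this is why a set \<open>D\<close> of exempted rows is carried along. For p below ln n
  / n isolated vertices usually exist, so the matrix has a trivial kernel part that every argument
  must split off. A minimal support of size one is such a vertex, or a leaf whose only neighbour is
  the exempted row.\<close>

lemma expectation_pair_pmf:
  fixes f :: "'a \<Rightarrow> 'b \<Rightarrow> real"
  assumes "finite (set_pmf M)" "finite (set_pmf N)"
  shows "measure_pmf.expectation (pair_pmf M N) (\<lambda>(x, y). f x y) =
    measure_pmf.expectation M (\<lambda>x. measure_pmf.expectation N (f x))"
proof -
  have "measure_pmf.expectation (pair_pmf M N) (\<lambda>(x, y). f x y) =
    (\<Sum>z\<in>set_pmf M \<times> set_pmf N. (case z of (x, y) \<Rightarrow> f x y) * pmf (pair_pmf M N) z)"
    using assms by (intro integral_measure_pmf_real) auto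
  also have "\<dots> = (\<Sum>x\<in>set_pmf M. \<Sum>y\<in>set_pmf N. f x y * (pmf M x * pmf N y))"
    unfolding sum.cartesian_product by (intro sum.cong) (auto simp: pmf_pair)
  also have "\<dots> = (\<Sum>x\<in>set_pmf M. measure_pmf.expectation N (f x) * pmf M x)"
    by (intro sum.cong refl, subst integral_measure_pmf_real[OF assms(2)])
       (auto simp: sum_distrib_left sum_distrib_right mult_ac)
  also have "\<dots> = measure_pmf.expectation M (\<lambda>x. measure_pmf.expectation N (f x))"
    by (rule integral_measure_pmf_real[symmetric]) (use assms in auto)
  finally show ?thesis .
qed

lemma prob_eq_expectation:
  "measure_pmf.prob M {x. P x} = measure_pmf.expectation M (\<lambda>x. of_bool (P x) :: real)"
proof -
  have "(\<lambda>x. of_bool (P x) :: real) = indicator {x. P x}"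
    by (auto simp: indicator_def)
  thus ?thesis by simp
qed

lemma prob_pair_pmf:
  assumes "finite (set_pmf M)" "finite (set_pmf N)"
  shows "measure_pmf.prob (pair_pmf M N) {(x, y). P x y} =
    measure_pmf.expectation M (\<lambda>x. measure_pmf.prob N {y. P x y})"
proof -
  have "measure_pmf.prob (pair_pmf M N) {(x, y). P x y} =
      measure_pmf.expectation (pair_pmf M N) (\<lambda>(x, y). of_bool (P x y))"
    using prob_eq_expectation[of "pair_pmf M N" "\<lambda>(x, y). P x y"]
    by (simp add: case_prod_unfold)
  also have "\<dots> = measure_pmf.expectation M (\<lambda>x. measure_pmf.prob N {y. P x y})"
    by (subst expectation_pair_pmf[OF assms]) (simp add: prob_eq_expectation)
  finally show ?thesis .
qed

lemma expectation_pmf_mono: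
  fixes f g :: "'a \<Rightarrow> real"
  assumes "finite (set_pmf M)" "\<And>x. x \<in> set_pmf M \<Longrightarrow> f x \<le> g x"
  shows "measure_pmf.expectation M f \<le> measure_pmf.expectation M g"
  by (intro integral_mono_AE integrable_measure_pmf_finite assms)
     (auto simp: AE_measure_pmf_iff assms)

lemma expectation_pmf_le:
  fixes f :: "'a \<Rightarrow> real"
  assumes "finite (set_pmf M)" "\<And>x. x \<in> set_pmf M \<Longrightarrow> f x \<le> c"
  shows "measure_pmf.expectation M f \<le> c"
  using expectation_pmf_mono[of M f "\<lambda>_. c"] assms by simp

lemma prob_mono:
  assumes "\<And>x. x \<in> set_pmf M \<Longrightarrow> P x \<Longrightarrow> Q x"
  shows "measure_pmf.prob M {x. P x} \<le> measure_pmf.prob M {x. Q x}"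
  by (rule measure_pmf.finite_measure_mono_AE) (auto simp: AE_measure_pmf_iff assms)

lemma prob_disj_le:
  "measure_pmf.prob M {x. P x \<or> Q x} \<le> measure_pmf.prob M {x. P x} + measure_pmf.prob M {x. Q x}"
  using measure_Un_le[of "{x. P x}" "measure_pmf M" "{x. Q x}"]
  by (simp add: Collect_disj_eq)

lemma prob_ex_le:
  assumes "finite I"
  shows "measure_pmf.prob M {x. \<exists>i\<in>I. P i x} \<le> (\<Sum>i\<in>I. measure_pmf.prob M {x. P i x})"
proof -
  have "{x. \<exists>i\<in>I. P i x} = (\<Union>i\<in>I. {x. P i x})" by auto
  thus ?thesis
    using measure_pmf.finite_measure_subadditive_finite[of I "\<lambda>i. {x. P i x}" M] assms by simp
qed

lemma markov_card:
  fixes a :: real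
  assumes "finite (set_pmf M)" "finite I" "a > 0"
  shows "measure_pmf.prob M {x. real (card {i \<in> I. P i x}) \<ge> a}
    \<le> (\<Sum>i\<in>I. measure_pmf.prob M {x. P i x}) / a"
proof -
  have "measure_pmf.prob M {x. real (card {i \<in> I. P i x}) \<ge> a} \<le>
      measure_pmf.expectation M (\<lambda>x. (\<Sum>i\<in>I. of_bool (P i x)) / a)"
    unfolding prob_eq_expectation
  proof (rule expectation_pmf_mono[OF assms(1)])
    fix x
    have "real (card {i \<in> I. P i x}) = (\<Sum>i\<in>I. of_bool (P i x))"
      using assms(2) by (simp add: Int_def)
    thus "of_bool (real (card {i \<in> I. P i x}) \<ge> a) \<le> ((\<Sum>i\<in>I. of_bool (P i x)) / a :: real)"
      using assms(3) by (auto simp: of_bool_def)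
  qed
  also have "\<dots> = (\<Sum>i\<in>I. measure_pmf.prob M {x. P i x}) / a"
    by (simp add: prob_eq_expectation integrable_measure_pmf_finite[OF assms(1)])
  finally show ?thesis .
qed

definition coin_pmf :: "'a set \<Rightarrow> real \<Rightarrow> ('a \<Rightarrow> bool) pmf" where
  "coin_pmf I p = Pi_pmf I False (\<lambda>_. bernoulli_pmf p)"

lemma finite_set_coin_pmf [simp]: "finite I \<Longrightarrow> finite (set_pmf (coin_pmf I p))"
  unfolding coin_pmf_def by (simp add: set_Pi_pmf finite_PiE_dflt)

lemma set_coin_pmfD: "finite I \<Longrightarrow> X \<in> set_pmf (coin_pmf I p) \<Longrightarrow> X i \<Longrightarrow> i \<in> I"
  unfolding coin_pmf_def using set_Pi_pmf_subset[of I False] by fastforce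

text \<open>Every conditioning in the proof goes through this form of Fubini: \<open>f\<close> holds
  the coins that are fixed, \<open>g\<close> those that stay random. Both are full families of coins
  on \<open>I\<close>, of which only one part each is read, so no restricted distributions appear
  later.\<close>

lemma coin_pmf_resample:
  assumes "finite I"
  shows "coin_pmf I p =
    map_pmf (\<lambda>(f, g) i. if i \<in> J then f i else g i) (pair_pmf (coin_pmf I p) (coin_pmf I p))"
proof -
  let ?m = "\<lambda>(A::'a set) f i. if i \<in> A then f i else False"
  have fin: "finite (I \<inter> J)" "finite (I - J)" using assms by auto
  have "coin_pmf I p = coin_pmf ((I \<inter> J) \<union> (I - J)) p"
    by (simp add: Int_Diff_Un)
  also have "\<dots> = map_pmf (\<lambda>(f, g) x. if x \<in> I \<inter> J then f x else g x)
       (pair_pmf (coin_pmf (I \<inter> J) p) (coin_pmf (I - J) p))"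
    unfolding coin_pmf_def by (rule Pi_pmf_union[OF fin]) auto
  also have "coin_pmf (I \<inter> J) p = map_pmf (?m (I \<inter> J)) (coin_pmf I p)"
    unfolding coin_pmf_def by (rule Pi_pmf_subset) (use assms in auto)
  also have "coin_pmf (I - J) p = map_pmf (?m (I - J)) (coin_pmf I p)"
    unfolding coin_pmf_def by (rule Pi_pmf_subset) (use assms in auto)
  also have "map_pmf (\<lambda>(f, g) x. if x \<in> I \<inter> J then f x else g x)
       (pair_pmf (map_pmf (?m (I \<inter> J)) (coin_pmf I p)) (map_pmf (?m (I - J)) (coin_pmf I p)))
     = map_pmf (\<lambda>(f, g) i. if i \<in> J then f i else g i) (pair_pmf (coin_pmf I p) (coin_pmf I p))"
    unfolding map_pair[symmetric] map_pmf_comp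
    by (intro map_pmf_cong refl) (auto simp: fun_eq_iff dest: set_coin_pmfD[OF assms])
  finally show ?thesis .
qed

lemma expectation_coin_resample:
  fixes F :: "('a \<Rightarrow> bool) \<Rightarrow> real"
  assumes "finite I"
  shows "measure_pmf.expectation (coin_pmf I p) F =
    measure_pmf.expectation (coin_pmf I p) (\<lambda>f. measure_pmf.expectation (coin_pmf I p)
      (\<lambda>g. F (\<lambda>i. if i \<in> J then f i else g i)))"
  by (subst coin_pmf_resample[OF assms, of p J], subst integral_map_pmf)
     (simp add: case_prod_unfold expectation_pair_pmf[symmetric] assms)

lemma prob_coin_resample:
  assumes "finite I"
  shows "measure_pmf.prob (coin_pmf I p) {X. P X} =
    measure_pmf.expectation (coin_pmf I p) (\<lambda>f. measure_pmf.prob (coin_pmf I p)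
      {g. P (\<lambda>i. if i \<in> J then f i else g i)})"
  unfolding prob_eq_expectation by (rule expectation_coin_resample[OF assms])

text \<open>A bound on the conditional probability given the coins in \<open>J\<close>, uniform in
  their outcome, is a bound on the probability.\<close>

lemma prob_coin_condition_le:
  assumes "finite I"
    and "\<And>f. f \<in> set_pmf (coin_pmf I p) \<Longrightarrow>
      measure_pmf.prob (coin_pmf I p) {g. P (\<lambda>i. if i \<in> J then f i else g i)} \<le> c"
  shows "measure_pmf.prob (coin_pmf I p) {X. P X} \<le> c"
  by (subst prob_coin_resample[OF assms(1), of _ _ J]) (intro expectation_pmf_le, auto simp: assms)

text \<open>Plays the part of measurability with respect to the coins in \<open>J\<close>; disjoint
  sets \<open>J\<close> give independence.\<close>

definition depends_on :: "(('a \<Rightarrow> bool) \<Rightarrow> 'b) \<Rightarrow> 'a set \<Rightarrow> bool" where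
  "depends_on F J \<longleftrightarrow> (\<forall>X Y. (\<forall>i\<in>J. X i = Y i) \<longrightarrow> F X = F Y)"

lemma depends_onD: "depends_on F J \<Longrightarrow> (\<And>i. i \<in> J \<Longrightarrow> X i = Y i) \<Longrightarrow> F X = F Y"
  unfolding depends_on_def by blast

lemma depends_onI: "(\<And>X Y. (\<And>i. i \<in> J \<Longrightarrow> X i = Y i) \<Longrightarrow> F X = F Y) \<Longrightarrow> depends_on F J"
  unfolding depends_on_def by blast

lemma expectation_coin_mult:
  fixes F G :: "('a \<Rightarrow> bool) \<Rightarrow> real"
  assumes "finite I" "depends_on F J" "depends_on G K" "J \<inter> K = {}"
  shows "measure_pmf.expectation (coin_pmf I p) (\<lambda>X. F X * G X) =
    measure_pmf.expectation (coin_pmf I p) F * measure_pmf.expectation (coin_pmf I p) G"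
proof -
  have F: "F (\<lambda>i. if i \<in> J then f i else g i) = F f" for f g
    by (rule depends_onD[OF assms(2)]) auto
  have G: "G (\<lambda>i. if i \<in> J then f i else g i) = G g" for f g
    by (rule depends_onD[OF assms(3)]) (use assms(4) in auto)
  show ?thesis
    by (subst expectation_coin_resample[OF assms(1), of _ _ J]) (simp add: F G)
qed

lemma expectation_coin_prod:
  fixes F :: "'b \<Rightarrow> ('a \<Rightarrow> bool) \<Rightarrow> real"
  assumes "finite I" "finite W" "\<And>w. w \<in> W \<Longrightarrow> depends_on (F w) (J w)"
    "disjoint_family_on J W"
  shows "measure_pmf.expectation (coin_pmf I p) (\<lambda>X. \<Prod>w\<in>W. F w X) =
    (\<Prod>w\<in>W. measure_pmf.expectation (coin_pmf I p) (F w))"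
  using assms(2,3,4)
proof (induction W rule: finite_induct)
  case (insert w W)
  have dep: "depends_on (\<lambda>X. \<Prod>w\<in>W. F w X) (\<Union>w\<in>W. J w)"
  proof (rule depends_onI)
    fix X Y :: "'a \<Rightarrow> bool" assume "\<And>i. i \<in> (\<Union>w\<in>W. J w) \<Longrightarrow> X i = Y i"
    thus "(\<Prod>w\<in>W. F w X) = (\<Prod>w\<in>W. F w Y)"
      by (intro prod.cong refl depends_onD[OF insert.prems(1)]) auto
  qed
  have "J w \<inter> (\<Union>w\<in>W. J w) = {}"
    using insert.prems(2) insert.hyps(2) by (auto simp: disjoint_family_on_def)
  with expectation_coin_mult[OF assms(1) insert.prems(1)[of w] dep this] insert
  show ?case by (simp add: disjoint_family_on_insert)
qed simp

lemma expectation_coin: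
  fixes f :: "bool \<Rightarrow> real"
  assumes "finite I" "i \<in> I" "0 \<le> p" "p \<le> 1"
  shows "measure_pmf.expectation (coin_pmf I p) (\<lambda>X. f (X i)) = f True * p + f False * (1 - p)"
proof -
  have "map_pmf (\<lambda>X. X i) (coin_pmf I p) = bernoulli_pmf p"
    unfolding coin_pmf_def using Pi_pmf_component[OF assms(1), of i False] assms by simp
  from this[symmetric] show ?thesis
    using integral_bernoulli_pmf[OF assms(3,4), of f] by simp
qed

lemma expectation_coin_prod_single:
  fixes f :: "'a \<Rightarrow> bool \<Rightarrow> real"
  assumes "finite I" "J \<subseteq> I" "0 \<le> p" "p \<le> 1"
  shows "measure_pmf.expectation (coin_pmf I p) (\<lambda>X. \<Prod>i\<in>J. f i (X i)) =
    (\<Prod>i\<in>J. f i True * p + f i False * (1 - p))"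
proof -
  have "finite J" using assms finite_subset by blast
  have "measure_pmf.expectation (coin_pmf I p) (\<lambda>X. \<Prod>i\<in>J. f i (X i)) =
     (\<Prod>i\<in>J. measure_pmf.expectation (coin_pmf I p) (\<lambda>X. f i (X i)))"
    by (rule expectation_coin_prod[where J = "\<lambda>i. {i}"])
       (use assms \<open>finite J\<close> in \<open>auto simp: depends_on_def disjoint_family_on_def\<close>)
  also have "\<dots> = (\<Prod>i\<in>J. f i True * p + f i False * (1 - p))"
    using assms by (intro prod.cong refl expectation_coin) auto
  finally show ?thesis .
qed

lemma prob_coin_all_False:
  assumes "finite I" "J \<subseteq> I" "0 \<le> p" "p \<le> 1"
  shows "measure_pmf.prob (coin_pmf I p) {X. \<forall>i\<in>J. \<not> X i} = (1 - p) ^ card J"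
proof -
  have "finite J" using assms finite_subset by blast
  hence "(\<lambda>X. of_bool (\<forall>i\<in>J. \<not> X i)) = (\<lambda>X. \<Prod>i\<in>J. of_bool (\<not> X i) :: real)"
    by (auto simp: fun_eq_iff prod_zero_iff)
  thus ?thesis
    using expectation_coin_prod_single[OF assms, of "\<lambda>_ b. of_bool (\<not> b)"]
    by (simp add: prob_eq_expectation)
qed

lemma prob_coin_two:
  assumes "finite I" "i \<in> I" "j \<in> I" "i \<noteq> j" "0 \<le> p" "p \<le> 1"
  shows "measure_pmf.prob (coin_pmf I p) {X. X i \<and> X j} = p\<^sup>2"
  using expectation_coin_prod_single[of I "{i, j}" p "\<lambda>_ b. of_bool b"] assms
  by (simp add: prob_eq_expectation of_bool_conj power2_eq_square)

subsection \<open>The Littlewood--Offord inequality\<close>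

text \<open>Bound for the probability that a sum of \<open>m\<close> independent Bernoulli variables with nonzero
  coefficients takes one of \<open>r\<close> given values: the probability that the walk on the integers with
  steps \<open>1\<close> and \<open>-1\<close>, each of probability \<open>p\<close>, started in \<open>r\<close>, does not reach \<open>0\<close> within \<open>m\<close> steps.\<close>

fun survival :: "real \<Rightarrow> nat \<Rightarrow> nat \<Rightarrow> real" where
  "survival p m 0 = 0"
| "survival p 0 (Suc r) = 1"
| "survival p (Suc m) (Suc r) =
    p * (survival p m (Suc (Suc r)) + survival p m r) + (1 - 2 * p) * survival p m (Suc r)"

lemma survival_0: "survival p 0 r = of_bool (r > 0)"
  by (cases r) auto

lemma survival_bounds:
  assumes "0 \<le> p" "p \<le> 1 / 2"
  shows "0 \<le> survival p m r" "survival p m r \<le> 1"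
proof -
  have "0 \<le> survival p m r \<and> survival p m r \<le> 1"
  proof (induction m arbitrary: r)
    case 0
    thus ?case by (simp add: survival_0)
  next
    case (Suc m)
    show ?case
    proof (cases r)
      case (Suc r')
      have "p * (survival p m (Suc (Suc r')) + survival p m r') \<le> p * (1 + 1)"
        by (intro mult_left_mono add_mono) (use Suc.IH assms in auto)
      moreover have "(1 - 2 * p) * survival p m (Suc r') \<le> (1 - 2 * p) * 1"
        by (intro mult_left_mono) (use Suc.IH assms in auto)
      moreover have "0 \<le> p * (survival p m (Suc (Suc r')) + survival p m r')"
          "0 \<le> (1 - 2 * p) * survival p m (Suc r')"
        using Suc.IH assms by auto
      ultimately show ?thesis by (simp add: Suc)
    qed auto
  qed
  thus "0 \<le> survival p m r" "survival p m r \<le> 1" by auto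
qed

text \<open>Bounding the survival probability from 2 by 1 leaves the affine recursion
  \<open>x = p + (1 - 2 * p) * x\<close>, whose fixed point is 1 / 2 and which contracts by the
  factor \<open>1 - 2 * p\<close>.\<close>

lemma survival_1_le:
  assumes "0 \<le> p" "p \<le> 1 / 2"
  shows "survival p m 1 \<le> 1 / 2 + (1 - 2 * p) ^ m / 2"
proof (induction m)
  case (Suc m)
  have "survival p (Suc m) 1 = p * survival p m 2 + (1 - 2 * p) * survival p m 1"
    by (simp add: numeral_2_eq_2)
  also have "\<dots> \<le> p * 1 + (1 - 2 * p) * (1 / 2 + (1 - 2 * p) ^ m / 2)"
    by (intro add_mono mult_left_mono survival_bounds Suc.IH) (use assms in auto)
  also have "\<dots> = 1 / 2 + (1 - 2 * p) ^ Suc m / 2"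
    by (simp add: field_simps)
  finally show ?case .
qed auto

text \<open>The right-hand side is the expected time the walk needs to leave \<open>(0, K)\<close>.\<close>

lemma sum_survival_le:
  assumes "0 < p" "p \<le> 1 / 2" "K > 0" "r \<le> K"
  shows "(\<Sum>j<m. survival p j r - real r / real K) \<le> real r * (real K - real r) / (2 * p)"
  using assms(4)
proof (induction m arbitrary: r)
  case 0
  thus ?case using assms by simp
next
  case (Suc m)
  show ?case
  proof (cases r)
    case 0
    thus ?thesis by simp
  next
    case (Suc r')
    show ?thesis
    proof (cases "r = K")
      case True
      have "(\<Sum>j<Suc m. survival p j r - real r / real K) \<le> 0"
        by (rule sum_nonpos) (use True assms survival_bounds in auto)
      thus ?thesis by (simp add: True)
    next
      case False
      \<comment> \<open>\<open>r / K\<close> is the gambler's ruin probability of reaching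
        \<open>K\<close> before 0. It is harmonic for the walk, so the differences obey the
        recursion of \<open>survival\<close>. The claimed bound solves this recursion with source
        term 1, which dominates the summand of index 0.\<close>
      define S where "S = (\<lambda>r. \<Sum>j<m. survival p j r - real r / real K)"
      have "(\<Sum>j<Suc m. survival p j r - real r / real K) =
         (survival p 0 r - real r / real K) + (\<Sum>j<m. survival p (Suc j) r - real r / real K)"
        by (rule sum.lessThan_Suc_shift)
      also have "(\<Sum>j<m. survival p (Suc j) r - real r / real K) =
         (\<Sum>j<m. p * ((survival p j (Suc r) - real (Suc r) / real K) +
           (survival p j r' - real r' / real K)) +
           (1 - 2 * p) * (survival p j r - real r / real K))"
        by (intro sum.cong refl) (use Suc assms in \<open>simp add: field_simps\<close>)
      also have "\<dots> = p * (S (Suc r) + S r') + (1 - 2 * p) * S r"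
        by (simp add: S_def sum.distrib sum_distrib_left flip: sum_distrib_left)
      also have "survival p 0 r - real r / real K \<le> 1"
        by (simp add: survival_0)
      also have "p * (S (Suc r) + S r') + (1 - 2 * p) * S r \<le>
          p * (real (Suc r) * (real K - real (Suc r)) / (2 * p) +
            real r' * (real K - real r') / (2 * p)) +
          (1 - 2 * p) * (real r * (real K - real r) / (2 * p))"
        unfolding S_def
        by (intro add_mono mult_left_mono Suc.IH) (use Suc False Suc.prems assms in auto)
      also have "1 + \<dots> = real r * (real K - real r) / (2 * p)"
        using Suc assms by (simp add: field_simps)
      finally show ?thesis by simp
    qed
  qed
qed

lemma coin_pmf_insert_prob:
  assumes "finite I" "i \<notin> I" "0 \<le> p" "p \<le> 1"
  shows "measure_pmf.prob (coin_pmf (insert i I) p) {X. P X} =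
    p * measure_pmf.prob (coin_pmf I p) {X. P (X(i := True))} +
    (1 - p) * measure_pmf.prob (coin_pmf I p) {X. P (X(i := False))}"
proof -
  have fin: "finite (set_pmf (bernoulli_pmf p))" by (rule finite_subset[of _ UNIV]) auto
  have "measure_pmf.prob (coin_pmf (insert i I) p) {X. P X} =
    measure_pmf.prob (pair_pmf (bernoulli_pmf p) (coin_pmf I p)) {(b, X). P (X(i := b))}"
    unfolding coin_pmf_def Pi_pmf_insert[OF assms(1,2)] measure_map_pmf
    by (rule arg_cong[where f = "measure_pmf.prob _"]) auto
  also have "\<dots> = measure_pmf.expectation (bernoulli_pmf p)
      (\<lambda>b. measure_pmf.prob (coin_pmf I p) {X. P (X(i := b))})"
    by (rule prob_pair_pmf) (use assms fin in auto)
  also have "\<dots> = p * measure_pmf.prob (coin_pmf I p) {X. P (X(i := True))} +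
    (1 - p) * measure_pmf.prob (coin_pmf I p) {X. P (X(i := False))}"
    using assms by (subst integral_bernoulli_pmf) auto
  finally show ?thesis .
qed

text \<open>Adding a coordinate with coefficient \<open>c\<close> replaces the set \<open>B\<close> of values by \<open>B\<close> and \<open>B - c\<close>;
  moving one element of the second set to the first turns sizes \<open>r, r\<close> into \<open>r + 1, r - 1\<close>.\<close>

lemma prob_linear_form_in_le:
  fixes v :: "'a \<Rightarrow> real"
  assumes "finite I" "0 \<le> p" "p \<le> 1 / 2"
  shows "m \<le> card {i \<in> I. v i \<noteq> 0} \<Longrightarrow> finite B \<Longrightarrow>
    measure_pmf.prob (coin_pmf I p) {X. (\<Sum>i\<in>I. v i * of_bool (X i)) \<in> B} \<le> survival p m (card B)"
  using assms(1)
proof (induction I arbitrary: m B rule: finite_induct)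
  case empty
  thus ?case by (auto simp: survival_0 coin_pmf_def intro!: measure_pmf.prob_le_1)
next
  case (insert i I)
  let ?Pr = "\<lambda>B. measure_pmf.prob (coin_pmf I p) {X. (\<Sum>i\<in>I. v i * of_bool (X i)) \<in> B}"
  define B' where "B' = (\<lambda>b. b - v i) ` B"
  have cB': "card B' = card B" "finite B'"
    unfolding B'_def using insert.prems by (auto intro!: card_image inj_onI)
  have T: "{X. (\<Sum>j\<in>insert i I. v j * of_bool ((X(i := True)) j)) \<in> B} =
      {X. (\<Sum>j\<in>I. v j * of_bool (X j)) \<in> B'}"
  proof -
    have "(\<Sum>j\<in>I. v j * of_bool ((X(i := True)) j)) = (\<Sum>j\<in>I. v j * of_bool (X j))" for X
      using insert.hyps by (intro sum.cong) auto
    hence "(\<Sum>j\<in>insert i I. v j * of_bool ((X(i := True)) j)) = v i + (\<Sum>j\<in>I. v j * of_bool (X j))" for X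
      using insert.hyps by (subst sum.insert) auto
    moreover have "v i + t \<in> B \<longleftrightarrow> t \<in> B'" for t
      unfolding B'_def by (force simp: image_iff)
    ultimately show ?thesis by simp
  qed
  have F: "{X. (\<Sum>j\<in>insert i I. v j * of_bool ((X(i := False)) j)) \<in> B} =
      {X. (\<Sum>j\<in>I. v j * of_bool (X j)) \<in> B}"
  proof -
    have "(\<Sum>j\<in>I. v j * of_bool ((X(i := False)) j)) = (\<Sum>j\<in>I. v j * of_bool (X j))" for X
      using insert.hyps by (intro sum.cong) auto
    hence "(\<Sum>j\<in>insert i I. v j * of_bool ((X(i := False)) j)) = (\<Sum>j\<in>I. v j * of_bool (X j))" for X
      using insert.hyps by (subst sum.insert) auto
    thus ?thesis by simp
  qed
  have eq: "measure_pmf.prob (coin_pmf (insert i I) p)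
      {X. (\<Sum>i\<in>insert i I. v i * of_bool (X i)) \<in> B} = p * ?Pr B' + (1 - p) * ?Pr B"
    by (subst coin_pmf_insert_prob) (use insert.hyps assms in \<open>simp_all only: T F\<close>, auto)
  show ?case
  proof (cases "m \<le> card {i \<in> I. v i \<noteq> 0}")
    case True
    have "p * ?Pr B' + (1 - p) * ?Pr B \<le> p * survival p m (card B) + (1 - p) * survival p m (card B)"
      using insert.IH[OF True cB'(2)] insert.IH[OF True insert.prems(2)] cB' assms
      by (intro add_mono mult_left_mono) auto
    thus ?thesis unfolding eq by (simp add: field_simps)
  next
    case False
    have vi: "v i \<noteq> 0"
    proof
      assume "v i = 0"
      hence "{j \<in> insert i I. v j \<noteq> 0} = {j \<in> I. v j \<noteq> 0}" by auto
      with insert.prems(1) False show False by simp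
    qed
    hence "{j \<in> insert i I. v j \<noteq> 0} = insert i {j \<in> I. v j \<noteq> 0}" by auto
    with insert.prems(1) insert.hyps have "m \<le> Suc (card {j \<in> I. v j \<noteq> 0})" by simp
    with False obtain m' where m: "m = Suc m'" "m' \<le> card {j \<in> I. v j \<noteq> 0}"
      by (cases m) auto
    show ?thesis
    proof (cases "B = {}")
      case True
      thus ?thesis by simp
    next
      case B: False
      \<comment> \<open>A nonempty finite set is not invariant under a nonzero translation, since
        the sum of its elements changes.\<close>
      have "B' \<noteq> B"
      proof
        assume *: "B' = B"
        have "\<Sum>B' = (\<Sum>b\<in>B. b - v i)"
          unfolding B'_def by (subst sum.reindex) (auto intro: inj_onI)
        also have "\<dots> = \<Sum>B - real (card B) * v i" by (simp add: sum_subtractf)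
        finally show False using * vi B insert.prems(2) by simp
      qed
      then obtain b where b: "b \<in> B'" "b \<notin> B"
        using cB' insert.prems(2) card_subset_eq by blast
      from B insert.prems(2) obtain r where r: "card B = Suc r"
        by (metis card_gt_0_iff gr0_conv_Suc)
      have split: "?Pr B' = ?Pr (B' - {b}) + ?Pr {b}"
        by (subst measure_pmf.finite_measure_Union[symmetric])
           (use b in \<open>auto intro!: arg_cong[where f = "measure_pmf.prob _"]\<close>)
      have join: "?Pr (insert b B) = ?Pr B + ?Pr {b}"
        by (subst measure_pmf.finite_measure_Union[symmetric])
           (use b in \<open>auto intro!: arg_cong[where f = "measure_pmf.prob _"]\<close>)
      have "?Pr (insert b B) \<le> survival p m' (Suc (Suc r))"
        using insert.IH[OF m(2), of "insert b B"] insert.prems(2) b r by simp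
      moreover have "?Pr (B' - {b}) \<le> survival p m' r"
        using insert.IH[OF m(2), of "B' - {b}"] cB' b r by simp
      moreover have "?Pr B \<le> survival p m' (Suc r)"
        using insert.IH[OF m(2) insert.prems(2)] r by simp
      \<comment> \<open>Moving \<open>b\<close> from \<open>B'\<close> to \<open>B\<close> does not
        change the total weighted by \<open>p\<close>. The weight \<open>1 - p\<close> of
        \<open>B\<close> splits into \<open>p\<close>, which is paired with \<open>B'\<close>, and
        \<open>1 - 2 * p\<close>, which is nonnegative because p is at most 1 / 2.\<close>
      ultimately have "p * (?Pr (insert b B) + ?Pr (B' - {b})) + (1 - 2 * p) * ?Pr B \<le>
         survival p m (card B)"
        unfolding r m survival.simps using assms
        by (intro add_mono mult_left_mono) auto
      moreover have "p * ?Pr B' + (1 - p) * ?Pr B =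
          p * (?Pr (insert b B) + ?Pr (B' - {b})) + (1 - 2 * p) * ?Pr B"
        unfolding split join by (simp add: algebra_simps)
      ultimately show ?thesis unfolding eq by simp
    qed
  qed
qed

lemma prob_linear_form_eq_le_survival:
  fixes v :: "'a \<Rightarrow> real"
  assumes "finite I" "0 \<le> p" "p \<le> 1 / 2" "m \<le> card {i \<in> I. v i \<noteq> 0}"
  shows "measure_pmf.prob (coin_pmf I p) {X. (\<Sum>i\<in>I. v i * of_bool (X i)) = a} \<le> survival p m 1"
  using prob_linear_form_in_le[OF assms(1-4), of "{a}"] by simp

text \<open>For \<open>p * m\<close> merely bounded below: the bound then stays away from 1, which
  is enough when many independent rows are multiplied.\<close>

lemma prob_linear_form_eq_le_exp:
  fixes v :: "'a \<Rightarrow> real"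
  assumes "finite I" "0 \<le> p" "p \<le> 1 / 2" "m \<le> card {i \<in> I. v i \<noteq> 0}"
  shows "measure_pmf.prob (coin_pmf I p) {X. (\<Sum>i\<in>I. v i * of_bool (X i)) = a}
    \<le> 1 / 2 + exp (- 2 * p * real m) / 2"
proof -
  have "(1 - 2 * p) ^ m \<le> exp (- 2 * p) ^ m"
    using assms exp_ge_add_one_self[of "- 2 * p"] by (intro power_mono) auto
  also have "\<dots> = exp (- 2 * p * real m)"
    by (simp add: exp_of_nat_mult[symmetric] mult_ac)
  finally show ?thesis
    using prob_linear_form_eq_le_survival[OF assms, of a] survival_1_le[OF assms(2,3), of m] by linarith
qed

text \<open>Nonzero coefficients may be ignored, so the probability is at most
  \<open>survival p j 1\<close> for every \<open>j < m\<close>, hence at most the average over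
  \<open>j\<close>. This brings in the expected exit time from an interval of length
  \<open>K\<close>; taking \<open>K\<close> of order \<open>sqrt (p * m)\<close> balances its two
  contributions.\<close>

lemma prob_linear_form_eq_le:
  fixes v :: "'a \<Rightarrow> real"
  assumes "finite I" "0 < p" "p \<le> 1 / 2" "m \<le> card {i \<in> I. v i \<noteq> 0}" "m > 0"
  shows "measure_pmf.prob (coin_pmf I p) {X. (\<Sum>i\<in>I. v i * of_bool (X i)) = a}
    \<le> 2 / sqrt (p * real m)"
proof -
  define q where "q = measure_pmf.prob (coin_pmf I p) {X. (\<Sum>i\<in>I. v i * of_bool (X i)) = a}"
  define t where "t = sqrt (p * real m)"
  have t: "t > 0" "t ^ 2 = p * real m" unfolding t_def using assms by auto
  have "q \<le> 2 / t"
  proof (cases "t \<ge> 1")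
    case False
    have "q \<le> 1" unfolding q_def by simp
    also have "1 \<le> 2 / t" using False t by (simp add: field_simps)
    finally show ?thesis .
  next
    case True
    define K where "K = nat \<lceil>t\<rceil>"
    have K: "t \<le> real K" "real K \<le> 2 * t" "K > 0" using True unfolding K_def by linarith+
    have "real m * q = (\<Sum>j<m. q)" by simp
    also have "\<dots> \<le> (\<Sum>j<m. survival p j 1)"
      unfolding q_def by (intro sum_mono prob_linear_form_eq_le_survival) (use assms in auto)
    also have "\<dots> = (\<Sum>j<m. survival p j 1 - real 1 / real K) + real m / real K"
      by (simp add: sum_subtractf)
    also have "\<dots> \<le> (real K - 1) / (2 * p) + real m / real K"
      using sum_survival_le[of p K 1 m] K assms by simp
    also have "\<dots> \<le> real K / (2 * p) + real m / real K"
      using assms by (simp add: divide_right_mono)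
    also have "\<dots> \<le> t / p + real m / t"
    proof (rule add_mono)
      show "real K / (2 * p) \<le> t / p" using K assms by (simp add: field_simps)
      show "real m / real K \<le> real m / t" using K t by (intro divide_left_mono) auto
    qed
    also have "t / p = real m / t" using t assms by (simp add: field_simps power2_eq_square)
    finally have "real m * q \<le> real m * (2 / t)" by (simp add: mult.commute)
    thus ?thesis using assms(5) by (simp only: mult_le_cancel_left_pos of_nat_0_less_iff)
  qed
  thus ?thesis unfolding q_def t_def .
qed

subsection \<open>Quadratic forms\<close>

lemma expectation_pmf_swap:
  fixes f :: "'a \<Rightarrow> 'b \<Rightarrow> real"
  assumes "finite (set_pmf M)" "finite (set_pmf N)"
  shows "measure_pmf.expectation M (\<lambda>x. measure_pmf.expectation N (f x)) =
    measure_pmf.expectation N (\<lambda>y. measure_pmf.expectation M (\<lambda>x. f x y))"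
proof -
  have "measure_pmf.expectation (pair_pmf M N) (\<lambda>(x, y). f x y) =
      measure_pmf.expectation (pair_pmf N M) (\<lambda>(y, x). f x y)"
    by (subst pair_commute_pmf) (simp add: case_prod_unfold)
  thus ?thesis
    using expectation_pair_pmf[OF assms, of f] expectation_pair_pmf[OF assms(2,1), of "\<lambda>y x. f x y"]
    by simp
qed

lemma expectation_power2_le:
  fixes h :: "'a \<Rightarrow> real"
  assumes "finite (set_pmf M)"
  shows "(measure_pmf.expectation M h)\<^sup>2 \<le> measure_pmf.expectation M (\<lambda>x. (h x)\<^sup>2)"
proof -
  have "0 \<le> measure_pmf.variance M h" by simp
  also have "\<dots> = measure_pmf.expectation M (\<lambda>x. (h x)\<^sup>2) - (measure_pmf.expectation M h)\<^sup>2"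
    by (rule measure_pmf.variance_eq) (auto intro: integrable_measure_pmf_finite[OF assms])
  finally show ?thesis by simp
qed

lemma prob_power2:
  assumes "finite (set_pmf M)"
  shows "(measure_pmf.prob M {x. P x})\<^sup>2 =
    measure_pmf.expectation M (\<lambda>x. measure_pmf.expectation M (\<lambda>y. of_bool (P x \<and> P y)))"
proof -
  have "measure_pmf.expectation M (\<lambda>x. measure_pmf.expectation M (\<lambda>y. of_bool (P x \<and> P y) :: real)) =
    measure_pmf.expectation M (\<lambda>x. of_bool (P x) * measure_pmf.prob M {x. P x})"
    by (simp add: prob_eq_expectation of_bool_conj)
  thus ?thesis by (simp add: prob_eq_expectation power2_eq_square)
qed

text \<open>Decoupling: if the form vanishes both at \<open>(y, z)\<close> and at \<open>(y, z')\<close>, where \<open>y\<close> collects the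
  coordinates in \<open>J\<close>, then a linear form in \<open>y\<close> with coefficients depending on \<open>z - z'\<close> has a
  prescribed value. By Cauchy--Schwarz this costs only a square root.\<close>

lemma prob_quadratic_form_eq_0_le:
  fixes M :: "'a \<Rightarrow> 'a \<Rightarrow> real"
  assumes fin: "finite I" and p: "0 < p" "p \<le> 1 / 2"
    and sym: "\<And>i j. i \<in> I \<Longrightarrow> j \<in> I \<Longrightarrow> M i j = M j i"
    and J: "J \<subseteq> I" "k \<le> card J" "k > 0"
    and supp: "\<And>i. i \<in> J \<Longrightarrow> k \<le> card {j \<in> I - J. M i j \<noteq> 0}"
  shows "measure_pmf.prob (coin_pmf I p)
      {X. (\<Sum>i\<in>I. \<Sum>j\<in>I. M i j * of_bool (X i) * of_bool (X j)) = 0} \<le> sqrt (7 / sqrt (p * real k))"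
proof -
  define P where "P = coin_pmf I p"
  have finP: "finite (set_pmf P)" unfolding P_def using fin by simp
  have finJ: "finite J" using J fin finite_subset by blast
  define Q where "Q = (\<lambda>X. \<Sum>i\<in>I. \<Sum>j\<in>I. M i j * of_bool (X i) * of_bool (X j))"
  define mg where "mg = (\<lambda>f g i. if i \<in> J then f i else g i :: bool)"
  define q1 where "q1 = (\<lambda>f. \<Sum>i\<in>J. \<Sum>j\<in>J. M i j * of_bool (f i) * of_bool (f j))"
  define q2 where "q2 = (\<lambda>f. \<Sum>i\<in>I - J. \<Sum>j\<in>I - J. M i j * of_bool (f i) * of_bool (f j))"
  define l where "l = (\<lambda>i g. \<Sum>j\<in>I - J. M i j * of_bool (g j))"
  define u where "u = (\<lambda>g g' i. 2 * (l i g - l i g'))"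
  define z where "z = (\<lambda>g g'. real (card {i \<in> J. u g g' i = 0}))"
  define h where "h = (\<lambda>f. measure_pmf.prob P {g. Q (mg f g) = 0})"
  define B where "B = 2 / sqrt (p * (real k / 2))"
  have Q_split: "Q (mg f g) = q1 f + (\<Sum>i\<in>J. 2 * l i g * of_bool (f i)) + q2 g" for f g
  proof -
    have IJ: "(\<Sum>i\<in>I. t i) = (\<Sum>i\<in>J. t i) + (\<Sum>i\<in>I - J. t i)" for t :: "'a \<Rightarrow> real"
      using sum.subset_diff[OF J(1) fin, of t] by simp
    have "Q (mg f g) = q1 f + (\<Sum>i\<in>J. \<Sum>j\<in>I - J. M i j * of_bool (f i) * of_bool (g j))
      + (\<Sum>i\<in>I - J. \<Sum>j\<in>J. M i j * of_bool (g i) * of_bool (f j)) + q2 g"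
      unfolding Q_def q1_def q2_def mg_def IJ sum.distrib by (simp add: sum.distrib)
    also have "(\<Sum>i\<in>I - J. \<Sum>j\<in>J. M i j * of_bool (g i) * of_bool (f j)) =
       (\<Sum>j\<in>J. \<Sum>i\<in>I - J. M i j * of_bool (g i) * of_bool (f j))"
      by (rule sum.swap)
    also have "\<dots> = (\<Sum>i\<in>J. \<Sum>j\<in>I - J. M i j * of_bool (f i) * of_bool (g j))"
      by (intro sum.cong refl) (use sym J in \<open>auto simp: mult_ac\<close>)
    also have "\<dots> = (\<Sum>i\<in>J. l i g * of_bool (f i))"
      by (simp add: l_def sum_distrib_left sum_distrib_right mult_ac)
    finally show ?thesis
      by (simp add: sum_distrib_left sum.distrib[symmetric] algebra_simps flip: sum_distrib_left)
  qed
  have kp: "p * real k > 0" using J p by simp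
  \<comment> \<open>\<open>z g g'\<close> counts the vanishing coefficients of the decoupled linear
    form. If fewer than half of \<open>J\<close> vanish, at least \<open>k / 2\<close> coefficients
    remain for the Littlewood--Offord inequality, which gives \<open>B\<close>.\<close>
  have lin: "measure_pmf.prob P {f. Q (mg f g) = 0 \<and> Q (mg f g') = 0} \<le>
      of_bool (z g g' \<ge> real (card J) / 2) + B" for g g'
  proof (cases "z g g' \<ge> real (card J) / 2")
    case True
    have "measure_pmf.prob P {f. Q (mg f g) = 0 \<and> Q (mg f g') = 0} \<le> 1" by simp
    also have "\<dots> \<le> of_bool (z g g' \<ge> real (card J) / 2) + B"
      using True kp by (simp add: B_def)
    finally show ?thesis .
  next
    case False
    define v where "v = (\<lambda>i. if i \<in> J then u g g' i else 0)"
    have v: "{i \<in> I. v i \<noteq> 0} = J - {i \<in> J. u g g' i = 0}"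
      using J by (auto simp: v_def)
    have "card {i \<in> I. v i \<noteq> 0} = card J - card {i \<in> J. u g g' i = 0}"
      unfolding v by (rule card_Diff_subset) (use finJ in auto)
    moreover have "card {i \<in> J. u g g' i = 0} \<le> card J" by (rule card_mono) (use finJ in auto)
    ultimately have *: "real (card {i \<in> I. v i \<noteq> 0}) \<ge> real k / 2"
      using False J unfolding z_def by linarith
    hence pos: "card {i \<in> I. v i \<noteq> 0} > 0" using J by (intro Nat.gr0I) auto
    have "measure_pmf.prob P {f. Q (mg f g) = 0 \<and> Q (mg f g') = 0} \<le>
        measure_pmf.prob P {f. (\<Sum>i\<in>I. v i * of_bool (f i)) = q2 g' - q2 g}"
    proof (rule prob_mono, elim conjE)
      fix f assume "Q (mg f g) = 0" "Q (mg f g') = 0"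
      hence "(\<Sum>i\<in>J. 2 * l i g * of_bool (f i)) - (\<Sum>i\<in>J. 2 * l i g' * of_bool (f i)) = q2 g' - q2 g"
        unfolding Q_split by linarith
      also have "(\<Sum>i\<in>J. 2 * l i g * of_bool (f i)) - (\<Sum>i\<in>J. 2 * l i g' * of_bool (f i)) =
          (\<Sum>i\<in>J. u g g' i * of_bool (f i))"
        unfolding sum_subtractf[symmetric] by (intro sum.cong) (auto simp: u_def algebra_simps)
      also have "\<dots> = (\<Sum>i\<in>I. v i * of_bool (f i))"
        by (rule sum.mono_neutral_cong_left) (use fin J in \<open>auto simp: v_def\<close>)
      finally show "(\<Sum>i\<in>I. v i * of_bool (f i)) = q2 g' - q2 g" .
    qed
    also have "\<dots> \<le> 2 / sqrt (p * real (card {i \<in> I. v i \<noteq> 0}))"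
      unfolding P_def by (rule prob_linear_form_eq_le) (use fin p pos in auto)
    also have "\<dots> \<le> B"
      unfolding B_def by (intro divide_left_mono real_sqrt_le_mono mult_left_mono *) (use p pos J in auto)
    finally show ?thesis by simp
  qed
  \<comment> \<open>For fixed \<open>g\<close>, the vanishing of one coefficient is itself a linear
    equation in \<open>g'\<close>, with at least \<open>k\<close> nonzero coefficients by
    \<open>supp\<close>. Markov's inequality over \<open>J\<close> doubles the bound 2 to 4.\<close>
  have many: "measure_pmf.prob P {g'. z g g' \<ge> real (card J) / 2} \<le> 4 / sqrt (p * real k)" for g
  proof -
    have "measure_pmf.prob P {g'. z g g' \<ge> real (card J) / 2} \<le>
        (\<Sum>i\<in>J. measure_pmf.prob P {g'. u g g' i = 0}) / (real (card J) / 2)"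
      unfolding z_def by (rule markov_card) (use finP finJ J in auto)
    also have "(\<Sum>i\<in>J. measure_pmf.prob P {g'. u g g' i = 0}) \<le> (\<Sum>i\<in>J. 2 / sqrt (p * real k))"
    proof (rule sum_mono)
      fix i assume i: "i \<in> J"
      define v where "v = (\<lambda>j. if j \<in> J then 0 else M i j)"
      have v: "{j \<in> I. v j \<noteq> 0} = {j \<in> I - J. M i j \<noteq> 0}" by (auto simp: v_def)
      have "(\<Sum>j\<in>I. v j * of_bool (g' j)) = l i g'" for g'
        unfolding l_def by (rule sum.mono_neutral_cong_right) (use fin in \<open>auto simp: v_def\<close>)
      hence "{g'. u g g' i = 0} = {g'. (\<Sum>j\<in>I. v j * of_bool (g' j)) = l i g}"
        by (auto simp: u_def)
      thus "measure_pmf.prob P {g'. u g g' i = 0} \<le> 2 / sqrt (p * real k)"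
        unfolding P_def using prob_linear_form_eq_le[OF fin p, of k v "l i g"] supp[OF i] J
        by (simp add: v)
    qed
    hence "(\<Sum>i\<in>J. measure_pmf.prob P {g'. u g g' i = 0}) / (real (card J) / 2) \<le>
      (\<Sum>i\<in>J. 2 / sqrt (p * real k)) / (real (card J) / 2)"
      by (rule divide_right_mono) auto
    also have "\<dots> = 4 / sqrt (p * real k)" using J by simp
    finally show ?thesis .
  qed
  have "(measure_pmf.prob P {X. Q X = 0})\<^sup>2 = (measure_pmf.expectation P h)\<^sup>2"
    unfolding P_def h_def mg_def by (subst prob_coin_resample[OF fin, of _ _ J]) simp
  also have "\<dots> \<le> measure_pmf.expectation P (\<lambda>f. (h f)\<^sup>2)"
    by (rule expectation_power2_le[OF finP])
  also have "\<dots> = measure_pmf.expectation P (\<lambda>f. measure_pmf.expectation P (\<lambda>g.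
      measure_pmf.expectation P (\<lambda>g'. of_bool (Q (mg f g) = 0 \<and> Q (mg f g') = 0))))"
    unfolding h_def by (subst prob_power2[OF finP]) simp
  also have "\<dots> = measure_pmf.expectation P (\<lambda>g. measure_pmf.expectation P (\<lambda>f.
      measure_pmf.expectation P (\<lambda>g'. of_bool (Q (mg f g) = 0 \<and> Q (mg f g') = 0))))"
    by (rule expectation_pmf_swap[OF finP finP])
  also have "\<dots> = measure_pmf.expectation P (\<lambda>g. measure_pmf.expectation P (\<lambda>g'.
      measure_pmf.prob P {f. Q (mg f g) = 0 \<and> Q (mg f g') = 0}))"
    by (subst expectation_pmf_swap[OF finP finP]) (simp add: prob_eq_expectation)
  also have "\<dots> \<le> 4 / sqrt (p * real k) + B"
  proof (rule expectation_pmf_le[OF finP])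
    fix g
    have "measure_pmf.expectation P (\<lambda>g'. measure_pmf.prob P {f. Q (mg f g) = 0 \<and> Q (mg f g') = 0})
      \<le> measure_pmf.expectation P (\<lambda>g'. of_bool (z g g' \<ge> real (card J) / 2) + B)"
      by (rule expectation_pmf_mono[OF finP lin])
    also have "\<dots> = measure_pmf.prob P {g'. z g g' \<ge> real (card J) / 2} + B"
      by (subst Bochner_Integration.integral_add)
         (auto simp: prob_eq_expectation integrable_measure_pmf_finite[OF finP])
    finally show "measure_pmf.expectation P (\<lambda>g'. measure_pmf.prob P
        {f. Q (mg f g) = 0 \<and> Q (mg f g') = 0}) \<le> 4 / sqrt (p * real k) + B"
      using many[of g] by linarith
  qed
  \<comment> \<open>The constant 7 rounds up 4 plus \<open>2 * sqrt 2\<close>, where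
    \<open>sqrt 2\<close> comes from having only \<open>k / 2\<close> coefficients.\<close>
  also have "4 / sqrt (p * real k) + B \<le> 7 / sqrt (p * real k)"
  proof -
    have "B = 2 * sqrt 2 / sqrt (p * real k)"
      unfolding B_def by (simp add: real_sqrt_divide)
    moreover have "sqrt 2 \<le> 3 / 2" by (rule real_le_lsqrt) (auto simp: power2_eq_square)
    hence "2 * sqrt 2 / sqrt (p * real k) \<le> 3 / sqrt (p * real k)"
      using kp by (intro divide_right_mono) auto
    moreover have "4 / sqrt (p * real k) + 3 / sqrt (p * real k) = 7 / sqrt (p * real k)"
      by (simp add: add_divide_distrib[symmetric])
    ultimately show ?thesis by linarith
  qed
  finally show ?thesis
    unfolding P_def Q_def by (rule real_le_rsqrt)
qed

subsection \<open>Linear systems\<close>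

text \<open>Gaussian elimination: the equation \<open>t\<close> is solved for a pivot variable
  \<open>j0\<close>, which is substituted into the other equations. Index sets replace matrix
  dimensions, since the rows and columns used below are varying sets of vertices.\<close>

lemma homogeneous_system_nontrivial_solution:
  fixes a :: "'b \<Rightarrow> 'a \<Rightarrow> real"
  assumes "finite T"
  shows "finite S \<Longrightarrow> card T < card S \<Longrightarrow>
    \<exists>u. (\<exists>j\<in>S. u j \<noteq> 0) \<and> (\<forall>j. j \<notin> S \<longrightarrow> u j = 0) \<and> (\<forall>t\<in>T. (\<Sum>j\<in>S. a t j * u j) = 0)"
  using assms
proof (induction T arbitrary: S a rule: finite_induct)
  case empty
  then obtain j where "j \<in> S" by fastforce
  thus ?case by (intro exI[of _ "\<lambda>i. of_bool (i = j)"]) auto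
next
  case (insert t T)
  show ?case
  proof (cases "\<forall>j\<in>S. a t j = 0")
    case True
    from insert have "card T < card S" by simp
    from insert.IH[OF insert.prems(1) this, of a] True show ?thesis by auto
  next
    case False
    then obtain j0 where j0: "j0 \<in> S" "a t j0 \<noteq> 0" by auto
    define S' where "S' = S - {j0}"
    have S': "finite S'" "card T < card S'" "S = insert j0 S'" "j0 \<notin> S'"
      unfolding S'_def using insert.prems insert.hyps j0 by auto
    obtain u where u: "\<exists>j\<in>S'. u j \<noteq> 0" "\<And>j. j \<notin> S' \<Longrightarrow> u j = 0"
        "\<And>r. r \<in> T \<Longrightarrow> (\<Sum>j\<in>S'. (a r j - a r j0 * a t j / a t j0) * u j) = 0"
      using insert.IH[OF S'(1,2), of "\<lambda>r j. a r j - a r j0 * a t j / a t j0"] by blast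
    define x where "x = - (\<Sum>j\<in>S'. a t j * u j) / a t j0"
    define w where "w = u(j0 := x)"
    have w: "(\<Sum>j\<in>S. a r j * w j) = a r j0 * x + (\<Sum>j\<in>S'. a r j * u j)" for r
    proof -
      have "(\<Sum>j\<in>S'. a r j * w j) = (\<Sum>j\<in>S'. a r j * u j)"
        by (intro sum.cong) (use S' in \<open>auto simp: w_def\<close>)
      thus ?thesis using S' by (simp add: w_def)
    qed
    have "(\<Sum>j\<in>S. a r j * w j) = 0" if "r \<in> T" for r
    proof -
      have "0 = (\<Sum>j\<in>S'. a r j * u j) - a r j0 / a t j0 * (\<Sum>j\<in>S'. a t j * u j)"
        unfolding u(3)[OF that, symmetric] sum_distrib_left sum_subtractf[symmetric]
        by (intro sum.cong) (auto simp: algebra_simps)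
      thus ?thesis unfolding w x_def by (simp add: field_simps)
    qed
    moreover have "(\<Sum>j\<in>S. a t j * w j) = 0"
      unfolding w x_def using j0 by simp
    moreover have "\<exists>j\<in>S. w j \<noteq> 0" using u(1) S' by (auto simp: w_def)
    moreover have "\<forall>j. j \<notin> S \<longrightarrow> w j = 0" using u(2) S' by (auto simp: w_def)
    ultimately show ?thesis by blast
  qed
qed

lemma independent_rows_card_le:
  fixes a :: "'b \<Rightarrow> 'a \<Rightarrow> real"
  assumes "finite R" "finite S"
    and "\<And>c. (\<And>j. j \<in> S \<Longrightarrow> (\<Sum>r\<in>R. c r * a r j) = 0) \<Longrightarrow> (\<forall>r\<in>R. c r = 0)"
  shows "card R \<le> card S"
proof (rule ccontr)
  assume "\<not> card R \<le> card S"
  then obtain c where "\<exists>r\<in>R. c r \<noteq> 0" "\<forall>j\<in>S. (\<Sum>r\<in>R. a r j * c r) = 0"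
    using homogeneous_system_nontrivial_solution[OF assms(2,1), of "\<lambda>j r. a r j"] by auto
  thus False using assms(3)[of c] by (auto simp: mult.commute)
qed

text \<open>A row basis built greedily: a row is added only if it does not vanish on the kernel of
  those chosen so far. Independent rows number at most \<open>card S\<close>, which limits how many
  rows must be exposed to know a kernel vector.\<close>

lemma exists_determining_rows:
  fixes a :: "'b \<Rightarrow> 'a \<Rightarrow> real"
  assumes "finite V" "finite S"
  shows "\<exists>R\<subseteq>V. card R \<le> card S \<and>
    (\<forall>u. (\<forall>r\<in>R. (\<Sum>j\<in>S. a r j * u j) = 0) \<longrightarrow> (\<forall>v\<in>V. (\<Sum>j\<in>S. a v j * u j) = 0))"
proof -
  define Ind where "Ind = (\<lambda>R. \<forall>c. (\<forall>j\<in>S. (\<Sum>r\<in>R. c r * a r j) = 0) \<longrightarrow> (\<forall>r\<in>R. c r = 0))"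
  define Ker where "Ker = (\<lambda>R u. \<forall>r\<in>R. (\<Sum>j\<in>S. a r j * u j) = 0)"
  have "\<exists>R\<subseteq>V. Ind R \<and> (\<forall>u. Ker R u \<longrightarrow> Ker V u)"
    using assms(1)
  proof (induction V rule: finite_induct)
    case empty
    show ?case by (rule exI[of _ "{}"]) (simp add: Ind_def)
  next
    case (insert v V)
    then obtain R where R: "R \<subseteq> V" "Ind R" "\<forall>u. Ker R u \<longrightarrow> Ker V u"
      by blast
    have fR: "finite R" "v \<notin> R" using R(1) insert.hyps finite_subset by auto
    show ?case
    proof (cases "\<forall>u. Ker R u \<longrightarrow> Ker {v} u")
      case True
      have "\<forall>u. Ker R u \<longrightarrow> Ker (insert v V) u" using True R(3) by (simp add: Ker_def)
      thus ?thesis using R(1,2) by (intro exI[of _ R]) auto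
    next
      case False
      then obtain u where "Ker R u" "\<not> Ker {v} u" by blast
      hence u: "\<And>r. r \<in> R \<Longrightarrow> (\<Sum>j\<in>S. a r j * u j) = 0" "(\<Sum>j\<in>S. a v j * u j) \<noteq> 0"
        by (simp_all add: Ker_def)
      have "\<forall>r\<in>insert v R. c r = 0" if c: "\<forall>j\<in>S. (\<Sum>r\<in>insert v R. c r * a r j) = 0" for c
      proof -
        \<comment> \<open>Pairing the relation with \<open>u\<close>, which all earlier rows
          annihilate, isolates the coefficient of the new row.\<close>
        have "0 = (\<Sum>j\<in>S. (\<Sum>r\<in>insert v R. c r * a r j) * u j)" using c by simp
        also have "\<dots> = (\<Sum>r\<in>insert v R. c r * (\<Sum>j\<in>S. a r j * u j))"
          unfolding sum_distrib_left sum_distrib_right by (subst sum.swap) (simp add: mult_ac)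
        also have "\<dots> = c v * (\<Sum>j\<in>S. a v j * u j)"
          using fR u(1) by simp
        finally have cv: "c v = 0" using u(2) by simp
        have "\<forall>j\<in>S. (\<Sum>r\<in>R. c r * a r j) = 0"
          using c cv fR by simp
        with R(2) have "\<forall>r\<in>R. c r = 0" unfolding Ind_def by blast
        with cv show ?thesis by simp
      qed
      hence "Ind (insert v R)" unfolding Ind_def by blast
      moreover have "\<forall>u. Ker (insert v R) u \<longrightarrow> Ker (insert v V) u"
        using R(3) by (simp add: Ker_def)
      ultimately show ?thesis using R(1) by (intro exI[of _ "insert v R"]) auto
    qed
  qed
  then obtain R where R: "R \<subseteq> V" "Ind R" "\<forall>u. Ker R u \<longrightarrow> Ker V u"
    by blast
  have "card R \<le> card S"
  proof (rule independent_rows_card_le[OF _ assms(2)])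
    show "finite R" using R(1) assms(1) finite_subset by blast
    show "\<forall>r\<in>R. c r = 0" if "\<And>j. j \<in> S \<Longrightarrow> (\<Sum>r\<in>R. c r * a r j) = 0" for c
      using R(2) that unfolding Ind_def by blast
  qed
  with R(1,3) show ?thesis unfolding Ker_def by (intro exI[of _ R]) simp
qed

text \<open>The annihilator of the kernel is the row space. If \<open>u0\<close> is killed by the
  old rows but not by row \<open>v\<close>, the coefficient of row \<open>v\<close> is forced to be
  \<open>\<beta> / s\<close>, and projecting along \<open>u0\<close> reduces the claim to the old
  rows. It later supplies the rows of the inverse.\<close>

lemma annihilator_in_row_space:
  fixes a :: "'b \<Rightarrow> 'a \<Rightarrow> real"
  assumes "finite V" "finite S"
    and "\<And>u. (\<And>v. v \<in> V \<Longrightarrow> (\<Sum>j\<in>S. a v j * u j) = 0) \<Longrightarrow> (\<Sum>j\<in>S. b j * u j) = 0"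
  shows "\<exists>c. \<forall>j\<in>S. (\<Sum>v\<in>V. c v * a v j) = b j"
  using assms(1,3)
proof (induction V arbitrary: b rule: finite_induct)
  case empty
  have "b j = 0" if "j \<in> S" for j
    using empty[of "\<lambda>i. of_bool (i = j)"] that assms(2) by simp
  thus ?case by simp
next
  case (insert v V)
  show ?case
  proof (cases "\<forall>u. (\<forall>v\<in>V. (\<Sum>j\<in>S. a v j * u j) = 0) \<longrightarrow> (\<Sum>j\<in>S. a v j * u j) = 0")
    case True
    hence "\<exists>c. \<forall>j\<in>S. (\<Sum>v\<in>V. c v * a v j) = b j"
      by (intro insert.IH insert.prems) auto
    then obtain c where "\<forall>j\<in>S. (\<Sum>v\<in>V. c v * a v j) = b j" by blast
    moreover have "(\<Sum>r\<in>V. (c(v := 0)) r * a r j) = (\<Sum>v\<in>V. c v * a v j)" for j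
      by (intro sum.cong) (use insert.hyps in auto)
    ultimately show ?thesis using insert.hyps by (intro exI[of _ "c(v := 0)"]) simp
  next
    case False
    then obtain u0 where u0: "\<And>r. r \<in> V \<Longrightarrow> (\<Sum>j\<in>S. a r j * u0 j) = 0"
        and nz: "(\<Sum>j\<in>S. a v j * u0 j) \<noteq> 0"
      by blast
    define s where "s = (\<Sum>j\<in>S. a v j * u0 j)"
    define \<beta> where "\<beta> = (\<Sum>j\<in>S. b j * u0 j)"
    have "\<exists>c. \<forall>j\<in>S. (\<Sum>v\<in>V. c v * a v j) = b j - \<beta> / s * a v j"
    proof (rule insert.IH)
      fix u assume u: "\<And>v. v \<in> V \<Longrightarrow> (\<Sum>j\<in>S. a v j * u j) = 0"
      define \<tau> where "\<tau> = (\<Sum>j\<in>S. a v j * u j) / s"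
      have lin: "(\<Sum>j\<in>S. x j * (u j - \<tau> * u0 j)) = (\<Sum>j\<in>S. x j * u j) - \<tau> * (\<Sum>j\<in>S. x j * u0 j)" for x
        by (simp add: algebra_simps sum_subtractf sum_distrib_left)
      have "(\<Sum>j\<in>S. a r j * (u j - \<tau> * u0 j)) = 0" if "r \<in> insert v V" for r
        unfolding lin using that u u0 nz by (cases "r = v") (simp_all add: \<tau>_def s_def)
      hence "(\<Sum>j\<in>S. b j * (u j - \<tau> * u0 j)) = 0"
        by (rule insert.prems)
      hence "(\<Sum>j\<in>S. b j * u j) = \<tau> * \<beta>" unfolding lin \<beta>_def by simp
      moreover have "(\<Sum>j\<in>S. (b j - \<beta> / s * a v j) * u j) =
          (\<Sum>j\<in>S. b j * u j) - \<beta> / s * (\<Sum>j\<in>S. a v j * u j)"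
        by (simp add: algebra_simps sum_subtractf sum_distrib_left)
      ultimately show "(\<Sum>j\<in>S. (b j - \<beta> / s * a v j) * u j) = 0"
        by (simp add: \<tau>_def)
    qed
    then obtain c where c: "\<And>j. j \<in> S \<Longrightarrow> (\<Sum>v\<in>V. c v * a v j) = b j - \<beta> / s * a v j" by blast
    have "(\<Sum>r\<in>V. (c(v := \<beta> / s)) r * a r j) = (\<Sum>v\<in>V. c v * a v j)" for j
      by (intro sum.cong) (use insert.hyps in auto)
    with c show ?thesis using insert.hyps by (intro exI[of _ "c(v := \<beta> / s)"]) simp
  qed
qed

text \<open>Take a nonzero solution of least support. For any other solution \<open>u\<close> on
  that support, the multiple \<open>c\<close> that cancels \<open>u\<close> at one point
  \<open>j0\<close> leaves a solution of smaller support, which must vanish.\<close>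

lemma minimal_support_solution:
  fixes a :: "'b \<Rightarrow> 'a \<Rightarrow> real"
  assumes "finite S" "\<exists>j\<in>S. w j \<noteq> 0" "\<forall>t\<in>T. (\<Sum>j\<in>S. a t j * w j) = 0"
  shows "\<exists>S'\<subseteq>S. \<exists>w. S' \<noteq> {} \<and> (\<forall>j\<in>S'. w j \<noteq> 0) \<and> (\<forall>t\<in>T. (\<Sum>j\<in>S'. a t j * w j) = 0) \<and>
    (\<forall>u. (\<forall>t\<in>T. (\<Sum>j\<in>S'. a t j * u j) = 0) \<longrightarrow> (\<exists>c. \<forall>j\<in>S'. u j = c * w j))"
proof -
  define Sol where "Sol = (\<lambda>S' w. S' \<subseteq> S \<and> S' \<noteq> {} \<and> (\<forall>j\<in>S'. w j \<noteq> 0) \<and>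
    (\<forall>t\<in>T. (\<Sum>j\<in>S'. a t j * w j) = 0))"
  have restrict: "Sol {j \<in> S'. x j \<noteq> 0} x"
    if "S' \<subseteq> S" "\<exists>j\<in>S'. x j \<noteq> 0" "\<And>t. t \<in> T \<Longrightarrow> (\<Sum>j\<in>S'. a t j * x j) = 0" for S' x
  proof -
    have fS': "finite S'" using that(1) assms(1) finite_subset by blast
    have "(\<Sum>j\<in>{j \<in> S'. x j \<noteq> 0}. a t j * x j) = (\<Sum>j\<in>S'. a t j * x j)" for t
      by (rule sum.mono_neutral_left) (use fS' in auto)
    thus ?thesis unfolding Sol_def using that by auto
  qed
  have "Sol {j \<in> S. w j \<noteq> 0} w" by (rule restrict) (use assms in auto)
  hence "\<exists>n S' w. Sol S' w \<and> card S' = n" by blast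
  then obtain n where "\<exists>S' w. Sol S' w \<and> card S' = n" and n: "\<forall>m<n. \<not> (\<exists>S' w. Sol S' w \<and> card S' = m)"
    unfolding exists_least_iff[of "\<lambda>n. \<exists>S' w. Sol S' w \<and> card S' = n"] by blast
  then obtain S' w where Sw: "Sol S' w" "card S' = n" by blast
  have min: "card S' \<le> card S''" if "Sol S'' x" for S'' x
    using n that unfolding Sw(2) not_less[symmetric] by blast
  have S': "S' \<subseteq> S" "S' \<noteq> {}" "\<And>j. j \<in> S' \<Longrightarrow> w j \<noteq> 0" "\<And>t. t \<in> T \<Longrightarrow> (\<Sum>j\<in>S'. a t j * w j) = 0"
    using Sw unfolding Sol_def by auto
  have fS': "finite S'" using S'(1) assms(1) finite_subset by blast
  obtain j0 where j0: "j0 \<in> S'" using S'(2) by auto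
  have uniq: "\<exists>c. \<forall>j\<in>S'. u j = c * w j" if u: "\<And>t. t \<in> T \<Longrightarrow> (\<Sum>j\<in>S'. a t j * u j) = 0" for u
  proof (rule ccontr)
    assume neg: "\<not> ?thesis"
    define c where "c = u j0 / w j0"
    define x where "x = (\<lambda>j. u j - c * w j)"
    have "(\<Sum>j\<in>S'. a t j * x j) = (\<Sum>j\<in>S'. a t j * u j) - c * (\<Sum>j\<in>S'. a t j * w j)" for t
      by (simp add: x_def algebra_simps sum_subtractf sum_distrib_left)
    hence "Sol {j \<in> S'. x j \<noteq> 0} x"
      using neg S' u by (intro restrict) (auto simp: x_def)
    from min[OF this] have "card S' \<le> card {j \<in> S'. x j \<noteq> 0}" .
    moreover have "x j0 = 0" using S'(3)[OF j0] by (simp add: x_def c_def)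
    hence "{j \<in> S'. x j \<noteq> 0} \<subset> S'" using j0 by blast
    hence "card {j \<in> S'. x j \<noteq> 0} < card S'" by (rule psubset_card_mono[OF fS'])
    ultimately show False by simp
  qed
  with S' show ?thesis by (intro exI[of _ S'] exI[of _ w] conjI ballI allI impI) simp_all
qed

subsection \<open>Neighbourhood patterns of small supports\<close>

text \<open>With \<open>h j = {v, j}\<close> this reads a row of the adjacency matrix as coins
  indexed by vertices; with the identity it restricts to the pairs of a subset.\<close>

lemma coin_pmf_map_inj:
  assumes "finite I" "inj h" "h ` S \<subseteq> I"
  shows "map_pmf (\<lambda>X j. j \<in> S \<and> X (h j)) (coin_pmf I p) = coin_pmf S p"
proof -
  have fS: "finite S"
    using assms finite_subset finite_imageD inj_on_subset subset_UNIV by metis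
  have "coin_pmf S p = map_pmf (\<lambda>g. g \<circ> h) (coin_pmf (h ` S) p)"
    unfolding coin_pmf_def
    by (rule Pi_pmf_bij_betw) (use fS assms(2) in \<open>auto simp: inj_on_def bij_betw_def\<close>)
  also have "coin_pmf (h ` S) p = map_pmf (\<lambda>f x. if x \<in> h ` S then f x else False) (coin_pmf I p)"
    unfolding coin_pmf_def by (rule Pi_pmf_subset) (use assms in auto)
  finally show ?thesis
    using assms(2)
    by (auto simp: map_pmf_comp o_def inj_image_mem_iff fun_eq_iff intro!: map_pmf_cong)
qed

lemma finite_all_pairs [simp]: "finite V \<Longrightarrow> finite (all_pairs V)"
  unfolding all_pairs_def by simp

lemma pair_in_all_pairs_iff: "{u, v} \<in> all_pairs V \<longleftrightarrow> u \<in> V \<and> v \<in> V \<and> u \<noteq> v"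
  unfolding all_pairs_def by (auto simp: card_insert_if)

abbreviation coins :: "nat set \<Rightarrow> real \<Rightarrow> (nat set \<Rightarrow> bool) pmf" where
  "coins V p \<equiv> coin_pmf (all_pairs V) p"

text \<open>The guard keeps the diagonal zero for every \<open>X\<close>, also where
  \<open>X\<close> holds at a singleton set.\<close>

definition adj :: "(nat set \<Rightarrow> bool) \<Rightarrow> nat \<Rightarrow> nat \<Rightarrow> real" where
  "adj X u v = of_bool (u \<noteq> v \<and> X {u, v})"

lemma adj_sym: "adj X u v = adj X v u"
  unfolding adj_def by (auto simp: insert_commute)

definition nbrs :: "(nat set \<Rightarrow> bool) \<Rightarrow> nat set \<Rightarrow> nat \<Rightarrow> nat set" where
  "nbrs X S v = {j \<in> S. j \<noteq> v \<and> X {v, j}}"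

lemma finite_nbrs [simp]: "finite S \<Longrightarrow> finite (nbrs X S v)"
  unfolding nbrs_def by simp

lemma sum_adj_eq_0: "nbrs X S v = {} \<Longrightarrow> (\<Sum>j\<in>S. adj X v j * u j) = 0"
  by (intro sum.neutral) (auto simp: nbrs_def adj_def)

lemma coins_row:
  assumes "finite V" "S \<subseteq> V" "v \<in> V" "v \<notin> S"
  shows "map_pmf (\<lambda>X j. j \<in> S \<and> X {v, j}) (coins V p) = coin_pmf S p"
  by (rule coin_pmf_map_inj) (use assms in \<open>auto simp: inj_def doubleton_eq_iff pair_in_all_pairs_iff\<close>)

lemma prob_coins_row:
  assumes "finite V" "S \<subseteq> V" "v \<in> V" "v \<notin> S"
  shows "measure_pmf.prob (coins V p) {X. P (\<lambda>j. j \<in> S \<and> X {v, j})} =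
    measure_pmf.prob (coin_pmf S p) {x. P x}"
  by (simp flip: coins_row[OF assms, of p])

text \<open>\<open>D\<close> is empty or consists of a single exempted row; in the second case the condition describes
  a minimal linear relation that fails in this row only.\<close>

definition rigid :: "nat set \<Rightarrow> nat set \<Rightarrow> nat set \<Rightarrow> (nat set \<Rightarrow> bool) \<Rightarrow> bool" where
  "rigid V D S X \<longleftrightarrow> (\<exists>w. (\<forall>j\<in>S. w j \<noteq> 0) \<and> (\<forall>v\<in>V - D. (\<Sum>j\<in>S. adj X v j * w j) = 0) \<and>
    (\<forall>u. (\<forall>v\<in>V - D. (\<Sum>j\<in>S. adj X v j * u j) = 0) \<longrightarrow> (\<exists>c. \<forall>j\<in>S. u j = c * w j)))"

text \<open>A single neighbour \<open>j\<close> would force \<open>w j = 0\<close>. With too few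
  nonzero rows there would be room for one more equation, \<open>u j0 = 0\<close>, and still a
  nonzero solution; such a solution is no multiple of \<open>w\<close>.\<close>

lemma rigid_imp_nbrs:
  assumes "finite V" "S \<subseteq> V" "rigid V D S X" "S \<noteq> {}"
  shows "\<forall>v\<in>V - D. card (nbrs X S v) \<noteq> 1"
    and "card S \<le> card {v \<in> V - D. nbrs X S v \<noteq> {}} + 1"
proof -
  have fS: "finite S" using assms finite_subset by blast
  obtain w where w: "\<And>j. j \<in> S \<Longrightarrow> w j \<noteq> 0" "\<And>v. v \<in> V - D \<Longrightarrow> (\<Sum>j\<in>S. adj X v j * w j) = 0"
      "\<And>u. (\<forall>v\<in>V - D. (\<Sum>j\<in>S. adj X v j * u j) = 0) \<Longrightarrow> (\<exists>c. \<forall>j\<in>S. u j = c * w j)"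
    using assms(3) unfolding rigid_def by blast
  show "\<forall>v\<in>V - D. card (nbrs X S v) \<noteq> 1"
  proof
    fix v assume v: "v \<in> V - D"
    show "card (nbrs X S v) \<noteq> 1"
    proof
      assume "card (nbrs X S v) = 1"
      then obtain j where j: "nbrs X S v = {j}" by (meson card_1_singletonE)
      hence "j \<in> nbrs X S v" by simp
      hence jS: "j \<in> S" "adj X v j = 1" by (auto simp: nbrs_def adj_def)
      have "(\<Sum>i\<in>S. adj X v i * w i) = (\<Sum>i\<in>nbrs X S v. adj X v i * w i)"
        by (rule sum.mono_neutral_right) (use fS in \<open>auto simp: nbrs_def adj_def\<close>)
      also have "\<dots> = w j" using jS by (simp add: j)
      finally show False using w(1)[OF jS(1)] w(2)[OF v] by simp
    qed
  qed
  show "card S \<le> card {v \<in> V - D. nbrs X S v \<noteq> {}} + 1"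
  proof (rule ccontr)
    define T where "T = {v \<in> V - D. nbrs X S v \<noteq> {}}"
    assume "\<not> ?thesis"
    hence T: "card T + 1 < card S" unfolding T_def by simp
    have fT: "finite T" unfolding T_def using assms(1) by simp
    obtain j0 where j0: "j0 \<in> S" using assms(4) by auto
    \<comment> \<open>\<open>None\<close> indexes the additional equation
      \<open>u j0 = 0\<close>.\<close>
    define a where "a = (\<lambda>t j. case t of None \<Rightarrow> of_bool (j = j0) | Some v \<Rightarrow> adj X v j)"
    have "finite (insert None (Some ` T))" "card (insert None (Some ` T)) < card S"
      using T fT by (auto simp: card_insert_if card_image)
    from homogeneous_system_nontrivial_solution[OF this(1) fS this(2), of a]
    obtain u where u: "\<exists>j\<in>S. u j \<noteq> 0" "(\<Sum>j\<in>S. of_bool (j = j0) * u j) = 0"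
        "\<And>v. v \<in> T \<Longrightarrow> (\<Sum>j\<in>S. adj X v j * u j) = 0"
      unfolding a_def by auto
    have "\<forall>v\<in>V - D. (\<Sum>j\<in>S. adj X v j * u j) = 0"
      using u(3) sum_adj_eq_0 unfolding T_def by blast
    from w(3)[OF this] obtain c where c: "\<forall>j\<in>S. u j = c * w j" by blast
    have "u j0 = 0" using u(2) j0 fS by simp
    hence "c = 0" using c w(1) j0 by auto
    thus False using c u(1) by auto
  qed
qed

lemma handshake:
  assumes "finite S"
  shows "(\<Sum>v\<in>S. card (nbrs X S v)) = 2 * card {e \<in> all_pairs S. X e}"
proof -
  have "card (nbrs X S v) = card {e \<in> {e \<in> all_pairs S. X e}. v \<in> e}" if "v \<in> S" for v
  proof (rule bij_betw_same_card[of "\<lambda>j. {v, j}"])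
    have "(\<lambda>j. {v, j}) ` nbrs X S v = {e \<in> {e \<in> all_pairs S. X e}. v \<in> e}"
    proof (intro equalityI subsetI)
      fix e assume e: "e \<in> {e \<in> {e \<in> all_pairs S. X e}. v \<in> e}"
      then obtain a b where "e = {a, b}" "a \<noteq> b" by (auto simp: all_pairs_def card_2_iff)
      with e obtain j where "e = {v, j}" "j \<noteq> v" by auto
      with e show "e \<in> (\<lambda>j. {v, j}) ` nbrs X S v"
        by (auto simp: nbrs_def pair_in_all_pairs_iff)
    qed (use that in \<open>auto simp: nbrs_def pair_in_all_pairs_iff\<close>)
    thus "bij_betw (\<lambda>j. {v, j}) (nbrs X S v) {e \<in> {e \<in> all_pairs S. X e}. v \<in> e}"
      by (auto simp: bij_betw_def inj_on_def doubleton_eq_iff)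
  qed
  hence "(\<Sum>v\<in>S. card (nbrs X S v)) = (\<Sum>v\<in>S. card {e \<in> {e \<in> all_pairs S. X e}. v \<in> e})"
    by (intro sum.cong) auto
  also have "\<dots> = 2 * card {e \<in> all_pairs S. X e}"
  proof (rule sum_multicount[OF assms])
    show "\<forall>e\<in>{e \<in> all_pairs S. X e}. card {v \<in> S. v \<in> e} = 2"
    proof
      fix e assume "e \<in> {e \<in> all_pairs S. X e}"
      moreover from this have "{v \<in> S. v \<in> e} = e" by (auto simp: all_pairs_def)
      ultimately show "card {v \<in> S. v \<in> e} = 2" by (simp add: all_pairs_def)
    qed
  qed (use assms in simp)
  finally show ?thesis .
qed

text \<open>Rows outside \<open>S\<close> use disjoint sets of coins, but rows inside
  \<open>S\<close> share theirs. The latter are charged to edges: a nonzero row has at least two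
  neighbours, so by the handshake identity there are at most as many such rows in \<open>S\<close>
  as edges inside \<open>S\<close>.\<close>

lemma count_many_nbrs_or_edges:
  assumes "finite V" "S \<subseteq> V"
    and "\<forall>v\<in>V - D. card (nbrs X S v) \<noteq> 1"
    and "card S \<le> card {v \<in> V - D. nbrs X S v \<noteq> {}} + 1"
  shows "card S \<le> card {v \<in> V - S - D. card (nbrs X S v) \<ge> 2} + card {e \<in> all_pairs S. X e} + 1"
proof -
  have fS: "finite S" using assms finite_subset by blast
  define T where "T = {v \<in> S - D. card (nbrs X S v) \<ge> 2}"
  have ge2: "card (nbrs X S v) \<ge> 2" if "v \<in> V - D" "nbrs X S v \<noteq> {}" for v
  proof -
    have "card (nbrs X S v) > 0" using that fS by (simp add: card_gt_0_iff)
    moreover have "card (nbrs X S v) \<noteq> 1" using that assms(3) by blast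
    ultimately show ?thesis by linarith
  qed
  have "{v \<in> V - D. nbrs X S v \<noteq> {}} \<subseteq> {v \<in> V - S - D. card (nbrs X S v) \<ge> 2} \<union> T"
    using ge2 unfolding T_def by auto
  hence "card {v \<in> V - D. nbrs X S v \<noteq> {}} \<le> card ({v \<in> V - S - D. card (nbrs X S v) \<ge> 2} \<union> T)"
    by (intro card_mono) (use assms fS in \<open>auto simp: T_def\<close>)
  also have "\<dots> \<le> card {v \<in> V - S - D. card (nbrs X S v) \<ge> 2} + card T"
    by (rule card_Un_le)
  finally have *: "card {v \<in> V - D. nbrs X S v \<noteq> {}} \<le>
    card {v \<in> V - S - D. card (nbrs X S v) \<ge> 2} + card T" .
  have "2 * card T \<le> 2 * card {e \<in> all_pairs S. X e}"
  proof -
    have "2 * card T = (\<Sum>v\<in>T. 2)" by simp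
    also have "\<dots> \<le> (\<Sum>v\<in>T. card (nbrs X S v))" by (intro sum_mono) (auto simp: T_def)
    also have "\<dots> \<le> (\<Sum>v\<in>S. card (nbrs X S v))"
      by (intro sum_mono2) (use fS in \<open>auto simp: T_def\<close>)
    finally show ?thesis by (simp add: handshake[OF fS])
  qed
  with * show ?thesis using assms(4) by linarith
qed

lemma prob_no_nbrs:
  assumes "finite V" "S \<subseteq> V" "v \<in> V" "v \<notin> S" "0 \<le> p" "p \<le> 1"
  shows "measure_pmf.prob (coins V p) {X. nbrs X S v = {}} = (1 - p) ^ card S"
proof -
  have "{X. nbrs X S v = {}} = {X. \<forall>e\<in>(\<lambda>j. {v, j}) ` S. \<not> X e}"
    using assms(4) by (auto simp: nbrs_def)
  moreover have "(\<lambda>j. {v, j}) ` S \<subseteq> all_pairs V"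
    using assms by (auto simp: pair_in_all_pairs_iff)
  moreover have "card ((\<lambda>j. {v, j}) ` S) = card S"
    by (rule card_image) (auto simp: inj_on_def doubleton_eq_iff)
  ultimately show ?thesis
    using prob_coin_all_False[of "all_pairs V" "(\<lambda>j. {v, j}) ` S" p] assms
    by simp
qed

lemma prob_two_nbrs_le:
  assumes "finite V" "S \<subseteq> V" "v \<in> V" "v \<notin> S" "0 \<le> p" "p \<le> 1"
  shows "measure_pmf.prob (coins V p) {X. card (nbrs X S v) \<ge> 2} \<le> (real (card S) * p)\<^sup>2"
proof -
  have fS: "finite S" using assms finite_subset by blast
  have "measure_pmf.prob (coins V p) {X. card (nbrs X S v) \<ge> 2} \<le>
      measure_pmf.prob (coins V p) {X. \<exists>ab\<in>S \<times> S. fst ab \<noteq> snd ab \<and> X {v, fst ab} \<and> X {v, snd ab}}"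
  proof (rule prob_mono)
    fix X assume "card (nbrs X S v) \<ge> 2"
    hence "\<not> card (nbrs X S v) \<le> Suc 0" by simp
    then obtain a b where "a \<in> nbrs X S v" "b \<in> nbrs X S v" "a \<noteq> b"
      using card_le_Suc0_iff_eq[OF finite_nbrs[OF fS]] by blast
    thus "\<exists>ab\<in>S \<times> S. fst ab \<noteq> snd ab \<and> X {v, fst ab} \<and> X {v, snd ab}"
      by (intro bexI[of _ "(a, b)"]) (auto simp: nbrs_def)
  qed
  also have "\<dots> \<le> (\<Sum>ab\<in>S \<times> S. measure_pmf.prob (coins V p)
      {X. fst ab \<noteq> snd ab \<and> X {v, fst ab} \<and> X {v, snd ab}})"
    by (rule prob_ex_le) (use fS in auto)
  also have "\<dots> \<le> (\<Sum>ab\<in>S \<times> S. p\<^sup>2)"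
  proof (rule sum_mono)
    fix ab assume ab: "ab \<in> S \<times> S"
    show "measure_pmf.prob (coins V p) {X. fst ab \<noteq> snd ab \<and> X {v, fst ab} \<and> X {v, snd ab}} \<le> p\<^sup>2"
    proof (cases "fst ab = snd ab")
      case False
      have "measure_pmf.prob (coins V p) {X. X {v, fst ab} \<and> X {v, snd ab}} = p\<^sup>2"
        by (rule prob_coin_two)
           (use assms ab False in \<open>auto simp: pair_in_all_pairs_iff doubleton_eq_iff\<close>)
      thus ?thesis using False by simp
    qed simp
  qed
  also have "\<dots> = (real (card S) * p)\<^sup>2"
    by (simp add: card_cartesian_product power2_eq_square)
  finally show ?thesis .
qed

lemma exp_minus_le_quadratic:
  fixes x :: real
  assumes "0 \<le> x"
  shows "exp (- x) \<le> 1 - x + x\<^sup>2"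
proof -
  have "exp (- x) = 1 / exp x" by (simp add: exp_minus field_simps)
  also have "\<dots> \<le> 1 / (1 + x)" using assms exp_ge_add_one_self[of x] by (intro divide_left_mono) auto
  also have "\<dots> \<le> 1 - x + x\<^sup>2"
  proof -
    have "1 \<le> (1 - x + x\<^sup>2) * (1 + x)" using assms by (simp add: algebra_simps power2_eq_square)
    thus ?thesis using assms by (simp add: field_simps)
  qed
  finally show ?thesis .
qed

text \<open>The weight \<open>l\<close> on every vertex with two neighbours in \<open>S\<close> and on every edge inside \<open>S\<close>
  turns the number of nonzero rows into the factor \<open>l ^ (card S - 1)\<close>.\<close>

lemma prob_nbr_pattern_le:
  assumes fV: "finite V" and S: "S \<subseteq> V" "S \<noteq> {}" and D: "finite D" "card D \<le> 1"
    and p: "0 < p" "p \<le> 1 / 2" and l: "1 \<le> l" and Np: "1 \<le> real (card V) * p"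
  shows "measure_pmf.prob (coins V p) {X. (\<forall>v\<in>V - D. card (nbrs X S v) \<noteq> 1) \<and>
        card S \<le> card {v \<in> V - D. nbrs X S v \<noteq> {}} + 1} * l ^ (card S - 1)
    \<le> exp (- (real (card V) * real (card S) * p) + 5 * real (card V) * l * (real (card S) * p)\<^sup>2)"
proof -
  define H where "H = (\<lambda>X. (\<forall>v\<in>V - D. card (nbrs X S v) \<noteq> 1) \<and>
        card S \<le> card {v \<in> V - D. nbrs X S v \<noteq> {}} + 1)"
  define s where "s = real (card S)"
  define N where "N = real (card V)"
  define W where "W = V - S - D"
  define E where "E = coins V p"
  have fin: "finite S" "finite W" "finite (set_pmf E)"
    using S fV finite_subset unfolding W_def E_def by auto
  define g where "g = (\<lambda>v X. of_bool (nbrs X S v = {}) + l * of_bool (card (nbrs X S v) \<ge> 2) :: real)"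
  define r where "r = (\<lambda>X. \<Prod>e\<in>all_pairs S. if X e then l else 1)"
  have s1: "s \<ge> 1" unfolding s_def using S fin by (simp add: Suc_le_eq card_gt_0_iff)
  have l0: "l > 0" using l by simp
  have pairs: "all_pairs S \<subseteq> all_pairs V" using S unfolding all_pairs_def by auto
  \<comment> \<open>An exponential Markov bound with product structure: on the event every factor
    \<open>g v X\<close> is 1 or \<open>l\<close>, because exactly one neighbour is
    excluded.\<close>
  have pointwise: "of_bool (H X) * l ^ (card S - 1) \<le> (\<Prod>v\<in>W. g v X) * r X" for X
  proof (cases "H X")
    case True
    define W2 where "W2 = {v \<in> W. card (nbrs X S v) \<ge> 2}"
    have "card S \<le> card W2 + card {e \<in> all_pairs S. X e} + 1"
      unfolding W2_def W_def
      by (rule count_many_nbrs_or_edges) (use True fV S in \<open>auto simp: H_def\<close>)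
    hence "l ^ (card S - 1) \<le> l ^ (card W2 + card {e \<in> all_pairs S. X e})"
      using l by (intro power_increasing) auto
    also have "\<dots> = l ^ card W2 * l ^ card {e \<in> all_pairs S. X e}" by (rule power_add)
    also have "l ^ card {e \<in> all_pairs S. X e} = r X"
      unfolding r_def by (subst prod.If_cases) (use fin in \<open>auto simp: Int_def\<close>)
    also have "l ^ card W2 = (\<Prod>v\<in>W. if card (nbrs X S v) \<ge> 2 then l else 1)"
      by (subst prod.If_cases) (use fin in \<open>auto simp: Int_def W2_def\<close>)
    also have "\<dots> = (\<Prod>v\<in>W. g v X)"
    proof (rule prod.cong[OF refl])
      fix v assume v: "v \<in> W"
      show "(if card (nbrs X S v) \<ge> 2 then l else 1) = g v X"
      proof (cases "nbrs X S v = {}")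
        case False
        have "card (nbrs X S v) \<noteq> 1" using v True by (auto simp: H_def W_def)
        moreover have "card (nbrs X S v) > 0" using False fin by (simp add: card_gt_0_iff)
        ultimately show ?thesis using False by (simp add: g_def)
      qed (simp add: g_def)
    qed
    finally show ?thesis using True by simp
  next
    case False
    have "(\<Prod>v\<in>W. g v X) * r X \<ge> 0"
      unfolding g_def r_def using l0 by (intro mult_nonneg_nonneg prod_nonneg) auto
    thus ?thesis using False by simp
  qed
  have Eg: "measure_pmf.expectation E (g v) \<le> exp (- (s * p) + 2 * l * (s * p)\<^sup>2)" if v: "v \<in> W" for v
  proof -
    have "measure_pmf.expectation E (g v) = measure_pmf.prob E {X. nbrs X S v = {}} +
        l * measure_pmf.prob E {X. card (nbrs X S v) \<ge> 2}"
      unfolding g_def prob_eq_expectation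
      by (subst Bochner_Integration.integral_add)
         (auto intro: integrable_measure_pmf_finite[OF fin(3)])
    also have "\<dots> \<le> (1 - p) ^ card S + l * (s * p)\<^sup>2"
      unfolding E_def s_def
      using v fV S p l0 prob_no_nbrs[of V S v p] prob_two_nbrs_le[of V S v p]
      by (simp add: W_def)
    also have "(1 - p) ^ card S \<le> exp (- (s * p))"
    proof -
      have "(1 - p) ^ card S \<le> exp (- p) ^ card S"
        using exp_ge_add_one_self[of "- p"] p by (intro power_mono) auto
      thus ?thesis unfolding s_def by (simp add: exp_of_nat_mult[symmetric])
    qed
    also have "\<dots> \<le> 1 - s * p + (s * p)\<^sup>2"
      by (rule exp_minus_le_quadratic) (use s1 p in auto)
    also have "1 - s * p + (s * p)\<^sup>2 + l * (s * p)\<^sup>2 \<le> 1 - s * p + l * (s * p)\<^sup>2 + l * (s * p)\<^sup>2"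
      using l by (simp add: mult_le_cancel_right1)
    also have "1 - s * p + l * (s * p)\<^sup>2 + l * (s * p)\<^sup>2 = 1 + (- (s * p) + 2 * l * (s * p)\<^sup>2)"
      by simp
    also have "\<dots> \<le> exp (- (s * p) + 2 * l * (s * p)\<^sup>2)" by (rule exp_ge_add_one_self)
    finally show ?thesis by simp
  qed
  have Eg0: "measure_pmf.expectation E (g v) \<ge> 0" for v
    by (rule integral_nonneg_AE) (use l0 in \<open>auto simp: g_def\<close>)
  define J where "J = (\<lambda>v. (\<lambda>j. {v, j}) ` S)"
  have dep: "depends_on (g v) (J v)" for v
  proof (rule depends_onI)
    fix X Y :: "nat set \<Rightarrow> bool" assume "\<And>e. e \<in> J v \<Longrightarrow> X e = Y e"
    hence "nbrs X S v = nbrs Y S v" unfolding J_def nbrs_def by auto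
    thus "g v X = g v Y" by (simp add: g_def)
  qed
  have disj: "disjoint_family_on J W"
    unfolding disjoint_family_on_def J_def W_def by (auto simp: doubleton_eq_iff)
  have Er: "measure_pmf.expectation E r \<le> exp (l * p * s\<^sup>2)"
  proof -
    have "measure_pmf.expectation E r = (\<Prod>e\<in>all_pairs S. l * p + 1 * (1 - p))"
      unfolding E_def r_def
      using expectation_coin_prod_single[OF _ pairs, of p "\<lambda>_ b. if b then l else 1"] fV p by simp
    also have "\<dots> \<le> exp (l * p * s\<^sup>2)"
    proof -
      have "(\<Prod>e\<in>all_pairs S. l * p + 1 * (1 - p)) = (l * p + 1 * (1 - p)) ^ card (all_pairs S)" by simp
      also have "\<dots> \<le> exp (l * p) ^ card (all_pairs S)"
      proof (rule power_mono)
        have "l * p + 1 * (1 - p) \<le> 1 + l * p" using p by simp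
        also have "\<dots> \<le> exp (l * p)" by (rule exp_ge_add_one_self)
        finally show "l * p + 1 * (1 - p) \<le> exp (l * p)" .
        show "0 \<le> l * p + 1 * (1 - p)" using p l0 by simp
      qed
      also have "\<dots> = exp (real (card (all_pairs S)) * (l * p))" by (simp add: exp_of_nat_mult)
      also have "\<dots> \<le> exp (s\<^sup>2 * (l * p))"
      proof (subst exp_le_cancel_iff, rule mult_right_mono)
        have "card (all_pairs S) = card S choose 2"
          unfolding all_pairs_def by (rule n_subsets[OF fin(1)])
        also have "\<dots> \<le> card S ^ 2" 
          unfolding choose_two power2_eq_square
          by (rule order_trans[OF div_le_dividend]) simp
        finally show "real (card (all_pairs S)) \<le> s\<^sup>2" unfolding s_def by (metis of_nat_le_iff of_nat_power)
      qed (use p l0 in auto)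
      finally show ?thesis by (simp add: mult_ac)
    qed
    finally show ?thesis .
  qed
  have "measure_pmf.prob E {X. H X} * l ^ (card S - 1) =
      measure_pmf.expectation E (\<lambda>X. of_bool (H X) * l ^ (card S - 1))"
    by (simp add: prob_eq_expectation)
  also have "\<dots> \<le> measure_pmf.expectation E (\<lambda>X. (\<Prod>v\<in>W. g v X) * r X)"
    by (rule expectation_pmf_mono[OF fin(3) pointwise])
  also have "\<dots> = measure_pmf.expectation E (\<lambda>X. \<Prod>v\<in>W. g v X) * measure_pmf.expectation E r"
    unfolding E_def
  proof (rule expectation_coin_mult)
    show "depends_on (\<lambda>X. \<Prod>v\<in>W. g v X) (\<Union>v\<in>W. J v)"
    proof (rule depends_onI)
      fix X Y :: "nat set \<Rightarrow> bool" assume "\<And>e. e \<in> (\<Union>v\<in>W. J v) \<Longrightarrow> X e = Y e"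
      thus "(\<Prod>v\<in>W. g v X) = (\<Prod>v\<in>W. g v Y)"
        by (intro prod.cong refl depends_onD[OF dep]) auto
    qed
    show "depends_on r (all_pairs S)"
      unfolding r_def by (intro depends_onI prod.cong) auto
    show "(\<Union>v\<in>W. J v) \<inter> all_pairs S = {}"
      unfolding J_def W_def by (auto simp: pair_in_all_pairs_iff)
  qed (use fV in simp)
  also have "measure_pmf.expectation E (\<lambda>X. \<Prod>v\<in>W. g v X) = (\<Prod>v\<in>W. measure_pmf.expectation E (g v))"
    unfolding E_def by (rule expectation_coin_prod[OF _ fin(2) dep disj]) (use fV in simp)
  also have "(\<Prod>v\<in>W. measure_pmf.expectation E (g v)) * measure_pmf.expectation E r \<le>
      (\<Prod>v\<in>W. exp (- (s * p) + 2 * l * (s * p)\<^sup>2)) * exp (l * p * s\<^sup>2)"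
    by (intro mult_mono prod_mono Er prod_nonneg integral_nonneg_AE)
       (use Eg Eg0 l0 in \<open>auto simp: r_def intro!: prod_nonneg\<close>)
  also have "(\<Prod>v\<in>W. exp (- (s * p) + 2 * l * (s * p)\<^sup>2)) =
      exp (real (card W) * (- (s * p) + 2 * l * (s * p)\<^sup>2))"
    by (simp add: exp_of_nat_mult)
  also have "\<dots> * exp (l * p * s\<^sup>2) = exp (real (card W) * (- (s * p) + 2 * l * (s * p)\<^sup>2) + l * p * s\<^sup>2)"
    by (simp add: exp_add)
  also have "\<dots> \<le> exp (- (N * s * p) + 5 * N * l * (s * p)\<^sup>2)"
  proof (subst exp_le_cancel_iff)
    \<comment> \<open>\<open>W\<close> misses at most \<open>card S + 1\<close> vertices. As
      \<open>N * p\<close> is at least 1, this loss and the edges inside \<open>S\<close> are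
      absorbed by the quadratic term; the constant is 5 = 2 + 1 + 2 from the facts 2, 3 and
      4.\<close>
    have "card V \<le> card (W \<union> S \<union> (D \<inter> V))"
      by (rule card_mono) (use fin fV in \<open>auto simp: W_def\<close>)
    also have "\<dots> \<le> card W + card S + card (D \<inter> V)"
      using card_Un_le[of "W \<union> S" "D \<inter> V"] card_Un_le[of W S] by linarith
    also have "card (D \<inter> V) \<le> 1"
      using D card_mono[OF D(1), of "D \<inter> V"] by simp
    finally have W: "real (card W) \<ge> N - s - 1" unfolding N_def s_def by linarith
    have WN: "real (card W) \<le> N" unfolding N_def W_def using fV by (auto intro: card_mono)
    have Np': "p * s\<^sup>2 \<le> N * (s * p)\<^sup>2"
    proof -
      have "p * s\<^sup>2 * 1 \<le> p * s\<^sup>2 * (N * p)"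
        using Np p by (intro mult_left_mono) (auto simp: N_def)
      thus ?thesis by (simp add: power2_eq_square mult_ac)
    qed
    have 1: "real (card W) * (s * p) \<ge> (N - s - 1) * (s * p)"
      using W s1 p by (intro mult_right_mono) auto
    have 2: "real (card W) * (2 * l * (s * p)\<^sup>2) \<le> N * (2 * l * (s * p)\<^sup>2)"
      using WN l0 by (intro mult_right_mono) auto
    have 3: "l * (p * s\<^sup>2) \<le> l * (N * (s * p)\<^sup>2)" using Np' l0 by (intro mult_left_mono) auto
    have "(s + 1) * (s * p) \<le> (2 * s) * (s * p)" using s1 p by (intro mult_right_mono) auto
    also have "\<dots> = 2 * (p * s\<^sup>2)" by (simp add: power2_eq_square)
    also have "1 * (p * s\<^sup>2) \<le> l * (p * s\<^sup>2)" using l p by (intro mult_right_mono) auto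
    hence "2 * (p * s\<^sup>2) \<le> 2 * (l * (p * s\<^sup>2))" by simp
    also have "\<dots> \<le> 2 * (l * (N * (s * p)\<^sup>2))" using 3 by simp
    finally have 4: "(s + 1) * (s * p) \<le> 2 * (l * (N * (s * p)\<^sup>2))" .
    show "real (card W) * (- (s * p) + 2 * l * (s * p)\<^sup>2) + l * p * s\<^sup>2
        \<le> - (N * s * p) + 5 * N * l * (s * p)\<^sup>2"
      using 1 2 3 4 by (simp add: algebra_simps)
  qed
  finally show ?thesis
    unfolding H_def E_def N_def s_def .
qed

subsection \<open>First moment over supports\<close>

lemma binomial_mult_power_le:
  fixes x :: real
  assumes "0 \<le> x"
  shows "real (n choose k) * x ^ k \<le> (1 + x) ^ n"
proof (cases "k \<le> n")
  case True
  have "real (n choose k) * x ^ k * 1 ^ (n - k) \<le> (\<Sum>k\<le>n. real (n choose k) * x ^ k * 1 ^ (n - k))"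
    by (rule member_le_sum) (use True assms in auto)
  also have "\<dots> = (x + 1) ^ n" by (rule binomial_ring[symmetric])
  finally show ?thesis by (simp add: add.commute)
next
  case False
  thus ?thesis using assms by (simp add: binomial_eq_0)
qed

lemma binomial_le_exp:
  assumes "0 < k" "0 < n"
  shows "real (n choose k) \<le> exp (real k) * (real n / real k) ^ k"
proof -
  define x where "x = real k / real n"
  have x: "x > 0" unfolding x_def using assms by simp
  have "real (n choose k) * x ^ k \<le> (1 + x) ^ n"
    by (rule binomial_mult_power_le) (use x in auto)
  also have "\<dots> \<le> exp x ^ n" using exp_ge_add_one_self[of x] x by (intro power_mono) auto
  also have "\<dots> = exp (real k)" using assms by (simp add: x_def exp_of_nat_mult[symmetric])
  finally have "real (n choose k) \<le> exp (real k) / x ^ k" using x by (simp add: field_simps)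
  also have "\<dots> = exp (real k) * (real n / real k) ^ k"
    by (simp add: x_def power_divide)
  finally show ?thesis .
qed

text \<open>The hypothesis is used with \<open>l = N / (s * \<mu>\<^sup>2)\<close> if this is at least 1, and with \<open>l = 1\<close>
  otherwise.\<close>

lemma binomial_mult_le_small:
  fixes P p :: real and N s :: nat
  defines "\<mu> \<equiv> real N * p"
  assumes s: "0 < s" "0 < N" and p: "0 < p" and \<mu>: "1 \<le> \<mu>" and sp: "real s * p \<le> 1 / 10"
    and P0: "0 \<le> P"
    and P: "\<And>l. 1 \<le> l \<Longrightarrow> P * l ^ (s - 1) \<le>
      exp (- (real N * real s * p) + 5 * real N * l * (real s * p)\<^sup>2)"
  shows "real (N choose s) * P \<le>
    real N * (exp 6 * \<mu>\<^sup>2 * exp (- \<mu>)) ^ s + (exp 1 * \<mu>\<^sup>2 * exp (- \<mu> / 2)) ^ s"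
proof -
  define q where "q = real N / real s"
  have q: "q > 0" "q \<le> real N" unfolding q_def using s by (auto simp: field_simps)
  obtain t where t: "s = Suc t" using s(1) by (cases s) auto
  have C: "real (N choose s) \<le> exp (real s) * q ^ s"
    unfolding q_def by (rule binomial_le_exp[OF s])
  have nn: "0 \<le> real N * (exp 6 * \<mu>\<^sup>2 * exp (- \<mu>)) ^ s" "0 \<le> (exp 1 * \<mu>\<^sup>2 * exp (- \<mu> / 2)) ^ s"
    by simp_all
  show ?thesis
  proof (cases "\<mu>\<^sup>2 \<le> q")
    case True
    \<comment> \<open>This choice turns the quadratic term into exactly \<open>5 * s\<close>; with
      the factor \<open>exp s\<close> of the binomial coefficient this gives \<open>exp 6\<close>.
      Since only \<open>l ^ (s - 1)\<close> is available, one factor \<open>q\<close> is left over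
      and is bounded by \<open>N\<close>.\<close>
    define l where "l = q / \<mu>\<^sup>2"
    have l: "l \<ge> 1" "q = l * \<mu>\<^sup>2" unfolding l_def using True \<mu> by auto
    have "5 * real N * l * (real s * p)\<^sup>2 = 5 * real s"
      unfolding l_def q_def \<mu>_def using s p by (simp add: field_simps power2_eq_square)
    with P[OF l(1)] have Pl: "P * l ^ t \<le> exp (5 * real s - real s * \<mu>)"
      by (simp add: t \<mu>_def mult_ac)
    have "real (N choose s) * P \<le> exp (real s) * q ^ s * P"
      by (rule mult_right_mono[OF C P0])
    also have "\<dots> = exp (real s) * (q * (\<mu>\<^sup>2) ^ t) * (P * l ^ t)"
      unfolding t power_Suc by (subst (2) l(2)) (simp add: power_mult_distrib mult_ac)
    also have "\<dots> \<le> exp (real s) * (q * (\<mu>\<^sup>2) ^ t) * exp (5 * real s - real s * \<mu>)"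
      using q by (intro mult_left_mono Pl) auto
    also have "\<dots> \<le> exp (real s) * (real N * (\<mu>\<^sup>2) ^ s) * exp (5 * real s - real s * \<mu>)"
    proof (intro mult_right_mono mult_left_mono mult_mono)
      have "1 * (\<mu>\<^sup>2) ^ t \<le> \<mu>\<^sup>2 * (\<mu>\<^sup>2) ^ t"
        using \<mu> by (intro mult_right_mono) (auto simp: one_le_power)
      thus "(\<mu>\<^sup>2) ^ t \<le> (\<mu>\<^sup>2) ^ s" by (simp add: t)
    qed (use q in auto)
    also have "\<dots> = real N * ((\<mu>\<^sup>2) ^ s * (exp (real s) * exp (5 * real s - real s * \<mu>)))"
      by (simp add: mult_ac)
    also have "exp (real s) * exp (5 * real s - real s * \<mu>) = exp (real s * (6 + - \<mu>))"
      by (simp add: exp_add[symmetric] algebra_simps)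
    also have "\<dots> = (exp 6 * exp (- \<mu>)) ^ s" by (simp only: exp_of_nat_mult exp_add)
    also have "real N * ((\<mu>\<^sup>2) ^ s * (exp 6 * exp (- \<mu>)) ^ s) =
        real N * (exp 6 * \<mu>\<^sup>2 * exp (- \<mu>)) ^ s"
      by (simp add: power_mult_distrib mult_ac)
    finally show ?thesis using nn by linarith
  next
    case False
    \<comment> \<open>With \<open>l = 1\<close> the condition \<open>s * p <= 1 / 10\<close> makes
      the quadratic term at most half of the linear one.\<close>
    have "P \<le> exp (- (real N * real s * p) + 5 * real N * 1 * (real s * p)\<^sup>2)"
      using P[of 1] by simp
    also have "\<dots> \<le> exp (real s * (- \<mu> / 2))"
    proof (subst exp_le_cancel_iff)
      have "5 * real N * 1 * (real s * p)\<^sup>2 = 5 * (real s * \<mu>) * (real s * p)"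
        by (simp add: \<mu>_def power2_eq_square)
      also have "\<dots> \<le> 5 * (real s * \<mu>) * (1 / 10)" using \<mu> by (intro mult_left_mono sp) auto
      finally show "- (real N * real s * p) + 5 * real N * 1 * (real s * p)\<^sup>2 \<le> real s * (- \<mu> / 2)"
        by (simp add: \<mu>_def mult_ac)
    qed
    also have "\<dots> = exp (- \<mu> / 2) ^ s" by (rule exp_of_nat_mult)
    finally have P': "P \<le> exp (- \<mu> / 2) ^ s" .
    have "real (N choose s) * P \<le> exp (real s) * q ^ s * exp (- \<mu> / 2) ^ s"
      by (intro mult_mono C P') (use P0 q in auto)
    also have "\<dots> \<le> exp (real s) * (\<mu>\<^sup>2) ^ s * exp (- \<mu> / 2) ^ s"
      using False q by (intro mult_right_mono mult_left_mono power_mono) auto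
    also have "exp (real s) = exp 1 ^ s" using exp_of_nat_mult[of s 1] by simp
    also have "exp 1 ^ s * (\<mu>\<^sup>2) ^ s * exp (- \<mu> / 2) ^ s = (exp 1 * \<mu>\<^sup>2 * exp (- \<mu> / 2)) ^ s"
      by (simp add: power_mult_distrib)
    finally show ?thesis using nn by linarith
  qed
qed

text \<open>Here \<open>2 * p * card S\<close> is at least 1 / 5, so the Littlewood--Offord bound is
  at most 1 / 2 + 0.84 / 2 = 1 - 2 / 25.\<close>

lemma prob_row_eq_0_le:
  assumes V: "finite V" "S \<subseteq> V" "v \<in> V" "v \<notin> S" and p: "0 < p" "p \<le> 1 / 2"
    and w: "\<And>j. j \<in> S \<Longrightarrow> w j \<noteq> 0" and sp: "1 / 10 \<le> real (card S) * p"
  shows "measure_pmf.prob (coins V p) {X. (\<Sum>j\<in>S. adj X v j * w j) = 0} \<le> exp (- 2 / 25)"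
proof -
  have fS: "finite S" using V finite_subset by blast
  have "{X. (\<Sum>j\<in>S. adj X v j * w j) = 0} = {X. (\<Sum>j\<in>S. w j * of_bool (j \<in> S \<and> X {v, j})) = 0}"
    by (intro Collect_cong arg_cong[where f = "\<lambda>x. x = 0"] sum.cong) (use V in \<open>auto simp: adj_def\<close>)
  hence "measure_pmf.prob (coins V p) {X. (\<Sum>j\<in>S. adj X v j * w j) = 0} =
      measure_pmf.prob (coin_pmf S p) {x. (\<Sum>j\<in>S. w j * of_bool (x j)) = 0}"
    using prob_coins_row[OF V, of p "\<lambda>x. (\<Sum>j\<in>S. w j * of_bool (x j)) = 0"] by simp
  also have "\<dots> \<le> 1 / 2 + exp (- 2 * p * real (card S)) / 2"
  proof (rule prob_linear_form_eq_le_exp)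
    have "{i \<in> S. w i \<noteq> 0} = S" using w by auto
    thus "card S \<le> card {i \<in> S. w i \<noteq> 0}" by simp
  qed (use fS p in auto)
  also have "exp (- 2 * p * real (card S)) \<le> exp (- (1 / 5))"
    using sp by (subst exp_le_cancel_iff) (simp add: mult_ac)
  also have "exp (- (1 / 5)) \<le> (1 - 1 / 5 + (1 / 5)\<^sup>2 :: real)"
    using exp_minus_le_quadratic[of "1 / 5"] by simp
  also have "1 / 2 + (1 - 1 / 5 + (1 / 5)\<^sup>2) / 2 \<le> (1 + (- 2 / 25) :: real)"
    by (simp add: power2_eq_square)
  also have "\<dots> \<le> exp (- 2 / 25)" by (rule exp_ge_add_one_self)
  finally show ?thesis by simp
qed

text \<open>At most \<open>card S\<close> rows \<open>R\<close> determine the vector up to a factor; the rows outside \<open>S\<close> and \<open>R\<close>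
  are independent of them, and each annihilates the vector with probability bounded away from 1.\<close>

lemma prob_rigid_le_large:
  assumes fV: "finite V" and S: "S \<subseteq> V" and D: "finite D" "card D \<le> 1" and p: "0 < p" "p \<le> 1 / 2"
    and sp: "1 / 10 \<le> real (card S) * p" and s: "card S < card V"
  shows "measure_pmf.prob (coins V p) {X. rigid V D S X} \<le>
    real (card V choose card S) * exp (- 2 / 25 * (real (card V) - 2 * real (card S) - 1))"
proof -
  define E where "E = coins V p"
  have finE: "finite (all_pairs V)" using fV by simp
  have fS: "finite S" using S fV finite_subset by blast
  define Rs where "Rs = {R. R \<subseteq> V \<and> card R = card S}"
  have fR: "finite Rs" unfolding Rs_def using fV by simp
  define det where "det = (\<lambda>R X w. (\<forall>j\<in>S. w j \<noteq> 0) \<and> (\<forall>v\<in>R - D. (\<Sum>j\<in>S. adj X v j * w j) = 0) \<and>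
    (\<forall>u. (\<forall>v\<in>R - D. (\<Sum>j\<in>S. adj X v j * u j) = 0) \<longrightarrow> (\<exists>c. \<forall>j\<in>S. u j = c * w j)))"
  define ev where "ev = (\<lambda>R X. \<exists>w. det R X w \<and> (\<forall>v\<in>V - D. (\<Sum>j\<in>S. adj X v j * w j) = 0))"
  have cover: "\<exists>R\<in>Rs. ev R X" if rigid: "rigid V D S X" for X
  proof -
    obtain w where w: "\<And>j. j \<in> S \<Longrightarrow> w j \<noteq> 0" "\<And>v. v \<in> V - D \<Longrightarrow> (\<Sum>j\<in>S. adj X v j * w j) = 0"
      "\<And>u. (\<forall>v\<in>V - D. (\<Sum>j\<in>S. adj X v j * u j) = 0) \<Longrightarrow> (\<exists>c. \<forall>j\<in>S. u j = c * w j)"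
      using rigid unfolding rigid_def by blast
    have "finite (V - D)" using fV by simp
    from exists_determining_rows[OF this fS, of "adj X"] obtain R0 where R0: "R0 \<subseteq> V - D"
        "card R0 \<le> card S"
        and det0: "\<forall>u. (\<forall>r\<in>R0. (\<Sum>j\<in>S. adj X r j * u j) = 0) \<longrightarrow>
          (\<forall>v\<in>V - D. (\<Sum>j\<in>S. adj X v j * u j) = 0)"
      by (elim exE conjE) (rule that)
    \<comment> \<open>Padding \<open>R0\<close> to exactly \<open>card S\<close> rows makes the
      number of candidates a single binomial coefficient.\<close>
    obtain R where R: "R0 \<subseteq> R" "R \<subseteq> V" "card R = card S"
      using exists_subset_between[of R0 "card S" V] R0(1,2) s fV by auto
    have "\<exists>c. \<forall>j\<in>S. u j = c * w j" if "\<forall>v\<in>R - D. (\<Sum>j\<in>S. adj X v j * u j) = 0" for u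
      by (rule w(3), rule det0[THEN spec, THEN mp]) (use that R(1) R0(1) in auto)
    hence "det R X w" unfolding det_def using w(1,2) R(2) by auto
    hence "ev R X" unfolding ev_def using w(2) by blast
    moreover have "R \<in> Rs" using R unfolding Rs_def by simp
    ultimately show ?thesis by blast
  qed
  have each: "measure_pmf.prob E {X. ev R X} \<le> exp (- 2 / 25 * (real (card V) - 2 * real (card S) - 1))"
    if R: "R \<in> Rs" for R
  proof -
    \<comment> \<open>Fixing the coins between \<open>R\<close> and \<open>S\<close> decides
      \<open>det\<close> and thus fixes the vector up to a factor. The rows in \<open>W\<close>
      avoid \<open>R\<close> and \<open>S\<close>, so their coins towards \<open>S\<close> lie
      outside \<open>K\<close> and are disjoint for different rows.\<close>
    define K where "K = {e. \<exists>r\<in>R. \<exists>j\<in>S. e = {r, j}}"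
    define W where "W = V - D - S - R"
    have fW: "finite W" unfolding W_def using fV by simp
    have det_cong: "det R X w = det R Y w" if "\<And>e. e \<in> K \<Longrightarrow> X e = Y e" for X Y w
    proof -
      have "adj X r j = adj Y r j" if "r \<in> R" "j \<in> S" for r j
        using \<open>\<And>e. e \<in> K \<Longrightarrow> X e = Y e\<close>[of "{r, j}"] that by (auto simp: adj_def K_def)
      hence "(\<Sum>j\<in>S. adj X r j * u j) = (\<Sum>j\<in>S. adj Y r j * u j)" if "r \<in> R - D" for r u
        using that by (intro sum.cong) auto
      thus ?thesis unfolding det_def by simp
    qed
    have cond: "measure_pmf.prob E {g. ev R (\<lambda>e. if e \<in> K then f e else g e)} \<le> exp (- 2 / 25) ^ card W" for f
    proof (cases "\<exists>w. det R f w")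
      case False
      have "\<not> ev R (\<lambda>e. if e \<in> K then f e else g e)" for g
        using False det_cong[of "\<lambda>e. if e \<in> K then f e else g e" f] unfolding ev_def by auto
      thus ?thesis by simp
    next
      case True
      then obtain w where w: "det R f w" by blast
      have kill: "(\<Sum>j\<in>S. adj g v j * w j) = 0"
        if ev: "ev R (\<lambda>e. if e \<in> K then f e else g e)" and v: "v \<in> W" for g v
      proof -
        define Z where "Z = (\<lambda>e. if e \<in> K then f e else g e)"
        have Zf: "det R Z x = det R f x" for x by (rule det_cong) (simp add: Z_def)
        have "ev R Z" using ev unfolding Z_def .
        then obtain x where x: "det R Z x" "\<forall>v\<in>V - D. (\<Sum>j\<in>S. adj Z v j * x j) = 0"
          unfolding ev_def by (elim exE conjE) (rule that)
        have "det R Z w" using w Zf by simp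
        hence "\<forall>v\<in>R - D. (\<Sum>j\<in>S. adj Z v j * w j) = 0"
          unfolding det_def by (elim conjE)
        with x(1) have "\<exists>c. \<forall>j\<in>S. w j = c * x j" unfolding det_def by (elim conjE allE[of _ w] mp)
        then obtain c where c: "\<forall>j\<in>S. w j = c * x j" by (elim exE)
        have "(\<Sum>j\<in>S. adj g v j * w j) = (\<Sum>j\<in>S. adj Z v j * w j)"
        proof (intro sum.cong refl)
          fix j assume "j \<in> S"
          hence "{v, j} \<notin> K" using v unfolding K_def W_def by (auto simp: doubleton_eq_iff)
          thus "adj g v j * w j = adj Z v j * w j" by (simp add: adj_def Z_def)
        qed
        also have "\<dots> = c * (\<Sum>j\<in>S. adj Z v j * x j)"
          unfolding sum_distrib_left using c by (intro sum.cong) auto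
        also have "\<dots> = 0" using x(2) v by (simp add: W_def)
        finally show ?thesis .
      qed
      have "\<forall>j\<in>S. w j \<noteq> 0" using w unfolding det_def by (elim conjE)
      hence wnz: "\<And>j. j \<in> S \<Longrightarrow> w j \<noteq> 0" by simp
      define h where "h = (\<lambda>v X. of_bool ((\<Sum>j\<in>S. adj X v j * w j) = 0) :: real)"
      have "measure_pmf.prob E {g. ev R (\<lambda>e. if e \<in> K then f e else g e)} \<le>
          measure_pmf.prob E {g. \<forall>v\<in>W. (\<Sum>j\<in>S. adj g v j * w j) = 0}"
        by (rule prob_mono) (use kill in blast)
      also have "\<dots> = measure_pmf.expectation E (\<lambda>g. \<Prod>v\<in>W. h v g)"
        unfolding prob_eq_expectation
        by (rule arg_cong[where f = "measure_pmf.expectation E"])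
           (use fW in \<open>auto simp: fun_eq_iff h_def prod_zero_iff\<close>)
      also have "\<dots> = (\<Prod>v\<in>W. measure_pmf.expectation E (h v))"
        unfolding E_def
      proof (rule expectation_coin_prod[OF finE fW])
        show "depends_on (h v) ((\<lambda>j. {v, j}) ` S)" for v
        proof (rule depends_onI)
          fix X Y :: "nat set \<Rightarrow> bool" assume "\<And>e. e \<in> (\<lambda>j. {v, j}) ` S \<Longrightarrow> X e = Y e"
          hence "(\<Sum>j\<in>S. adj X v j * w j) = (\<Sum>j\<in>S. adj Y v j * w j)"
            by (intro sum.cong) (auto simp: adj_def)
          thus "h v X = h v Y" by (simp add: h_def)
        qed
        show "disjoint_family_on (\<lambda>v. (\<lambda>j. {v, j}) ` S) W"
          unfolding disjoint_family_on_def W_def by (auto simp: doubleton_eq_iff)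
      qed
      also have "\<dots> \<le> (\<Prod>v\<in>W. exp (- 2 / 25))"
      proof (rule prod_mono, rule conjI)
        fix v assume v: "v \<in> W"
        show "0 \<le> measure_pmf.expectation E (h v)"
          by (rule integral_nonneg_AE) (auto simp: h_def)
        show "measure_pmf.expectation E (h v) \<le> exp (- 2 / 25)"
          unfolding h_def prob_eq_expectation[symmetric] E_def
          by (rule prob_row_eq_0_le) (use v fV S p wnz sp in \<open>auto simp: W_def\<close>)
      qed
      finally show ?thesis by simp
    qed
    have "measure_pmf.prob E {X. ev R X} \<le> exp (- 2 / 25) ^ card W"
      unfolding E_def
      by (rule prob_coin_condition_le[OF finE, where P = "ev R" and J = K]) (rule cond[unfolded E_def])
    also have "\<dots> = exp (real (card W) * (- 2 / 25))" by (rule exp_of_nat_mult[symmetric])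
    also have "\<dots> \<le> exp (- 2 / 25 * (real (card V) - 2 * real (card S) - 1))"
    proof (subst exp_le_cancel_iff)
      have "finite R" using R fV finite_subset unfolding Rs_def by auto
      hence "card V \<le> card (W \<union> D \<union> S \<union> R)"
        by (intro card_mono) (use fW D fS in \<open>auto simp: W_def\<close>)
      also have "\<dots> \<le> card W + card D + card S + card R"
        using card_Un_le[of "W \<union> D \<union> S" R] card_Un_le[of "W \<union> D" S] card_Un_le[of W D] by linarith
      finally have "real (card V) \<le> real (card W) + 1 + 2 * real (card S)"
        using D(2) R unfolding Rs_def by simp
      thus "real (card W) * (- 2 / 25) \<le> - 2 / 25 * (real (card V) - 2 * real (card S) - 1)" by simp
    qed
    finally show ?thesis .
  qed
  have "measure_pmf.prob E {X. rigid V D S X} \<le> measure_pmf.prob E {X. \<exists>R\<in>Rs. ev R X}"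
    by (rule prob_mono) (use cover in blast)
  also have "\<dots> \<le> (\<Sum>R\<in>Rs. measure_pmf.prob E {X. ev R X})" by (rule prob_ex_le[OF fR])
  also have "\<dots> \<le> (\<Sum>R\<in>Rs. exp (- 2 / 25 * (real (card V) - 2 * real (card S) - 1)))"
    by (rule sum_mono[OF each])
  also have "\<dots> = real (card V choose card S) * exp (- 2 / 25 * (real (card V) - 2 * real (card S) - 1))"
    unfolding Rs_def by (simp add: n_subsets[OF fV])
  finally show ?thesis unfolding E_def .
qed

text \<open>The binomial theorem at 1 / 200, with \<open>200 <= exp 6\<close> obtained from
  \<open>(5 / 2) ^ 6\<close>; the exponent is (1 + 6) / 200.\<close>

lemma binomial_le_exp_small:
  assumes "real k \<le> real n / 200"
  shows "real (n choose k) \<le> exp (7 * real n / 200)"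
proof -
  have "(5 / 2 :: real) \<le> exp 1"
    using exp_lower_Taylor_quadratic[of "1 :: real"] by simp
  hence "(5 / 2 :: real) ^ 6 \<le> exp 1 ^ 6" by (intro power_mono) auto
  moreover have "exp 1 ^ 6 = exp (6 :: real)" by (simp add: exp_of_nat_mult[symmetric])
  ultimately have e6: "200 \<le> exp (6 :: real)" by (simp add: power_divide)
  have "real (n choose k) * (1 / 200) ^ k \<le> (1 + 1 / 200) ^ n"
    by (rule binomial_mult_power_le) simp
  also have "\<dots> \<le> exp (1 / 200) ^ n"
    using exp_ge_add_one_self[of "1 / 200"] by (intro power_mono) auto
  also have "\<dots> = exp (real n / 200)" by (simp add: exp_of_nat_mult[symmetric])
  finally have "real (n choose k) \<le> exp (real n / 200) * 200 ^ k"
    by (simp add: power_divide field_simps)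
  also have "(200 :: real) ^ k \<le> exp 6 ^ k" using e6 by (intro power_mono) auto
  also have "exp 6 ^ k = exp (real k * 6)" by (rule exp_of_nat_mult[symmetric])
  also have "\<dots> \<le> exp (6 * real n / 200)" using assms by simp
  also have "exp (real n / 200) * exp (6 * real n / 200) = exp (7 * real n / 200)"
    by (simp add: exp_add[symmetric])
  finally show ?thesis by simp
qed

text \<open>The factor is the number of supports of this size, so the left side is ready for the
  union bound. The proof switches from neighbourhood patterns to determining rows at
  \<open>card S * p = 1 / 10\<close>.\<close>

lemma binomial_mult_prob_rigid_le:
  fixes V D S :: "nat set" and p :: real
  defines "N \<equiv> card V"
  defines "\<mu> \<equiv> real N * p"
  assumes fV: "finite V" and S: "S \<subseteq> V" "S \<noteq> {}" and D: "finite D" "card D \<le> 1"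
    and p: "0 < p" "p \<le> 1 / 2" and \<mu>: "1 \<le> \<mu>" and small: "real (card S) \<le> real N / 200"
  shows "real (N choose card S) * measure_pmf.prob (coins V p) {X. rigid V D S X} \<le>
    real N * (exp 6 * \<mu>\<^sup>2 * exp (- \<mu>)) ^ card S + (exp 1 * \<mu>\<^sup>2 * exp (- \<mu> / 2)) ^ card S +
    exp (1 - real N / 125)"
proof -
  have N: "N > 0" using \<mu> unfolding \<mu>_def by (intro Nat.gr0I) auto
  have fS: "finite S" using S fV finite_subset by blast
  have s: "0 < card S" using S fS by (simp add: card_gt_0_iff)
  define P where "P = measure_pmf.prob (coins V p) {X. rigid V D S X}"
  have P0: "0 \<le> P" unfolding P_def by simp
  show ?thesis
  proof (cases "real (card S) * p \<le> 1 / 10")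
    case True
    have "P * l ^ (card S - 1) \<le> exp (- (real N * real (card S) * p) + 5 * real N * l * (real (card S) * p)\<^sup>2)"
      if l: "1 \<le> l" for l
    proof -
      have "P * l ^ (card S - 1) \<le> measure_pmf.prob (coins V p) {X. (\<forall>v\<in>V - D. card (nbrs X S v) \<noteq> 1) \<and>
        card S \<le> card {v \<in> V - D. nbrs X S v \<noteq> {}} + 1} * l ^ (card S - 1)"
        unfolding P_def using l rigid_imp_nbrs[OF fV S(1) _ S(2)]
        by (intro mult_right_mono prob_mono) auto
      also have "\<dots> \<le> exp (- (real N * real (card S) * p) + 5 * real N * l * (real (card S) * p)\<^sup>2)"
        unfolding N_def by (rule prob_nbr_pattern_le[OF fV S D p l]) (use \<mu> in \<open>simp add: \<mu>_def N_def\<close>)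
      finally show ?thesis .
    qed
    from binomial_mult_le_small[OF s N p(1) \<mu>[unfolded \<mu>_def] True P0 this]
    have "real (N choose card S) * P \<le>
      real N * (exp 6 * \<mu>\<^sup>2 * exp (- \<mu>)) ^ card S + (exp 1 * \<mu>\<^sup>2 * exp (- \<mu> / 2)) ^ card S"
      unfolding \<mu>_def by simp
    thus ?thesis unfolding P_def using exp_ge_zero[of "1 - real N / 125"] by linarith
  next
    case False
    have lt: "card S < N" using small N by (simp add: field_simps)
    have "P \<le> real (N choose card S) * exp (- 2 / 25 * (real N - 2 * real (card S) - 1))"
      unfolding P_def N_def
      by (rule prob_rigid_le_large[OF fV S(1) D p]) (use False lt in \<open>auto simp: N_def\<close>)
    hence "real (N choose card S) * P \<le> real (N choose card S) *
        (real (N choose card S) * exp (- 2 / 25 * (real N - 2 * real (card S) - 1)))"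
      by (rule mult_left_mono) simp
    also have "\<dots> \<le> exp (7 * real N / 200) * (exp (7 * real N / 200) *
        exp (- 2 / 25 * (real N - 2 * real (card S) - 1)))"
      by (intro mult_mono binomial_le_exp_small small) auto
    also have "\<dots> = exp (7 * real N / 200 + (7 * real N / 200 - 2 / 25 * (real N - 2 * real (card S) - 1)))"
      by (simp add: exp_add[symmetric])
    \<comment> \<open>Two binomial coefficients cost 14 / 200 = 0.07 per vertex, and the fresh rows
      gain at least 0.08 * 0.99; the difference exceeds 1 / 125. The 1 pays for the exempted
      row.\<close>
    also have "\<dots> \<le> exp (1 - real N / 125)"
    proof (subst exp_le_cancel_iff)
      show "7 * real N / 200 + (7 * real N / 200 - 2 / 25 * (real N - 2 * real (card S) - 1))
          \<le> 1 - real N / 125"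
        using small by (simp add: field_simps)
    qed
    finally have "real (N choose card S) * P \<le> exp (1 - real N / 125)" .
    moreover have "0 \<le> real N * (exp 6 * \<mu>\<^sup>2 * exp (- \<mu>)) ^ card S"
        "0 \<le> (exp 1 * \<mu>\<^sup>2 * exp (- \<mu> / 2)) ^ card S" by simp_all
    ultimately show ?thesis unfolding P_def by linarith
  qed
qed

lemma sum_power_ge_2_le:
  fixes x :: real
  assumes "0 \<le> x" "x \<le> 1 / 2"
  shows "(\<Sum>s\<in>{2..n}. x ^ s) \<le> 2 * x\<^sup>2"
proof -
  have "(\<Sum>s\<in>{2..n}. x ^ s) \<le> 2 * x\<^sup>2 - 2 * x ^ (n + 1)" if "n \<ge> 1"
    using that
  proof (induction n rule: dec_induct)
    case base
    show ?case by (simp add: power2_eq_square)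
  next
    case (step n)
    have "x ^ Suc n * (2 * x) \<le> x ^ Suc n * 1" using assms by (intro mult_left_mono) auto
    moreover have "{2..Suc n} = insert (Suc n) {2..n}" using step by auto
    ultimately show ?case using step by (simp add: algebra_simps)
  qed
  moreover have "(\<Sum>s\<in>{2..0::nat}. x ^ s) = 0" by simp
  ultimately show ?thesis using assms
    by (cases "n \<ge> 1") (auto simp: not_le intro: order_trans[of _ "2 * x\<^sup>2 - 2 * x ^ (n + 1)"])
qed

text \<open>The first two terms bound the geometric sums over sizes at least two in the pattern
  regime, and size two dominates them; the third is the regime of determining rows. The constant
  \<open>exp 6\<close> in the second term is generous so that one smallness condition serves both
  sums.\<close>

definition rigid_bound :: "nat \<Rightarrow> real \<Rightarrow> real" where
  "rigid_bound N p = (let \<mu> = real N * p in 2 * real N * (exp 6 * \<mu>\<^sup>2 * exp (- \<mu>))\<^sup>2 +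
     2 * (exp 6 * \<mu>\<^sup>2 * exp (- \<mu> / 2))\<^sup>2 + real N * exp (1 - real N / 125))"

text \<open>Size one is left out: such supports are leaves or isolated vertices and are far more
  likely, so they are treated by hand.\<close>

definition small_rigid :: "nat set \<Rightarrow> nat set \<Rightarrow> (nat set \<Rightarrow> bool) \<Rightarrow> bool" where
  "small_rigid V D X \<longleftrightarrow> (\<exists>S\<subseteq>V. 2 \<le> card S \<and> real (card S) \<le> real (card V) / 200 \<and> rigid V D S X)"

text \<open>The last condition bounds the ratios of the geometric series by 1 / 2.\<close>

definition admissible :: "nat \<Rightarrow> real \<Rightarrow> bool" where
  "admissible N p \<longleftrightarrow> 0 < p \<and> p \<le> 1 / 2 \<and> 1 \<le> real N * p \<and>
    exp 6 * (real N * p)\<^sup>2 * exp (- (real N * p) / 2) \<le> 1 / 2"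

lemma prob_small_rigid_le:
  assumes fV: "finite V" and D: "finite D" "card D \<le> 1" and adm: "admissible (card V) p"
  shows "measure_pmf.prob (coins V p) {X. small_rigid V D X} \<le> rigid_bound (card V) p"
proof -
  define N where "N = card V"
  define \<mu> where "\<mu> = real N * p"
  define y where "y = exp 6 * \<mu>\<^sup>2 * exp (- \<mu>)"
  define x where "x = exp 1 * \<mu>\<^sup>2 * exp (- \<mu> / 2)"
  define x' where "x' = exp 6 * \<mu>\<^sup>2 * exp (- \<mu> / 2)"
  have p: "0 < p" "p \<le> 1 / 2" and \<mu>: "1 \<le> \<mu>" and x': "x' \<le> 1 / 2"
    using adm unfolding admissible_def \<mu>_def N_def x'_def by auto
  have y: "0 \<le> y" "y \<le> x'" unfolding y_def x'_def using \<mu> by (auto intro!: mult_left_mono)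
  have x: "0 \<le> x" "x \<le> x'" unfolding x_def x'_def using \<mu> by (auto intro!: mult_right_mono)
  define A where "A = (\<lambda>s. {S. S \<subseteq> V \<and> card S = s})"
  define I where "I = {s \<in> {2..N}. real s \<le> real N / 200}"
  have fin: "finite (A s)" "finite I" for s unfolding A_def I_def using fV by auto
  have level: "(\<Sum>S\<in>A s. measure_pmf.prob (coins V p) {X. rigid V D S X}) \<le>
      real N * y ^ s + x ^ s + exp (1 - real N / 125)" if s: "s \<in> I" for s
  proof -
    define b where "b = real N * y ^ s + x ^ s + exp (1 - real N / 125)"
    have C: "real (N choose s) > 0" using s by (simp add: I_def)
    have "(\<Sum>S\<in>A s. measure_pmf.prob (coins V p) {X. rigid V D S X}) \<le> (\<Sum>S\<in>A s. b / real (N choose s))"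
    proof (rule sum_mono)
      fix S assume S: "S \<in> A s"
      have "S \<noteq> {}" using S s by (auto simp: A_def I_def)
      have "real (N choose card S) * measure_pmf.prob (coins V p) {X. rigid V D S X} \<le> b"
        unfolding b_def y_def x_def using binomial_mult_prob_rigid_le[OF fV _ \<open>S \<noteq> {}\<close> D p] S s \<mu>
        by (simp add: A_def I_def N_def \<mu>_def)
      thus "measure_pmf.prob (coins V p) {X. rigid V D S X} \<le> b / real (N choose s)"
        using C S by (simp add: A_def field_simps)
    qed
    also have "\<dots> = b" using C by (simp add: A_def n_subsets[OF fV] N_def)
    finally show ?thesis unfolding b_def .
  qed
  have "measure_pmf.prob (coins V p) {X. small_rigid V D X} \<le>
      measure_pmf.prob (coins V p) {X. \<exists>s\<in>I. \<exists>S\<in>A s. rigid V D S X}"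
  proof (rule prob_mono)
    fix X assume "small_rigid V D X"
    then obtain S where "S \<subseteq> V" "2 \<le> card S" "real (card S) \<le> real N / 200" "rigid V D S X"
      unfolding small_rigid_def N_def by blast
    thus "\<exists>s\<in>I. \<exists>S\<in>A s. rigid V D S X"
      using card_mono[OF fV \<open>S \<subseteq> V\<close>]
      by (intro bexI[of _ "card S"] bexI[of _ S]) (simp_all add: I_def A_def N_def)
  qed
  also have "\<dots> \<le> (\<Sum>s\<in>I. measure_pmf.prob (coins V p) {X. \<exists>S\<in>A s. rigid V D S X})"
    by (rule prob_ex_le[OF fin(2)])
  also have "\<dots> \<le> (\<Sum>s\<in>I. \<Sum>S\<in>A s. measure_pmf.prob (coins V p) {X. rigid V D S X})"
    by (intro sum_mono prob_ex_le fin)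
  also have "\<dots> \<le> (\<Sum>s\<in>I. real N * y ^ s + x ^ s + exp (1 - real N / 125))"
    by (intro sum_mono level)
  also have "\<dots> \<le> (\<Sum>s\<in>{2..N}. real N * y ^ s + x ^ s + exp (1 - real N / 125))"
    by (intro sum_mono2) (use x y in \<open>auto simp: I_def\<close>)
  also have "\<dots> = real N * (\<Sum>s\<in>{2..N}. y ^ s) + (\<Sum>s\<in>{2..N}. x ^ s) +
      real (N - 1) * exp (1 - real N / 125)"
    by (simp add: sum.distrib sum_distrib_left)
  also have "\<dots> \<le> real N * (2 * y\<^sup>2) + 2 * x\<^sup>2 + real N * exp (1 - real N / 125)"
    by (intro add_mono mult_left_mono mult_right_mono sum_power_ge_2_le) (use x y x' in auto)
  also have "2 * x\<^sup>2 \<le> 2 * x'\<^sup>2" using x by (intro mult_left_mono power_mono) auto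
  finally show ?thesis
    unfolding rigid_bound_def Let_def y_def x'_def \<mu>_def N_def by simp
qed

subsection \<open>Kernel vectors with large support\<close>

definition mat_app :: "nat set \<Rightarrow> (nat set \<Rightarrow> bool) \<Rightarrow> (nat \<Rightarrow> real) \<Rightarrow> nat \<Rightarrow> real" where
  "mat_app V X w v = (\<Sum>j\<in>V. adj X v j * w j)"

definition isolated :: "nat set \<Rightarrow> (nat set \<Rightarrow> bool) \<Rightarrow> nat \<Rightarrow> bool" where
  "isolated V X v \<longleftrightarrow> nbrs X V v = {}"

lemma adj_isolated: "isolated V X j \<Longrightarrow> v \<in> V \<Longrightarrow> adj X v j = 0"
  unfolding isolated_def nbrs_def adj_def by (auto simp: insert_commute)

lemma mat_app_isolated: "isolated V X v \<Longrightarrow> mat_app V X w v = 0"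
  unfolding mat_app_def isolated_def by (rule sum_adj_eq_0)

lemma mat_app_cong_nonisolated:
  assumes "v \<in> V" "\<And>j. j \<in> V \<Longrightarrow> \<not> isolated V X j \<Longrightarrow> w j = w' j"
  shows "mat_app V X w v = mat_app V X w' v"
  unfolding mat_app_def
proof (rule sum.cong[OF refl])
  fix j assume "j \<in> V"
  thus "adj X v j * w j = adj X v j * w' j"
    using assms adj_isolated[of V X j v] by (cases "isolated V X j") auto
qed

lemma mat_app_symmetric:
  "(\<Sum>v\<in>V. u v * mat_app V X w v) = (\<Sum>v\<in>V. w v * mat_app V X u v)"
proof -
  have "(\<Sum>v\<in>V. u v * mat_app V X w v) = (\<Sum>v\<in>V. \<Sum>j\<in>V. adj X v j * u v * w j)"
    by (simp add: mat_app_def sum_distrib_left mult_ac)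
  also have "\<dots> = (\<Sum>j\<in>V. \<Sum>v\<in>V. adj X v j * u v * w j)" by (rule sum.swap)
  also have "\<dots> = (\<Sum>v\<in>V. w v * mat_app V X u v)"
    by (simp add: mat_app_def sum_distrib_left mult_ac adj_sym)
  finally show ?thesis .
qed

text \<open>Isolated vertices are removed from the support first, since kernel entries there are
  arbitrary. Then a minimal support is taken; if it is a single vertex \<open>j\<close>, every row
  meeting \<open>j\<close> is exempted, which is the second alternative.\<close>

lemma small_support_imp_small_rigid:
  assumes fV: "finite V" and i: "i \<in> V" "\<not> isolated V X i" "w i \<noteq> 0"
    and small: "real (card {j \<in> V. w j \<noteq> 0}) \<le> real (card V) / 200"
    and ker: "\<And>v. v \<in> V - D \<Longrightarrow> mat_app V X w v = 0"
  shows "small_rigid V D X \<or> (\<exists>j\<in>V. nbrs X V j \<noteq> {} \<and> nbrs X V j \<subseteq> D)"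
proof -
  define S where "S = {j \<in> V. w j \<noteq> 0 \<and> \<not> isolated V X j}"
  have fS: "finite S" unfolding S_def using fV by simp
  have nz: "\<exists>j\<in>S. w j \<noteq> 0" using i by (auto simp: S_def)
  have kerS: "\<forall>v\<in>V - D. (\<Sum>j\<in>S. adj X v j * w j) = 0"
  proof
    fix v assume v: "v \<in> V - D"
    have "(\<Sum>j\<in>S. adj X v j * w j) = mat_app V X w v"
      unfolding mat_app_def
      by (rule sum.mono_neutral_left) (use fV v adj_isolated[of V X _ v] in \<open>auto simp: S_def\<close>)
    thus "(\<Sum>j\<in>S. adj X v j * w j) = 0" using ker[OF v] by simp
  qed
  obtain S' u where S': "S' \<subseteq> S" "S' \<noteq> {}" and u: "\<forall>j\<in>S'. u j \<noteq> 0"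
      "\<forall>t\<in>V - D. (\<Sum>j\<in>S'. adj X t j * u j) = 0"
      and uniq: "\<forall>y. (\<forall>t\<in>V - D. (\<Sum>j\<in>S'. adj X t j * y j) = 0) \<longrightarrow> (\<exists>c. \<forall>j\<in>S'. y j = c * u j)"
    using minimal_support_solution[where T = "V - D" and a = "adj X", OF fS nz kerS] by (elim exE conjE) (rule that)
  have rigid: "rigid V D S' X"
    unfolding rigid_def by (intro exI[of _ u] conjI u uniq)
  have fS': "finite S'" using S' fS finite_subset by blast
  have "card S' \<le> card {j \<in> V. w j \<noteq> 0}"
    by (rule card_mono) (use fV S' in \<open>auto simp: S_def\<close>)
  hence card: "real (card S') \<le> real (card V) / 200" using small by linarith
  have SV: "S' \<subseteq> V" using S' unfolding S_def by auto
  show ?thesis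
  proof (cases "2 \<le> card S'")
    case True
    thus ?thesis using rigid card SV unfolding small_rigid_def by blast
  next
    case False
    moreover have "card S' > 0" using S' fS' by (simp add: card_gt_0_iff)
    ultimately have "card S' = 1" by linarith
    then obtain j where j: "S' = {j}" by (meson card_1_singletonE)
    have jV: "j \<in> V" "\<not> isolated V X j" using S' j by (auto simp: S_def)
    have "adj X v j = 0" if "v \<in> V - D" for v
      using u that j by auto
    hence "nbrs X V j \<subseteq> D" unfolding nbrs_def adj_def by (auto simp: insert_commute)
    thus ?thesis using jV unfolding isolated_def by blast
  qed
qed

section \<open>Rows of the inverse with large support\<close>

text \<open>The vectors \<open>w\<close> are the candidates for row \<open>i\<close> of the inverse.
  Quantifying over all of them avoids assuming that an inverse exists, and covers the free entries
  at isolated vertices.\<close>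

definition sharp :: "nat set \<Rightarrow> (nat set \<Rightarrow> bool) \<Rightarrow> nat \<Rightarrow> bool" where
  "sharp V X i \<longleftrightarrow> \<not> isolated V X i \<and>
    (\<forall>w. (\<forall>v\<in>V. mat_app V X w v = of_bool (v = i)) \<longrightarrow>
      real (card {j \<in> V. w j \<noteq> 0}) > real (card V) / 200)"

text \<open>A small candidate \<open>w\<close> is a kernel vector except in row \<open>i\<close>, so
  the support argument applies with \<open>D = {i}\<close>. Its degenerate case is a leaf attached
  to \<open>i\<close>.\<close>

lemma not_sharp_cases:
  assumes fV: "finite V" and i: "i \<in> V" "\<not> sharp V X i"
  shows "small_rigid V {i} X \<or> (\<exists>j\<in>V - {i}. nbrs X V j = {i}) \<or> isolated V X i"
proof (rule ccontr)
  assume neg: "\<not> ?thesis"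
  hence nl: "\<not> isolated V X i" "\<not> (\<exists>j\<in>V - {i}. nbrs X V j = {i})" by blast+
  with i obtain w where w: "\<forall>v\<in>V. mat_app V X w v = of_bool (v = i)"
      "\<not> real (card {j \<in> V. w j \<noteq> 0}) > real (card V) / 200"
    unfolding sharp_def by blast
  have "\<exists>k\<in>V. \<not> isolated V X k \<and> w k \<noteq> 0"
  proof (rule ccontr)
    assume "\<not> ?thesis"
    hence "mat_app V X w i = mat_app V X (\<lambda>_. 0) i"
      by (intro mat_app_cong_nonisolated i) auto
    thus False using w(1) i by (simp add: mat_app_def)
  qed
  then obtain k where k: "k \<in> V" "\<not> isolated V X k" "w k \<noteq> 0" by blast
  have "small_rigid V {i} X \<or> (\<exists>j\<in>V. nbrs X V j \<noteq> {} \<and> nbrs X V j \<subseteq> {i})"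
    by (rule small_support_imp_small_rigid[where w = w, OF fV k]) (use w in auto)
  moreover have False if "j \<in> V" "nbrs X V j \<noteq> {}" "nbrs X V j \<subseteq> {i}" for j
  proof -
    have eq: "nbrs X V j = {i}" using that by blast
    moreover have "j \<noteq> i"
    proof
      assume "j = i"
      hence "j \<in> nbrs X V j" using eq by simp
      thus False by (simp add: nbrs_def)
    qed
    ultimately show False using nl(2) that(1) by blast
  qed
  ultimately show False using neg by blast
qed

text \<open>The second term bounds the expected number of leaves at a given vertex plus the
  probability that this vertex is isolated.\<close>

definition sharp_bound :: "nat \<Rightarrow> real \<Rightarrow> real" where
  "sharp_bound N p = rigid_bound N p + exp 1 * (real N * p + 1) * exp (- (real N * p))"

text \<open>Up to two missing factors cost at most \<open>exp (2 * p)\<close>, hence at most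
  \<open>exp 1\<close>.\<close>

lemma power_1_minus_le_exp:
  assumes "0 < p" "p \<le> 1 / 2" "N \<le> k + 2"
  shows "(1 - p) ^ k \<le> exp 1 * exp (- (real N * p))"
proof -
  have "(1 - p) ^ k \<le> exp (- p) ^ k"
    using assms exp_ge_add_one_self[of "- p"] by (intro power_mono) auto
  also have "\<dots> = exp (- (real k * p))" by (simp add: exp_of_nat_mult[symmetric])
  also have "\<dots> \<le> exp (1 + - (real N * p))"
  proof (subst exp_le_cancel_iff)
    have "real N * p \<le> (real k + 2) * p" using assms by (intro mult_right_mono) auto
    thus "- (real k * p) \<le> 1 + - (real N * p)" using assms by (simp add: algebra_simps)
  qed
  finally show ?thesis by (simp only: exp_add)
qed

lemma prob_isolated_le:
  assumes "finite V" "v \<in> V" "0 < p" "p \<le> 1 / 2"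
  shows "measure_pmf.prob (coins V p) {X. isolated V X v} \<le> exp 1 * exp (- (real (card V) * p))"
proof -
  have "{X. isolated V X v} = {X. nbrs X (V - {v}) v = {}}"
    unfolding isolated_def nbrs_def by auto
  also have "measure_pmf.prob (coins V p) \<dots> = (1 - p) ^ card (V - {v})"
    by (rule prob_no_nbrs) (use assms in auto)
  also have "\<dots> \<le> exp 1 * exp (- (real (card V) * p))"
    by (rule power_1_minus_le_exp) (use assms in auto)
  finally show ?thesis .
qed

lemma prob_leaf_le:
  assumes fV: "finite V" and ij: "i \<in> V" "j \<in> V" "i \<noteq> j" and p: "0 < p" "p \<le> 1 / 2"
  shows "measure_pmf.prob (coins V p) {X. nbrs X V j = {i}} \<le> p * (exp 1 * exp (- (real (card V) * p)))"
proof -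
  define U where "U = V - {i, j}"
  have fU: "finite U" unfolding U_def using fV by simp
  define F where "F = (\<lambda>X. of_bool (X {i, j}) :: real)"
  define G where "G = (\<lambda>X. of_bool (nbrs X U j = {}) :: real)"
  have "measure_pmf.prob (coins V p) {X. nbrs X V j = {i}} \<le>
      measure_pmf.prob (coins V p) {X. X {i, j} \<and> nbrs X U j = {}}"
  proof (rule prob_mono, rule conjI)
    fix X assume X: "nbrs X V j = {i}"
    hence "i \<in> nbrs X V j" by simp
    thus "X {i, j}" unfolding nbrs_def by (simp add: insert_commute)
    have "nbrs X U j = nbrs X V j \<inter> U" unfolding nbrs_def U_def by blast
    thus "nbrs X U j = {}" unfolding X U_def by simp
  qed
  also have "\<dots> = measure_pmf.expectation (coins V p) (\<lambda>X. F X * G X)"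
    by (simp add: prob_eq_expectation F_def G_def of_bool_conj)
  also have "\<dots> = measure_pmf.expectation (coins V p) F * measure_pmf.expectation (coins V p) G"
  proof (rule expectation_coin_mult)
    show "depends_on F {{i, j}}" by (rule depends_onI) (simp add: F_def)
    show "depends_on G ((\<lambda>u. {j, u}) ` U)"
    proof (rule depends_onI)
      fix X Y :: "nat set \<Rightarrow> bool" assume "\<And>e. e \<in> (\<lambda>u. {j, u}) ` U \<Longrightarrow> X e = Y e"
      hence "nbrs X U j = nbrs Y U j" unfolding nbrs_def by auto
      thus "G X = G Y" by (simp add: G_def)
    qed
  qed (use fV in \<open>auto simp: U_def doubleton_eq_iff\<close>)
  also have "measure_pmf.expectation (coins V p) F = p"
    unfolding F_def using expectation_coin[of "all_pairs V" "{i, j}" p of_bool] fV ij p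
    by (simp add: pair_in_all_pairs_iff)
  also have "measure_pmf.expectation (coins V p) G = (1 - p) ^ card U"
    unfolding G_def prob_eq_expectation[symmetric]
    by (rule prob_no_nbrs) (use fV ij p in \<open>auto simp: U_def\<close>)
  also have "(1 - p) ^ card U \<le> exp 1 * exp (- (real (card V) * p))"
    by (rule power_1_minus_le_exp) (use fV ij p in \<open>auto simp: U_def card_Diff_subset\<close>)
  finally show ?thesis using p by simp
qed

lemma prob_not_sharp_le:
  assumes fV: "finite V" and i: "i \<in> V" and adm: "admissible (card V) p"
  shows "measure_pmf.prob (coins V p) {X. \<not> sharp V X i} \<le> sharp_bound (card V) p"
proof -
  define q where "q = exp 1 * exp (- (real (card V) * p))"
  have p: "0 < p" "p \<le> 1 / 2" using adm unfolding admissible_def by auto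
  have "measure_pmf.prob (coins V p) {X. \<not> sharp V X i} \<le>
      measure_pmf.prob (coins V p) {X. small_rigid V {i} X \<or>
        ((\<exists>j\<in>V - {i}. nbrs X V j = {i}) \<or> isolated V X i)}"
    by (rule prob_mono) (use not_sharp_cases[OF fV i] in blast)
  also have "\<dots> \<le> measure_pmf.prob (coins V p) {X. small_rigid V {i} X} +
      measure_pmf.prob (coins V p) {X. (\<exists>j\<in>V - {i}. nbrs X V j = {i}) \<or> isolated V X i}"
    by (rule prob_disj_le)
  also have "\<dots> \<le> measure_pmf.prob (coins V p) {X. small_rigid V {i} X} +
      (measure_pmf.prob (coins V p) {X. \<exists>j\<in>V - {i}. nbrs X V j = {i}} +
       measure_pmf.prob (coins V p) {X. isolated V X i})"
    by (intro add_left_mono prob_disj_le)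
  also have "\<dots> \<le> rigid_bound (card V) p + ((\<Sum>j\<in>V - {i}. p * q) + q)"
  proof (intro add_mono)
    have "measure_pmf.prob (coins V p) {X. \<exists>j\<in>V - {i}. nbrs X V j = {i}} \<le>
        (\<Sum>j\<in>V - {i}. measure_pmf.prob (coins V p) {X. nbrs X V j = {i}})"
      by (rule prob_ex_le) (use fV in simp)
    also have "\<dots> \<le> (\<Sum>j\<in>V - {i}. p * q)"
      unfolding q_def by (intro sum_mono prob_leaf_le) (use fV i p in auto)
    finally show "measure_pmf.prob (coins V p) {X. \<exists>j\<in>V - {i}. nbrs X V j = {i}} \<le>
      (\<Sum>j\<in>V - {i}. p * q)" .
    show "measure_pmf.prob (coins V p) {X. isolated V X i} \<le> q"
      unfolding q_def by (rule prob_isolated_le[OF fV i p])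
    show "measure_pmf.prob (coins V p) {X. small_rigid V {i} X} \<le> rigid_bound (card V) p"
      by (rule prob_small_rigid_le) (use fV adm in auto)
  qed
  also have "(\<Sum>j\<in>V - {i}. p * q) \<le> (\<Sum>j\<in>V. p * q)"
    by (rule sum_mono2) (use fV p in \<open>auto simp: q_def\<close>)
  also have "\<dots> = real (card V) * p * q" by simp
  finally show ?thesis unfolding sharp_bound_def q_def by (simp add: algebra_simps)
qed

definition typical :: "nat set \<Rightarrow> (nat set \<Rightarrow> bool) \<Rightarrow> bool" where
  "typical V X \<longleftrightarrow> \<not> small_rigid V {} X \<and>
    \<not> real (card {i \<in> V. \<not> sharp V X i}) \<ge> real (card V) / 2"

lemma adj_cong_on:
  assumes "\<And>e. e \<in> all_pairs V \<Longrightarrow> X e = Y e" "u \<in> V" "v \<in> V"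
  shows "adj X u v = adj Y u v"
  using assms(1)[of "{u, v}"] assms(2,3) by (auto simp: adj_def pair_in_all_pairs_iff)

text \<open>Allows conditioning on the matrix after the deletion of a vertex while all pairs through
  that vertex stay random.\<close>

lemma typical_depends: "depends_on (typical V) (all_pairs V)"
proof (rule depends_onI)
  fix X Y :: "nat set \<Rightarrow> bool" assume eq: "\<And>e. e \<in> all_pairs V \<Longrightarrow> X e = Y e"
  note a = adj_cong_on[of V X Y, OF eq]
  have app: "mat_app V X w v = mat_app V Y w v" if "v \<in> V" for w v
    unfolding mat_app_def using a that by (intro sum.cong) auto
  have iso: "isolated V X i = isolated V Y i" if "i \<in> V" for i
    unfolding isolated_def nbrs_def using eq that by (auto simp: pair_in_all_pairs_iff)
  have sharp: "sharp V X i = sharp V Y i" if "i \<in> V" for i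
    unfolding sharp_def iso[OF that] using app by (simp cong: ball_cong)
  hence s: "{i \<in> V. \<not> sharp V X i} = {i \<in> V. \<not> sharp V Y i}" by auto
  have "rigid V {} S X = rigid V {} S Y" if "S \<subseteq> V" for S
  proof -
    have "(\<Sum>j\<in>S. adj X v j * u j) = (\<Sum>j\<in>S. adj Y v j * u j)" if "v \<in> V - {}" for v u
      using a that \<open>S \<subseteq> V\<close> by (intro sum.cong) auto
    thus ?thesis unfolding rigid_def by (simp cong: ball_cong)
  qed
  hence "small_rigid V {} X = small_rigid V {} Y"
    unfolding small_rigid_def by (auto cong: conj_cong)
  thus "typical V X = typical V Y" unfolding typical_def s by simp
qed

lemma prob_not_typical_le:
  assumes fV: "finite V" "V \<noteq> {}" and adm: "admissible (card V) p"
  shows "measure_pmf.prob (coins V p) {X. \<not> typical V X} \<le>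
    rigid_bound (card V) p + 2 * sharp_bound (card V) p"
proof -
  have N: "card V > 0" using fV by (simp add: card_gt_0_iff)
  have "measure_pmf.prob (coins V p) {X. \<not> typical V X} \<le>
      measure_pmf.prob (coins V p) {X. small_rigid V {} X \<or>
        real (card {i \<in> V. \<not> sharp V X i}) \<ge> real (card V) / 2}"
    by (rule prob_mono) (auto simp: typical_def)
  also have "\<dots> \<le> measure_pmf.prob (coins V p) {X. small_rigid V {} X} +
      measure_pmf.prob (coins V p) {X. real (card {i \<in> V. \<not> sharp V X i}) \<ge> real (card V) / 2}"
    by (rule prob_disj_le)
  also have "\<dots> \<le> rigid_bound (card V) p +
      (\<Sum>i\<in>V. measure_pmf.prob (coins V p) {X. \<not> sharp V X i}) / (real (card V) / 2)"
    by (intro add_mono prob_small_rigid_le markov_card) (use fV adm N in auto)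
  also have "\<dots> \<le> rigid_bound (card V) p + (\<Sum>i\<in>V. sharp_bound (card V) p) / (real (card V) / 2)"
    by (intro add_left_mono divide_right_mono sum_mono prob_not_sharp_le) (use fV adm in auto)
  also have "(\<Sum>i\<in>V. sharp_bound (card V) p) / (real (card V) / 2) = 2 * sharp_bound (card V) p"
    using N by simp
  finally show ?thesis .
qed

section \<open>Bordering a typical matrix by a random row\<close>

text \<open>The two terms belong to the linear and the quadratic case. A good row of the inverse has
  more than N / 200 nonzero entries; the set \<open>J\<close> of \<open>N div 400\<close> good rows
  removes at most N / 400 of them, so as many remain outside \<open>J\<close>.\<close>

definition row_bound :: "nat \<Rightarrow> real \<Rightarrow> real" where
  "row_bound N p = (let t = sqrt (p * real (N div 400)) in 2 / t + sqrt (7 / t))"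

text \<open>Says that \<open>w\<close>, extended by the value 1 at a new vertex with row
  \<open>x\<close>, is in the kernel of the bordered matrix.\<close>

definition extends_kernel :: "nat set \<Rightarrow> (nat set \<Rightarrow> bool) \<Rightarrow> (nat \<Rightarrow> bool) \<Rightarrow> (nat \<Rightarrow> real) \<Rightarrow> bool" where
  "extends_kernel V X x w \<longleftrightarrow> (\<forall>v\<in>V. mat_app V X w v = - of_bool (x v)) \<and>
    (\<Sum>j\<in>V. of_bool (x j) * w j) = 0"

text \<open>If a kernel vector with large support exists, it is orthogonal to the new row \<open>x\<close>;
  otherwise the matrix is invertible on the vertices that are not isolated, and the quadratic form
  of the inverse vanishes at \<open>x\<close>.\<close>

lemma prob_extends_kernel_le:
  assumes fV: "finite V" and N: "card V \<ge> 400" and p: "0 < p" "p \<le> 1 / 2" and regular: "typical V X"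
  shows "measure_pmf.prob (coin_pmf V p) {x. \<exists>w. extends_kernel V X x w} \<le> row_bound (card V) p"
proof -
  define k where "k = card V div 400"
  have k: "k > 0" "real k \<le> real (card V) / 400" unfolding k_def using N by auto
  define t where "t = sqrt (p * real k)"
  have t: "t > 0" unfolding t_def using p k by simp
  show ?thesis
  proof (cases "\<exists>u. (\<forall>v\<in>V. mat_app V X u v = 0) \<and> real (card {j \<in> V. u j \<noteq> 0}) > real (card V) / 200")
    case True
    then obtain u where u: "\<forall>v\<in>V. mat_app V X u v = 0"
        "real (card {j \<in> V. u j \<noteq> 0}) > real (card V) / 200"
      by (elim exE conjE)
    have "measure_pmf.prob (coin_pmf V p) {x. \<exists>w. extends_kernel V X x w} \<le>
        measure_pmf.prob (coin_pmf V p) {x. (\<Sum>j\<in>V. u j * of_bool (x j)) = 0}"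
    proof (rule prob_mono, elim exE)
      fix x w assume "extends_kernel V X x w"
      hence w: "\<forall>v\<in>V. mat_app V X w v = - of_bool (x v)" unfolding extends_kernel_def by (elim conjE)
      have "(\<Sum>v\<in>V. u v * mat_app V X w v) = 0"
        by (subst mat_app_symmetric) (use u(1) in simp)
      thus "(\<Sum>j\<in>V. u j * of_bool (x j)) = 0" using w by (simp add: sum_negf)
    qed
    also have "\<dots> \<le> 2 / t"
      unfolding t_def by (rule prob_linear_form_eq_le) (use fV p k u(2) in linarith)+
    also have "\<dots> \<le> row_bound (card V) p"
      using t unfolding row_bound_def Let_def k_def[symmetric] t_def[symmetric] by simp
    finally show ?thesis .
  next
    case False
    have ker: "u i = 0" if u: "\<And>v. v \<in> V \<Longrightarrow> mat_app V X u v = 0" and i: "i \<in> V" "\<not> isolated V X i" for u i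
    proof (rule ccontr)
      assume ui: "u i \<noteq> 0"
      have "\<not> real (card {j \<in> V. u j \<noteq> 0}) > real (card V) / 200"
        using False u by (auto simp only:)
      hence "small_rigid V {} X \<or> (\<exists>j\<in>V. nbrs X V j \<noteq> {} \<and> nbrs X V j \<subseteq> {})"
        by (intro small_support_imp_small_rigid[where w = u, OF fV i ui]) (use u in auto)
      thus False using regular unfolding typical_def by blast
    qed
    \<comment> \<open>Every kernel vector vanishes at \<open>i\<close>, so the unit vector at
      \<open>i\<close> lies in the row space; by symmetry its coefficients solve the system for the
      columns.\<close>
    have ex: "\<exists>m. \<forall>v\<in>V. mat_app V X m v = of_bool (v = i)" if i: "i \<in> V" "\<not> isolated V X i" for i
    proof -
      have "\<exists>c. \<forall>j\<in>V. (\<Sum>v\<in>V. c v * adj X v j) = of_bool (j = i)"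
      proof (rule annihilator_in_row_space[OF fV fV, of "adj X" "\<lambda>j. of_bool (j = i)"])
        fix u assume u: "\<And>v. v \<in> V \<Longrightarrow> (\<Sum>j\<in>V. adj X v j * u j) = 0"
        have "u i = 0" by (rule ker[OF _ i]) (simp add: mat_app_def u)
        thus "(\<Sum>j\<in>V. of_bool (j = i) * u j) = 0" using fV i by simp
      qed
      then obtain c where "\<forall>j\<in>V. (\<Sum>v\<in>V. c v * adj X v j) = of_bool (j = i)" by (elim exE)
      thus ?thesis
        by (intro exI[of _ c]) (simp add: mat_app_def mult.commute[of "adj X _ _"] adj_sym[of X _ "_"])
    qed
    define m where "m = (\<lambda>i. SOME m. \<forall>v\<in>V. mat_app V X m v = of_bool (v = i))"
    have m: "\<forall>v\<in>V. mat_app V X (m i) v = of_bool (v = i)" if "i \<in> V" "\<not> isolated V X i" for i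
      unfolding m_def by (rule someI_ex[OF ex[OF that]])
    \<comment> \<open>The chosen solutions \<open>m i\<close> are unique only up to their entries at
      isolated vertices. Setting these to 0 makes the inverse symmetric, as the quadratic inequality
      demands.\<close>
    define M where "M = (\<lambda>i j. if isolated V X i \<or> isolated V X j then 0 else m i j)"
    have appM: "\<forall>v\<in>V. mat_app V X (M i) v = of_bool (v = i)" if "i \<in> V" "\<not> isolated V X i" for i
    proof
      fix v assume v: "v \<in> V"
      have "mat_app V X (M i) v = mat_app V X (m i) v"
        by (rule mat_app_cong_nonisolated[OF v]) (use that in \<open>simp add: M_def\<close>)
      thus "mat_app V X (M i) v = of_bool (v = i)" using m[OF that] v by simp
    qed
    have symM: "M i j = M j i" if ij: "i \<in> V" "j \<in> V" for i j
    proof (cases "isolated V X i \<or> isolated V X j")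
      case False
      have "(\<Sum>v\<in>V. M i v * mat_app V X (M j) v) = (\<Sum>v\<in>V. M j v * mat_app V X (M i) v)"
        by (rule mat_app_symmetric)
      thus ?thesis using appM[of i] appM[of j] ij False fV by simp
    qed (auto simp: M_def)
    define G where "G = {i \<in> V. sharp V X i}"
    have "card V = card G + card {i \<in> V. \<not> sharp V X i}"
      unfolding G_def using fV by (subst card_Un_disjoint[symmetric]) (auto intro!: arg_cong[where f = card])
    hence "real (card G) > real (card V) / 2" using regular unfolding typical_def by linarith
    hence "k \<le> card G" using k by linarith
    then obtain J where J: "J \<subseteq> G" "card J = k" "finite J" by (metis obtain_subset_with_card_n)
    have "measure_pmf.prob (coin_pmf V p) {x. \<exists>w. extends_kernel V X x w} \<le>
        measure_pmf.prob (coin_pmf V p)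
          {x. (\<Sum>i\<in>V. \<Sum>j\<in>V. M i j * of_bool (x i) * of_bool (x j)) = 0}"
    proof (rule prob_mono, elim exE)
      fix x w assume "extends_kernel V X x w"
      hence w: "\<forall>v\<in>V. mat_app V X w v = - of_bool (x v)" and xw: "(\<Sum>j\<in>V. of_bool (x j) * w j) = 0"
        unfolding extends_kernel_def by (rule conjunct1, rule conjunct2)
      have x0: "\<not> x v" if "v \<in> V" "isolated V X v" for v
        using w that mat_app_isolated[OF that(2), of w] by auto
      \<comment> \<open>Pairing with row \<open>i\<close> of \<open>M\<close> recovers
        \<open>w i\<close> from \<open>- x\<close>. At an isolated \<open>i\<close> this fails, but
        there \<open>x i\<close> is false because the equation in that row reads 0 = - x i.\<close>
      have wi: "of_bool (x i) * w i = - (\<Sum>j\<in>V. M i j * of_bool (x i) * of_bool (x j))" if i: "i \<in> V" for i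
      proof (cases "isolated V X i")
        case True
        thus ?thesis using x0[OF i] by simp
      next
        case False
        have "w i = (\<Sum>v\<in>V. w v * mat_app V X (M i) v)" using appM[OF i False] fV i by simp
        also have "\<dots> = (\<Sum>v\<in>V. M i v * mat_app V X w v)" by (rule mat_app_symmetric)
        also have "\<dots> = - (\<Sum>j\<in>V. M i j * of_bool (x j))" using w by (simp add: sum_negf)
        finally show ?thesis by (simp add: sum_distrib_left mult_ac)
      qed
      have "(\<Sum>i\<in>V. \<Sum>j\<in>V. M i j * of_bool (x i) * of_bool (x j)) = - (\<Sum>j\<in>V. of_bool (x j) * w j)"
        by (simp add: wi sum_negf)
      thus "(\<Sum>i\<in>V. \<Sum>j\<in>V. M i j * of_bool (x i) * of_bool (x j)) = 0" using xw by simp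
    qed
    also have "\<dots> \<le> sqrt (7 / t)"
      unfolding t_def
    proof (rule prob_quadratic_form_eq_0_le[OF fV p symM])
      show "J \<subseteq> V" using J unfolding G_def by auto
      show "k \<le> card J" "k > 0" using J k by auto
      fix i assume i: "i \<in> J"
      have "sharp V X i" "i \<in> V" using i J unfolding G_def by auto
      hence "real (card {j \<in> V. M i j \<noteq> 0}) > real (card V) / 200"
        using appM[of i] unfolding sharp_def by simp
      moreover have "card {j \<in> V. M i j \<noteq> 0} \<le> card ({j \<in> V - J. M i j \<noteq> 0} \<union> J)"
        by (rule card_mono) (use fV J in auto)
      moreover have "card ({j \<in> V - J. M i j \<noteq> 0} \<union> J) \<le> card {j \<in> V - J. M i j \<noteq> 0} + card J"
        by (rule card_Un_le)
      ultimately show "k \<le> card {j \<in> V - J. M i j \<noteq> 0}" using k J(2) by linarith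
    qed
    also have "\<dots> \<le> row_bound (card V) p"
      using t unfolding row_bound_def Let_def k_def[symmetric] t_def[symmetric] by simp
    finally show ?thesis .
  qed
qed

section \<open>From one vertex of the support to the whole kernel\<close>

definition in_kernel :: "nat set \<Rightarrow> (nat set \<Rightarrow> bool) \<Rightarrow> (nat \<Rightarrow> real) \<Rightarrow> bool" where
  "in_kernel V X w \<longleftrightarrow> (\<forall>v\<in>V. mat_app V X w v = 0)"

lemma in_kernel_imp_extends_kernel:
  assumes fV: "finite V" and i: "i \<in> V" and w: "in_kernel V X w" "w i \<noteq> 0"
  shows "extends_kernel (V - {i}) X (\<lambda>j. j \<in> V - {i} \<and> X {i, j}) (\<lambda>j. w j / w i)"
proof -
  have split: "mat_app V X w v = adj X v i * w i + mat_app (V - {i}) X w v" for v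
    unfolding mat_app_def by (rule sum.remove[OF fV i])
  have scale: "mat_app (V - {i}) X (\<lambda>j. w j / w i) v = mat_app (V - {i}) X w v / w i" for v
    by (simp add: mat_app_def sum_divide_distrib)
  have 1: "mat_app (V - {i}) X (\<lambda>j. w j / w i) v = - of_bool (v \<in> V - {i} \<and> X {i, v})" if v: "v \<in> V - {i}" for v
  proof -
    have "adj X v i * w i + mat_app (V - {i}) X w v = 0"
      using w(1) v unfolding in_kernel_def split[symmetric] by blast
    hence "mat_app (V - {i}) X w v / w i = - adj X v i" using w(2) by (simp add: field_simps)
    thus ?thesis unfolding scale using v by (auto simp: adj_def insert_commute)
  qed
  have "(\<Sum>j\<in>V - {i}. of_bool (j \<in> V - {i} \<and> X {i, j}) * (w j / w i)) =
      mat_app (V - {i}) X (\<lambda>j. w j / w i) i"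
    unfolding mat_app_def by (intro sum.cong) (auto simp: adj_def)
  also have "\<dots> = 0"
  proof -
    have "mat_app V X w i = 0" using w(1) i unfolding in_kernel_def by blast
    thus ?thesis unfolding scale using split[of i] by (simp add: adj_def)
  qed
  finally show ?thesis unfolding extends_kernel_def using 1 by blast
qed

lemma prob_coins_restrict:
  assumes "finite V" "U \<subseteq> V" "depends_on P (all_pairs U)"
  shows "measure_pmf.prob (coins V p) {X. P X} = measure_pmf.prob (coins U p) {X. P X}"
proof -
  have "all_pairs U \<subseteq> all_pairs V" using assms(2) unfolding all_pairs_def by auto
  hence "coins U p = map_pmf (\<lambda>X e. e \<in> all_pairs U \<and> X e) (coins V p)"
    using coin_pmf_map_inj[of "all_pairs V" "\<lambda>e. e" "all_pairs U" p] assms(1) by simp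
  moreover have "P (\<lambda>e. e \<in> all_pairs U \<and> X e) = P X" for X
    by (rule depends_onD[OF assms(3)]) simp
  ultimately show ?thesis by simp
qed

definition vertex_bound :: "nat \<Rightarrow> real \<Rightarrow> real" where
  "vertex_bound N p = rigid_bound N p + 2 * sharp_bound N p + row_bound N p"

lemma prob_vertex_in_kernel_le:
  assumes fV: "finite V" and i: "i \<in> V" and N: "card V > 400"
    and adm: "admissible (card V - 1) p"
  shows "measure_pmf.prob (coins V p) {X. \<exists>w. in_kernel V X w \<and> w i \<noteq> 0} \<le> vertex_bound (card V - 1) p"
proof -
  define U where "U = V - {i}"
  have U: "finite U" "U \<subseteq> V" "card U = card V - 1" "i \<notin> U"
    unfolding U_def using fV i by (auto simp: card_Diff_singleton)
  have U_ne: "U \<noteq> {}" using U(3) N by auto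
  have p: "0 < p" "p \<le> 1 / 2" using adm unfolding admissible_def by auto
  define ev where "ev = (\<lambda>X. typical U X \<and> (\<exists>w. extends_kernel U X (\<lambda>j. j \<in> U \<and> X {i, j}) w))"
  have "measure_pmf.prob (coins V p) {X. \<exists>w. in_kernel V X w \<and> w i \<noteq> 0} \<le>
      measure_pmf.prob (coins V p) {X. \<not> typical U X \<or> ev X}"
    by (rule prob_mono) (use in_kernel_imp_extends_kernel[OF fV i] in \<open>unfold U_def ev_def, blast\<close>)
  also have "\<dots> \<le> measure_pmf.prob (coins V p) {X. \<not> typical U X} + measure_pmf.prob (coins V p) {X. ev X}"
    by (rule prob_disj_le)
  also have "measure_pmf.prob (coins V p) {X. \<not> typical U X} = measure_pmf.prob (coins U p) {X. \<not> typical U X}"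
    by (rule prob_coins_restrict[OF fV U(2)])
       (use typical_depends[of U] in \<open>auto simp: depends_on_def\<close>)
  also have "\<dots> \<le> rigid_bound (card U) p + 2 * sharp_bound (card U) p"
    by (rule prob_not_typical_le) (use U U_ne adm in auto)
  also have "measure_pmf.prob (coins V p) {X. ev X} \<le> row_bound (card U) p"
  proof (rule prob_coin_condition_le[where P = ev and J = "all_pairs U"])
    fix f
    define mg where "mg = (\<lambda>g e. if e \<in> all_pairs U then f e else g e :: bool)"
    \<comment> \<open>Pairs through \<open>i\<close> are not among the fixed coins, so the row of
      \<open>i\<close> keeps its distribution.\<close>
    have row: "mg g {i, j} = g {i, j}" for g j
      using U(4) by (simp add: mg_def pair_in_all_pairs_iff)
    have regular: "typical U (mg g) = typical U f" for g
      by (rule depends_onD[OF typical_depends]) (simp add: mg_def)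
    have "adj (mg g) u v = adj f u v" if "u \<in> U" "v \<in> U" for g u v
      by (rule adj_cong_on[of U]) (use that in \<open>auto simp: mg_def\<close>)
    hence app: "mat_app U (mg g) w v = mat_app U f w v" if "v \<in> U" for g w v
      unfolding mat_app_def using that by (intro sum.cong) auto
    have ext: "extends_kernel U (mg g) x w = extends_kernel U f x w" for g x w
      unfolding extends_kernel_def using app by simp
    show "measure_pmf.prob (coins V p) {g. ev (\<lambda>e. if e \<in> all_pairs U then f e else g e)} \<le>
        row_bound (card U) p"
    proof (cases "typical U f")
      case True
      have "measure_pmf.prob (coins V p) {g. ev (mg g)} =
          measure_pmf.prob (coins V p) {g. \<exists>w. extends_kernel U f (\<lambda>j. j \<in> U \<and> g {i, j}) w}"
        unfolding ev_def regular ext row using True by simp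
      also have "\<dots> = measure_pmf.prob (coin_pmf U p) {x. \<exists>w. extends_kernel U f x w}"
        by (rule prob_coins_row[OF fV U(2) i U(4)])
      also have "\<dots> \<le> row_bound (card U) p"
        by (rule prob_extends_kernel_le[OF U(1) _ p True]) (use U(3) N in simp)
      finally show ?thesis unfolding mg_def .
    next
      case False
      have "{g. ev (mg g)} = {}" unfolding ev_def regular using False by simp
      hence "measure_pmf.prob (coins V p) {g. ev (mg g)} = 0" by (simp only: measure_empty)
      also have "0 \<le> row_bound (card U) p" using p by (simp add: row_bound_def Let_def)
      finally show ?thesis unfolding mg_def .
    qed
  qed (use fV in simp)
  finally show ?thesis unfolding U(3) vertex_bound_def by simp
qed

text \<open>200 is the reciprocal of the density of vertices in a support that is not small, as it
  enters Markov's inequality.\<close>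

definition kernel_bound :: "nat \<Rightarrow> real \<Rightarrow> real" where
  "kernel_bound N p = rigid_bound N p + 200 * vertex_bound (N - 1) p"

lemma prob_kernel_nonisolated_le:
  assumes fV: "finite V" and N: "card V > 400"
    and adm: "admissible (card V) p" "admissible (card V - 1) p"
  shows "measure_pmf.prob (coins V p)
      {X. \<exists>w. in_kernel V X w \<and> (\<exists>i\<in>V. \<not> isolated V X i \<and> w i \<noteq> 0)} \<le> kernel_bound (card V) p"
proof -
  define K where "K = (\<lambda>i X. \<exists>w. in_kernel V X w \<and> w i \<noteq> 0)"
  have "measure_pmf.prob (coins V p)
      {X. \<exists>w. in_kernel V X w \<and> (\<exists>i\<in>V. \<not> isolated V X i \<and> w i \<noteq> 0)} \<le>
     measure_pmf.prob (coins V p) {X. small_rigid V {} X \<or>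
       real (card {i \<in> V. K i X}) \<ge> real (card V) / 200}"
  proof (rule prob_mono, elim exE conjE bexE)
    fix X w i assume w: "in_kernel V X w" and i: "i \<in> V" "\<not> isolated V X i" "w i \<noteq> 0"
    show "small_rigid V {} X \<or> real (card {i \<in> V. K i X}) \<ge> real (card V) / 200"
    proof (cases "real (card {j \<in> V. w j \<noteq> 0}) \<le> real (card V) / 200")
      case True
      have "small_rigid V {} X \<or> (\<exists>j\<in>V. nbrs X V j \<noteq> {} \<and> nbrs X V j \<subseteq> {})"
        by (rule small_support_imp_small_rigid[where w = w, OF fV i True]) (use w in \<open>simp add: in_kernel_def\<close>)
      thus ?thesis by blast
    next
      case False
      have "card {j \<in> V. w j \<noteq> 0} \<le> card {i \<in> V. K i X}"
        by (rule card_mono) (use fV w in \<open>auto simp: K_def\<close>)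
      thus ?thesis using False by linarith
    qed
  qed
  also have "\<dots> \<le> measure_pmf.prob (coins V p) {X. small_rigid V {} X} +
      measure_pmf.prob (coins V p) {X. real (card {i \<in> V. K i X}) \<ge> real (card V) / 200}"
    by (rule prob_disj_le)
  also have "\<dots> \<le> rigid_bound (card V) p +
      (\<Sum>i\<in>V. measure_pmf.prob (coins V p) {X. K i X}) / (real (card V) / 200)"
    by (intro add_mono prob_small_rigid_le markov_card) (use fV adm N in auto)
  also have "\<dots> \<le> rigid_bound (card V) p + (\<Sum>i\<in>V. vertex_bound (card V - 1) p) / (real (card V) / 200)"
    unfolding K_def
    by (intro add_left_mono divide_right_mono sum_mono prob_vertex_in_kernel_le) (use fV N adm in auto)
  also have "(\<Sum>i\<in>V. vertex_bound (card V - 1) p) / (real (card V) / 200) = 200 * vertex_bound (card V - 1) p"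
    using N by simp
  finally show ?thesis unfolding kernel_bound_def .
qed

subsection \<open>The giant component\<close>

lemma invertible_mat_if_det_nonzero:
  fixes A :: "'a :: field mat"
  assumes A: "A \<in> carrier_mat n n" and "Determinant.det A \<noteq> 0"
  shows "invertible_mat A"
proof -
  have "A \<in> Units (ring_mat TYPE('a) n ())" by (rule det_non_zero_imp_unit[OF assms])
  then obtain B where "B \<in> carrier_mat n n" "B * A = 1\<^sub>m n" "A * B = 1\<^sub>m n"
    unfolding Units_def ring_mat_def by auto
  thus ?thesis using A unfolding invertible_mat_def inverts_mat_def by auto
qed

definition coin_graph :: "nat set \<Rightarrow> (nat set \<Rightarrow> bool) \<Rightarrow> ugraph" where
  "coin_graph V X = (V, {e \<in> all_pairs V. X e})"

lemma adjacent_coin_graph: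
  "adjacent (coin_graph V X) u v \<longleftrightarrow> u \<in> V \<and> v \<in> nbrs X V u"
  unfolding adjacent_def coin_graph_def nbrs_def by (auto simp: pair_in_all_pairs_iff)

lemma adjacent_rtranclp_in_verts:
  "(adjacent (coin_graph V X))\<^sup>*\<^sup>* u v \<Longrightarrow> u \<in> V \<Longrightarrow> v \<in> V"
  by (induction rule: rtranclp_induct) (auto simp: adjacent_coin_graph nbrs_def)

definition component_of :: "nat set \<Rightarrow> (nat set \<Rightarrow> bool) \<Rightarrow> nat \<Rightarrow> nat set" where
  "component_of V X x = {v. (adjacent (coin_graph V X))\<^sup>*\<^sup>* x v}"

lemma connected_components_coin_graph:
  "connected_components (coin_graph V X) =
    (\<lambda>x. induced_subgraph (coin_graph V X) (component_of V X x)) ` V"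
proof -
  have "connectivity (coin_graph V X) `` {x} = component_of V X x" if "x \<in> V" for x
    using that adjacent_rtranclp_in_verts[of V X x]
    by (auto simp: connectivity_def component_of_def coin_graph_def)
  hence "V // connectivity (coin_graph V X) = component_of V X ` V"
    unfolding quotient_def by auto
  thus ?thesis unfolding connected_components_def by (auto simp: coin_graph_def image_image)
qed

text \<open>The choice made by \<open>ARG_MAX\<close> is a true maximiser because component sizes
  are bounded by \<open>card V\<close> and a component exists.\<close>

lemma giant_component_coin_graph:
  assumes fV: "finite V" "V \<noteq> {}"
  obtains x where "x \<in> V"
    "giant_component (coin_graph V X) = induced_subgraph (coin_graph V X) (component_of V X x)"
    "\<And>y. y \<in> V \<Longrightarrow> card (component_of V X y) \<le> card (component_of V X x)"
proof -
  define P where "P = (\<lambda>H. H \<in> connected_components (coin_graph V X))"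
  define f where "f = (\<lambda>H :: ugraph. card (verts H))"
  have verts: "verts (induced_subgraph (coin_graph V X) C) = C" for C
    unfolding induced_subgraph_def by simp
  obtain z where z: "z \<in> V" using fV by auto
  have "f H < card V + 1" if PH: "P H" for H
  proof -
    obtain x where x: "x \<in> V" "H = induced_subgraph (coin_graph V X) (component_of V X x)"
      using PH unfolding P_def connected_components_coin_graph by blast
    hence "verts H \<subseteq> V"
      using adjacent_rtranclp_in_verts[of V X x] by (auto simp: component_of_def induced_subgraph_def)
    thus ?thesis unfolding f_def using card_mono[OF fV(1)] by (simp add: le_imp_less_Suc)
  qed
  moreover have "P (induced_subgraph (coin_graph V X) (component_of V X z))"
    unfolding P_def connected_components_coin_graph using z by blast
  ultimately have max: "P (arg_max f P)" "\<And>H. P H \<Longrightarrow> f H \<le> f (arg_max f P)"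
    using arg_max_nat_lemma[of P _ f "card V + 1"] by blast+
  have giant: "giant_component (coin_graph V X) = arg_max f P"
    unfolding giant_component_def f_def P_def ..
  obtain x where x: "x \<in> V" "arg_max f P = induced_subgraph (coin_graph V X) (component_of V X x)"
    using max(1) unfolding P_def connected_components_coin_graph by blast
  show ?thesis
  proof (rule that[OF x(1)])
    show "giant_component (coin_graph V X) = induced_subgraph (coin_graph V X) (component_of V X x)"
      unfolding giant x(2) ..
    show "card (component_of V X y) \<le> card (component_of V X x)" if "y \<in> V" for y
      using max(2)[of "induced_subgraph (coin_graph V X) (component_of V X y)"] that
      unfolding x(2) unfolding P_def connected_components_coin_graph f_def by (auto simp: verts)
  qed
qed

text \<open>Translates a kernel vector with numbered entries into a function on vertices, set to 0
  outside \<open>C\<close> so that it can be tested against the full matrix.\<close>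

lemma adjacency_matrix_vec:
  assumes "finite C" "v \<in> carrier_vec (card C)"
    "adjacency_matrix (induced_subgraph (coin_graph V X) C) *\<^sub>v v = 0\<^sub>v (card C)" "v \<noteq> 0\<^sub>v (card C)"
    and CV: "C \<subseteq> V"
  shows "\<exists>w. (\<forall>u\<in>C. (\<Sum>j\<in>C. adj X u j * w j) = 0) \<and> (\<exists>u\<in>C. w u \<noteq> 0) \<and> (\<forall>u. u \<notin> C \<longrightarrow> w u = 0)"
proof -
  define vs where "vs = sorted_list_of_set C"
  define m where "m = card C"
  have vs: "set vs = C" "length vs = m" "distinct vs"
    unfolding vs_def m_def using assms(1) by auto
  define A where "A = adjacency_matrix (induced_subgraph (coin_graph V X) C)"
  have A: "A = Matrix.mat m m (\<lambda>(i, j). adj X (vs ! i) (vs ! j))"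
  proof -
    have "(if adjacent (induced_subgraph (coin_graph V X) C) a b then 1 else 0) = adj X a b"
      if "a \<in> C" "b \<in> C" for a b
      using that CV by (auto simp: adjacent_def induced_subgraph_def coin_graph_def adj_def
          pair_in_all_pairs_iff)
    moreover have "verts (induced_subgraph (coin_graph V X) C) = C"
      by (simp add: induced_subgraph_def)
    ultimately show ?thesis
      unfolding A_def adjacency_matrix_def Let_def vs_def[symmetric]
      using vs nth_mem[of _ vs] by (auto intro!: eq_matI simp flip: vs_def)
  qed
  have bij: "bij_betw (\<lambda>i. vs ! i) {..<m} C"
    using bij_betw_nth[OF vs(3)] vs by auto
  define ix where "ix = the_inv_into {..<m} (\<lambda>i. vs ! i)"
  have ix: "ix (vs ! i) = i" if "i < m" for i
    unfolding ix_def using bij that by (intro the_inv_into_f_f) (auto simp: bij_betw_def)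
  define w where "w = (\<lambda>u. if u \<in> C then v $ ix u else 0)"
  have memC: "vs ! i \<in> C" if "i < m" for i using that vs nth_mem by blast
  have wv: "w (vs ! i) = v $ i" if "i < m" for i
    using that memC ix by (simp add: w_def)
  have dim: "dim_vec v = m" using assms(2) by (simp add: m_def)
  have "(\<Sum>j\<in>C. adj X u j * w j) = 0" if "u \<in> C" for u
  proof -
    have "u \<in> (\<lambda>i. vs ! i) ` {..<m}" using that bij by (simp add: bij_betw_def)
    then obtain i where i: "i < m" "u = vs ! i" by auto
    have "(\<Sum>j\<in>C. adj X u j * w j) = (\<Sum>j<m. adj X u (vs ! j) * w (vs ! j))"
      by (rule sum.reindex_bij_betw[OF bij, symmetric])
    also have "\<dots> = (\<Sum>j<m. adj X (vs ! i) (vs ! j) * v $ j)"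
      using wv i by (intro sum.cong) auto
    also have "\<dots> = (A *\<^sub>v v) $ i"
      using i dim by (simp add: A scalar_prod_def atLeast0LessThan)
    also have "\<dots> = 0" using assms(3) i by (simp add: A_def m_def)
    finally show ?thesis .
  qed
  moreover have "\<exists>u\<in>C. w u \<noteq> 0"
  proof (rule ccontr)
    assume "\<not> ?thesis"
    hence "v $ i = 0" if "i < m" for i using memC[OF that] wv[OF that] by simp
    hence "v = 0\<^sub>v m" using dim by (intro eq_vecI) auto
    thus False using assms(4) by (simp add: m_def)
  qed
  moreover have "\<forall>u. u \<notin> C \<longrightarrow> w u = 0" by (simp add: w_def)
  ultimately show ?thesis by (intro exI[of _ w]) simp
qed

text \<open>A vertex outside a component has no neighbour inside it, so a kernel vector of the
  component extended by 0 is one of the whole graph. The vertex \<open>a\<close> ensures a component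
  with two vertices: without any edge the giant component is one vertex, with the singular matrix 0.
  In a connected set of two or more vertices none is isolated, which contradicts
  \<open>ker\<close>.\<close>

lemma nonsingular_giant_component:
  assumes fV: "finite V" and a: "a \<in> V" "\<not> isolated V X a"
    and ker: "\<not> (\<exists>w. in_kernel V X w \<and> (\<exists>i\<in>V. \<not> isolated V X i \<and> w i \<noteq> 0))"
  shows "nonsingular (giant_component (coin_graph V X))"
proof -
  have "V \<noteq> {}" using a by auto
  from giant_component_coin_graph[OF fV this] obtain x where x: "x \<in> V"
    "giant_component (coin_graph V X) = induced_subgraph (coin_graph V X) (component_of V X x)"
    and max: "\<And>y. y \<in> V \<Longrightarrow> card (component_of V X y) \<le> card (component_of V X x)"
    by blast
  define C where "C = component_of V X x"
  have CV: "C \<subseteq> V" unfolding C_def component_of_def using adjacent_rtranclp_in_verts x(1) by blast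
  have fC: "finite C" using CV fV finite_subset by blast
  obtain b where b: "b \<in> nbrs X V a" using a unfolding isolated_def by blast
  have "{a, b} \<subseteq> component_of V X a"
    using a b by (auto simp: component_of_def adjacent_coin_graph)
  moreover have "finite (component_of V X a)"
    using adjacent_rtranclp_in_verts[of V X a] a fV by (auto simp: component_of_def intro: finite_subset)
  moreover have "a \<noteq> b" using b by (auto simp: nbrs_def)
  ultimately have "2 \<le> card (component_of V X a)"
    using card_mono[of "component_of V X a" "{a, b}"] by simp
  hence C2: "2 \<le> card C" using max[OF a(1)] unfolding C_def by simp
  have closed: "j \<in> C" if "u \<in> C" "u \<in> V" "j \<in> nbrs X V u" for u j
    using that unfolding C_def component_of_def
    by (auto simp: adjacent_coin_graph intro: rtranclp.rtrancl_into_rtrancl)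
  have noniso: "\<not> isolated V X u" if u: "u \<in> C" for u
  proof (cases "u = x")
    case True
    have "\<not> C \<subseteq> {x}" using C2 card_mono[of "{x}" C] by auto
    then obtain y where "(adjacent (coin_graph V X))\<^sup>*\<^sup>* x y" "y \<noteq> x"
      unfolding C_def component_of_def by blast
    hence "\<exists>z. adjacent (coin_graph V X) x z" by (metis converse_rtranclpE)
    thus ?thesis unfolding True isolated_def by (auto simp: adjacent_coin_graph)
  next
    case False
    have "(adjacent (coin_graph V X))\<^sup>*\<^sup>* x u" using u unfolding C_def component_of_def by simp
    then obtain z where "adjacent (coin_graph V X) z u" using False by (metis rtranclp.cases)
    hence "z \<in> V" "u \<in> nbrs X V z" by (auto simp: adjacent_coin_graph)
    hence "z \<in> nbrs X V u" by (auto simp: nbrs_def insert_commute)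
    thus ?thesis unfolding isolated_def by blast
  qed
  define A where "A = adjacency_matrix (induced_subgraph (coin_graph V X) C)"
  have A: "A \<in> carrier_mat (card C) (card C)"
    unfolding A_def adjacency_matrix_def Let_def induced_subgraph_def using fC by simp
  have "Determinant.det A \<noteq> 0"
  proof
    assume "Determinant.det A = 0"
    then obtain v where v: "v \<in> carrier_vec (card C)" "v \<noteq> 0\<^sub>v (card C)" "A *\<^sub>v v = 0\<^sub>v (card C)"
      using det_0_iff_vec_prod_zero[OF A] by blast
    from adjacency_matrix_vec[OF fC v(1) v(3)[unfolded A_def] v(2) CV]
    obtain w u where w: "\<forall>u\<in>C. (\<Sum>j\<in>C. adj X u j * w j) = 0" "\<forall>u. u \<notin> C \<longrightarrow> w u = 0"
      and u: "u \<in> C" "w u \<noteq> 0"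
      by (elim exE conjE bexE) (rule that)
    have "mat_app V X w y = 0" if y: "y \<in> V" for y
    proof -
      have eq: "mat_app V X w y = (\<Sum>j\<in>C. adj X y j * w j)"
        unfolding mat_app_def by (rule sum.mono_neutral_right) (use fV CV w(2) in auto)
      show ?thesis
      proof (cases "y \<in> C")
        case True
        thus ?thesis using w(1) eq by simp
      next
        case False
        have "adj X y j = 0" if "j \<in> C" for j
        proof (rule ccontr)
          assume "adj X y j \<noteq> 0"
          hence "y \<in> nbrs X V j" using y by (auto simp: adj_def nbrs_def insert_commute)
          thus False using closed[OF that] that CV False by blast
        qed
        thus ?thesis unfolding eq by simp
      qed
    qed
    hence "in_kernel V X w" unfolding in_kernel_def by blast
    thus False using ker u noniso[OF u(1)] CV by blast
  qed
  thus ?thesis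
    unfolding nonsingular_def x(2) C_def[symmetric] A_def[symmetric]
    by (rule invertible_mat_if_det_nonzero[OF A])
qed

lemma prob_nonsingular_giant_component_ge:
  assumes n: "n > 400" and adm: "admissible n p" "admissible (n - 1) p"
  shows "measure_pmf.prob (random_graph n p) {G. nonsingular (giant_component G)} \<ge>
    1 - (kernel_bound n p + exp 1 * exp (- (real n * p)))"
proof -
  define V where "V = {1..n}"
  have V: "finite V" "card V = n" "n \<in> V" unfolding V_def using n by auto
  have p: "0 < p" "p \<le> 1 / 2" using adm(1) unfolding admissible_def by auto
  define Q where "Q = (\<lambda>X. nonsingular (giant_component (coin_graph V X)))"
  have eq: "measure_pmf.prob (random_graph n p) {G. nonsingular (giant_component G)} =
      measure_pmf.prob (coins V p) {X. Q X}"
    unfolding random_graph_def coin_pmf_def Q_def coin_graph_def V_def by simp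
  have compl: "measure_pmf.prob (coins V p) {X. Q X} = 1 - measure_pmf.prob (coins V p) {X. \<not> Q X}"
    using measure_pmf.prob_compl[of "{X. Q X}" "coins V p"]
    by (simp add: Compl_eq_Diff_UNIV[symmetric] Collect_neg_eq)
  \<comment> \<open>That the graph has an edge at all is obtained cheaply by asking one fixed
    vertex, \<open>n\<close>, not to be isolated.\<close>
  have "measure_pmf.prob (coins V p) {X. \<not> Q X} \<le>
      measure_pmf.prob (coins V p)
        {X. (\<exists>w. in_kernel V X w \<and> (\<exists>i\<in>V. \<not> isolated V X i \<and> w i \<noteq> 0)) \<or> isolated V X n}"
  proof (rule prob_mono)
    fix X assume "\<not> Q X"
    thus "(\<exists>w. in_kernel V X w \<and> (\<exists>i\<in>V. \<not> isolated V X i \<and> w i \<noteq> 0)) \<or> isolated V X n"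
      using nonsingular_giant_component[OF V(1,3)] unfolding Q_def by blast
  qed
  also have "\<dots> \<le> measure_pmf.prob (coins V p)
        {X. \<exists>w. in_kernel V X w \<and> (\<exists>i\<in>V. \<not> isolated V X i \<and> w i \<noteq> 0)} +
      measure_pmf.prob (coins V p) {X. isolated V X n}"
    by (rule prob_disj_le)
  also have "\<dots> \<le> kernel_bound n p + exp 1 * exp (- (real n * p))"
    using prob_kernel_nonisolated_le[OF V(1)] prob_isolated_le[OF V(1,3) p] n adm
    unfolding V(2) by (intro add_mono) auto
  finally show ?thesis using eq compl by linarith
qed

section \<open>Limits of the error bounds\<close>

text \<open>The number of vertices is a sequence \<open>N\<close>, since the bounds are needed for
  the graph itself and for the graph with one vertex deleted, with the same
  \<open>p\<close>.\<close>

lemma bounds_tendsto_0: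
  fixes N :: "nat \<Rightarrow> nat" and p :: "nat \<Rightarrow> real" and c :: real
  assumes c: "c > 1 / 2" and N: "filterlim N at_top sequentially"
    and p: "eventually (\<lambda>n. c * ln (real (N n)) \<le> real (N n) * p n) sequentially"
    and p2: "eventually (\<lambda>n. p n \<le> 1 / 2) sequentially"
  shows "filterlim (\<lambda>n. real (N n) * p n) at_top sequentially"
    and "(\<lambda>n. rigid_bound (N n) (p n)) \<longlonglongrightarrow> 0"
    and "(\<lambda>n. vertex_bound (N n) (p n)) \<longlonglongrightarrow> 0"
    and "eventually (\<lambda>n. admissible (N n) (p n)) sequentially"
proof -
  define \<mu> where "\<mu> = (\<lambda>n. real (N n) * p n)"
  have RN: "filterlim (\<lambda>n. real (N n)) at_top sequentially"
    by (rule filterlim_compose[OF filterlim_real_sequentially N])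
  have c0: "c > 0" using c by simp
  have "filterlim (\<lambda>x. c * ln x) at_top at_top" using c0 by real_asymp
  from filterlim_compose[OF this RN]
  have mu: "filterlim \<mu> at_top sequentially"
    by (rule filterlim_at_top_mono) (use p in \<open>simp add: \<mu>_def\<close>)
  thus "filterlim (\<lambda>n. real (N n) * p n) at_top sequentially" unfolding \<mu>_def .
  have mu1: "eventually (\<lambda>n. \<mu> n \<ge> 1) sequentially"
    using mu unfolding filterlim_at_top by blast
  have N1: "eventually (\<lambda>n. N n \<ge> 400) sequentially"
    using N unfolding filterlim_at_top by blast
  have p_pos: "p n > 0" if "\<mu> n \<ge> 1" for n
  proof (rule ccontr)
    assume "\<not> p n > 0"
    hence "\<mu> n \<le> 0" unfolding \<mu>_def by (intro mult_nonneg_nonpos) auto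
    thus False using that by simp
  qed
  \<comment> \<open>The lower bound on \<open>p\<close> gives \<open>N <= exp (\<mu> / c)\<close>,
    so the critical term \<open>N * exp (- 2 * \<mu>)\<close> is at most
    \<open>exp (- d * \<mu>)\<close>. The exponent \<open>d\<close> is positive exactly because c
    exceeds 1 / 2.\<close>
  define d where "d = 2 - 1 / c"
  have d: "d > 0" unfolding d_def using c by (simp add: field_simps)
  have "((\<lambda>x::real. exp 6 * x\<^sup>2 * exp (- x / 2)) \<longlongrightarrow> 0) at_top" by real_asymp
  from filterlim_compose[OF this mu] have x: "(\<lambda>n. exp 6 * (\<mu> n)\<^sup>2 * exp (- \<mu> n / 2)) \<longlonglongrightarrow> 0" .
  have "((\<lambda>x::real. 2 * exp 12 * x ^ 4 * exp (- d * x)) \<longlongrightarrow> 0) at_top" using d by real_asymp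
  from filterlim_compose[OF this mu] have y': "(\<lambda>n. 2 * exp 12 * \<mu> n ^ 4 * exp (- d * \<mu> n)) \<longlonglongrightarrow> 0" .
  have y: "(\<lambda>n. 2 * real (N n) * (exp 6 * (\<mu> n)\<^sup>2 * exp (- \<mu> n))\<^sup>2) \<longlonglongrightarrow> 0"
  proof (rule tendsto_sandwich[OF _ _ tendsto_const y'])
    show "eventually (\<lambda>n. 0 \<le> 2 * real (N n) * (exp 6 * (\<mu> n)\<^sup>2 * exp (- \<mu> n))\<^sup>2) sequentially"
      by simp
    show "eventually (\<lambda>n. 2 * real (N n) * (exp 6 * (\<mu> n)\<^sup>2 * exp (- \<mu> n))\<^sup>2 \<le>
        2 * exp 12 * \<mu> n ^ 4 * exp (- d * \<mu> n)) sequentially"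
      using p N1
    proof eventually_elim
      case (elim n)
      have "ln (real (N n)) \<le> \<mu> n / c" using elim(1) c0 by (simp add: \<mu>_def field_simps)
      hence "exp (ln (real (N n))) \<le> exp (\<mu> n / c)" by simp
      hence le: "real (N n) \<le> exp (\<mu> n / c)" using elim(2) by simp
      have "2 * real (N n) * (exp 6 * (\<mu> n)\<^sup>2 * exp (- \<mu> n))\<^sup>2 =
          2 * (exp 6)\<^sup>2 * \<mu> n ^ 4 * (real (N n) * (exp (- \<mu> n))\<^sup>2)"
        by (simp add: power_mult_distrib power_mult[symmetric])
      also have "\<dots> \<le> 2 * (exp 6)\<^sup>2 * \<mu> n ^ 4 * (exp (\<mu> n / c) * (exp (- \<mu> n))\<^sup>2)"
        by (intro mult_left_mono mult_right_mono le) auto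
      also have "(exp (6 :: real))\<^sup>2 = exp 12" by (simp add: exp_double[symmetric])
      also have "exp (\<mu> n / c) * (exp (- \<mu> n))\<^sup>2 = exp (- d * \<mu> n)"
        by (simp add: exp_double[symmetric] exp_add[symmetric] d_def algebra_simps)
      finally show ?case .
    qed
  qed
  have "((\<lambda>x::real. x * exp (1 - x / 125)) \<longlongrightarrow> 0) at_top" by real_asymp
  from filterlim_compose[OF this RN]
  have z: "(\<lambda>n. real (N n) * exp (1 - real (N n) / 125)) \<longlonglongrightarrow> 0" .
  have "(\<lambda>n. 2 * real (N n) * (exp 6 * (\<mu> n)\<^sup>2 * exp (- \<mu> n))\<^sup>2 +
      2 * (exp 6 * (\<mu> n)\<^sup>2 * exp (- \<mu> n / 2))\<^sup>2 + real (N n) * exp (1 - real (N n) / 125)) \<longlonglongrightarrow>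
      0 + 2 * 0\<^sup>2 + 0"
    by (intro tendsto_add tendsto_mult tendsto_power tendsto_const x y z)
  thus rb: "(\<lambda>n. rigid_bound (N n) (p n)) \<longlonglongrightarrow> 0"
    unfolding rigid_bound_def Let_def \<mu>_def by simp
  have "((\<lambda>x::real. exp 1 * (x + 1) * exp (- x)) \<longlongrightarrow> 0) at_top" by real_asymp
  from filterlim_compose[OF this mu] have "(\<lambda>n. exp 1 * (\<mu> n + 1) * exp (- \<mu> n)) \<longlonglongrightarrow> 0" .
  from tendsto_add[OF rb this] have sb: "(\<lambda>n. sharp_bound (N n) (p n)) \<longlonglongrightarrow> 0"
    unfolding sharp_bound_def \<mu>_def by simp
  have rowb: "(\<lambda>n. row_bound (N n) (p n)) \<longlonglongrightarrow> 0"
  proof (rule tendsto_sandwich[OF _ _ tendsto_const])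
    have "((\<lambda>x::real. 2 / sqrt (x / 800) + sqrt (7 / sqrt (x / 800))) \<longlongrightarrow> 0) at_top" by real_asymp
    from filterlim_compose[OF this mu]
    show "(\<lambda>n. 2 / sqrt (\<mu> n / 800) + sqrt (7 / sqrt (\<mu> n / 800))) \<longlonglongrightarrow> 0" .
    have ev: "eventually (\<lambda>n. 0 \<le> row_bound (N n) (p n) \<and>
      row_bound (N n) (p n) \<le> 2 / sqrt (\<mu> n / 800) + sqrt (7 / sqrt (\<mu> n / 800))) sequentially"
      using mu1 N1
    proof eventually_elim
      case (elim n)
      have pp: "p n > 0" using elim p_pos by simp
      \<comment> \<open>Once \<open>N\<close> is at least 400, the remainder is smaller than
        \<open>400 * (N div 400)\<close>; rounding down costs at most a factor 2, hence 800.\<close>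
      have "N n div 400 > 0" using elim(2) by (simp add: div_greater_zero_iff)
      moreover have "N n = 400 * (N n div 400) + N n mod 400" "N n mod 400 < 400" by simp_all
      ultimately have "N n \<le> 800 * (N n div 400)" by linarith
      hence "real (N n) \<le> real (800 * (N n div 400))" by (simp only: of_nat_le_iff)
      hence "real (N n) / 800 \<le> real (N n div 400)" by simp
      hence "p n * (real (N n) / 800) \<le> p n * real (N n div 400)" using pp by (intro mult_left_mono) auto
      hence le: "sqrt (\<mu> n / 800) \<le> sqrt (p n * real (N n div 400))" unfolding \<mu>_def by (simp add: mult.commute)
      have pos: "sqrt (\<mu> n / 800) > 0" using elim by simp
      show ?case
      proof
        show "0 \<le> row_bound (N n) (p n)" using pp by (simp add: row_bound_def Let_def)
        have "x / sqrt (p n * real (N n div 400)) \<le> x / sqrt (\<mu> n / 800)" if "x \<ge> 0" for x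
          using frac_le[OF that order_refl pos le] .
        thus "row_bound (N n) (p n) \<le> 2 / sqrt (\<mu> n / 800) + sqrt (7 / sqrt (\<mu> n / 800))"
          unfolding row_bound_def Let_def by (intro add_mono real_sqrt_le_mono) simp_all
      qed
    qed
    show "eventually (\<lambda>n. 0 \<le> row_bound (N n) (p n)) sequentially"
      using ev by eventually_elim simp
    show "eventually (\<lambda>n. row_bound (N n) (p n) \<le> 2 / sqrt (\<mu> n / 800) + sqrt (7 / sqrt (\<mu> n / 800))) sequentially"
      using ev by eventually_elim simp
  qed
  have "(\<lambda>n. rigid_bound (N n) (p n) + 2 * sharp_bound (N n) (p n) + row_bound (N n) (p n)) \<longlonglongrightarrow> 0 + 2 * 0 + 0"
    by (intro tendsto_add tendsto_mult tendsto_const rb sb rowb)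
  thus "(\<lambda>n. vertex_bound (N n) (p n)) \<longlonglongrightarrow> 0" unfolding vertex_bound_def by simp
  have "eventually (\<lambda>n. exp 6 * (\<mu> n)\<^sup>2 * exp (- \<mu> n / 2) < 1 / 2) sequentially"
    by (rule order_tendstoD(2)[OF x]) simp
  thus "eventually (\<lambda>n. admissible (N n) (p n)) sequentially"
    using mu1 p2
  proof eventually_elim
    case (elim n)
    have "p n > 0" using elim p_pos by simp
    thus ?case using elim unfolding admissible_def \<mu>_def by simp
  qed
qed

theorem corollary1p4:
  fixes c :: real and p :: "nat \<Rightarrow> real"
  assumes "c > 1 / 2"
    and "\<forall>\<^sub>F n in sequentially. c * ln (real n) / real n < p n \<and> p n < 1 / 2"
  shows "(\<lambda>n. measure_pmf.prob (random_graph n (p n))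
            {G. nonsingular (giant_component G)}) \<longlonglongrightarrow> 1"
proof -
  \<comment> \<open>Since ln x / x decreases, the bound with \<open>c\<close> on n vertices need not
    hold on n - 1 vertices. Any constant strictly between 1 / 2 and \<open>c\<close> absorbs the
    loss; this is the midpoint.\<close>
  define c' where "c' = (c + 1 / 2) / 2"
  have c': "1 / 2 < c'" "c' < c" unfolding c'_def using assms(1) by auto
  have half: "eventually (\<lambda>n. p n \<le> 1 / 2) sequentially"
    using assms(2) by eventually_elim simp
  have p: "eventually (\<lambda>n. c * ln (real n) \<le> real n * p n) sequentially"
    using assms(2) eventually_gt_at_top[of 0]
    by eventually_elim (simp add: field_simps less_imp_le)
  have "eventually (\<lambda>n::nat. c' * real n \<le> c * real (n - 1)) sequentially"
    using c' by real_asymp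
  hence p': "eventually (\<lambda>n. c' * ln (real (n - 1)) \<le> real (n - 1) * p n) sequentially"
    using p eventually_gt_at_top[of 2]
  proof eventually_elim
    case (elim n)
    have "real n * (c' * ln (real (n - 1))) \<le> real n * (c' * ln (real n))"
      using elim c' by (intro mult_left_mono) auto
    also have "\<dots> = (c' * real n) * ln (real n)" by simp
    also have "\<dots> \<le> (c * real (n - 1)) * ln (real n)"
      using elim by (intro mult_right_mono) auto
    also have "\<dots> = real (n - 1) * (c * ln (real n))" by simp
    also have "\<dots> \<le> real (n - 1) * (real n * p n)" by (intro mult_left_mono elim) auto
    finally have "real n * (c' * ln (real (n - 1))) \<le> real n * (real (n - 1) * p n)" by (simp add: mult_ac)
    thus ?case using elim(3) by simp
  qed
  have N: "filterlim (\<lambda>n::nat. n) at_top sequentially" "filterlim (\<lambda>n::nat. n - 1) at_top sequentially"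
    by (rule filterlim_ident, rule filterlim_minus_const_nat_at_top)
  note b = bounds_tendsto_0[OF assms(1) N(1) p half]
  note b' = bounds_tendsto_0[OF c'(1) N(2) p' half]
  have "((\<lambda>x::real. exp 1 * exp (- x)) \<longlongrightarrow> 0) at_top" by real_asymp
  from filterlim_compose[OF this b(1)] have e: "(\<lambda>n. exp 1 * exp (- (real n * p n))) \<longlonglongrightarrow> 0" .
  have "(\<lambda>n. 1 - (rigid_bound n (p n) + 200 * vertex_bound (n - 1) (p n) +
      exp 1 * exp (- (real n * p n)))) \<longlonglongrightarrow> 1 - (0 + 200 * 0 + 0)"
    by (intro tendsto_diff tendsto_add tendsto_mult tendsto_const b(2) b'(3) e)
  hence lower: "(\<lambda>n. 1 - (kernel_bound n (p n) + exp 1 * exp (- (real n * p n)))) \<longlonglongrightarrow> 1"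
    unfolding kernel_bound_def by simp
  show ?thesis
  proof (rule tendsto_sandwich[OF _ _ lower tendsto_const])
    show "eventually (\<lambda>n. 1 - (kernel_bound n (p n) + exp 1 * exp (- (real n * p n))) \<le>
        measure_pmf.prob (random_graph n (p n)) {G. nonsingular (giant_component G)}) sequentially"
      using b(4) b'(4) eventually_gt_at_top[of 400]
      by eventually_elim (rule prob_nonsingular_giant_component_ge)
  qed simp
qed

end
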